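(* Consider the random greedy algorithm for triangle-packing on $n$ vertices: $G(0)$ is the complete graph on vertex set $[n]$ and, as long as $G(i)$ contains a triangle, $G(i+1)$ is obtained from $G(i)$ by removing the three edges of a triangle chosen uniformly at random from the set of all triangles in $G(i)$. Let $M$ be the number of steps it takes the algorithm to terminate (that is, $G(M)$ is triangle-free), and let $E(M)$ be the edge set of the resulting triangle-free graph $G(M)$. Then with high probability $|E(M)| = O\big(n^{5/3}\log^4 n\big)$; that is, there is an absolute constant $C>0$ such that $\mathbb{P}\big(|E(M)| \le C n^{5/3}\log^4 n\big) \to 1$ as $n\to\infty$.
   Context: A triangle is a copy of $K_3$. The $i$-th graph $G(i)$ is the graph remaining after $i$ triangles have been removed; each random choice is uniform over the triangles of the current graph, given the history of the process. An event (depending on $n$) holds with high probability if its probability tends to $1$ as $n\to\infty$. *)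

theory Defs
  imports "HOL-Probability.Probability_Mass_Function"
begin

text \<open>A graph is represented by its edge set, an edge being a two-element set of vertices.
  The vertex set of the process, \<open>{1..n}\<close>, never changes. A triangle is represented by its
  vertex set; \<open>all_edges T\<close> is then the set of its three edges.\<close>

type_synonym graph = "nat set set"

definition all_edges :: "nat set \<Rightarrow> graph" where
  "all_edges V = {e. e \<subseteq> V \<and> card e = 2}"

definition triangles :: "graph \<Rightarrow> nat set set" where
  "triangles E = {T. card T = 3 \<and> all_edges T \<subseteq> E}"

lemma Union_all_edges: "card T = 3 \<Longrightarrow> \<Union> (all_edges T) = T"
proof -
  assume "card T = 3"
  then obtain a b c where T: "T = {a, b, c}" "a \<noteq> b" "b \<noteq> c" "a \<noteq> c"
    by (auto simp: card_3_iff)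
  then have "{a, b} \<in> all_edges T" "{a, c} \<in> all_edges T"
    by (auto simp: all_edges_def)
  moreover have "\<Union> (all_edges T) \<subseteq> T" by (auto simp: all_edges_def)
  ultimately show ?thesis using T(1) by blast
qed

lemma finite_triangles: "finite E \<Longrightarrow> finite (triangles E)"
proof (rule finite_subset)
  show "triangles E \<subseteq> Union ` Pow E"
  proof
    fix T assume "T \<in> triangles E"
    then have "T = \<Union> (all_edges T)" "all_edges T \<in> Pow E"
      by (auto simp: triangles_def Union_all_edges)
    then show "T \<in> Union ` Pow E" by (rule image_eqI)
  qed
qed simp

lemma card_remove_triangle:
  assumes "finite E" "T \<in> triangles E"
  shows "card (E - all_edges T) < card E"
proof (rule psubset_card_mono[OF assms(1)])
  have "card T = 3" "all_edges T \<subseteq> E" using assms(2) by (auto simp: triangles_def)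
  moreover have "all_edges T \<noteq> {}"
    using Union_all_edges[OF \<open>card T = 3\<close>] \<open>card T = 3\<close> by auto
  ultimately show "E - all_edges T \<subset> E" by blast
qed

text \<open>The law of the whole trajectory \<open>[G 0, \<dots>, G M]\<close> of the process started at \<open>E\<close>; it stops at
  the first triangle-free graph. The guard \<open>finite E\<close>, true for all graphs that occur on
  \<open>n\<close> vertices, is needed only to make the recursion total.\<close>

function trajectory :: "graph \<Rightarrow> graph list pmf" where
  "trajectory E =
     (if finite E \<and> triangles E \<noteq> {}
      then bind_pmf (pmf_of_set (triangles E))
             (\<lambda>T. map_pmf ((#) E) (trajectory (E - all_edges T)))
      else return_pmf [E])"
  by auto
termination
  by (relation "Wellfounded.measure card") (auto simp: finite_triangles card_remove_triangle)

declare trajectory.simps [simp del]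

definition triangle_packing_process :: "nat \<Rightarrow> graph list pmf" where
  "triangle_packing_process n = trajectory (all_edges {1..n})"

text \<open>In a trajectory \<open>G\<close>, the \<open>i\<close>-th graph is \<open>G ! i\<close>.\<close>

definition num_steps :: "graph list \<Rightarrow> nat" where
  "num_steps G = length G - 1"

text \<open>\<open>num_steps G\<close> is the first index at which the graph is triangle-free.\<close>

lemma trajectory_stops_at_triangle_free:
  assumes "finite E" "G \<in> set_pmf (trajectory E)"
  shows "G \<noteq> [] \<and> G ! 0 = E \<and> triangles (G ! num_steps G) = {}
    \<and> (\<forall>i < num_steps G. \<exists>T \<in> triangles (G ! i). G ! Suc i = G ! i - all_edges T)"
  using assms
proof (induction E arbitrary: G rule: trajectory.induct)
  case (1 E)
  show ?case
  proof (cases "triangles E = {}")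
    case True
    then have "G = [E]" using "1.prems" by (simp add: trajectory.simps[of E])
    then show ?thesis using True by (simp add: num_steps_def)
  next
    case False
    then have supp: "set_pmf (pmf_of_set (triangles E)) = triangles E"
      using finite_triangles[OF "1.prems"(1)] by simp
    obtain T H where T: "T \<in> triangles E" and H: "H \<in> set_pmf (trajectory (E - all_edges T))"
      and G: "G = E # H"
      using "1.prems" False supp by (auto simp: trajectory.simps[of E])
    have IH: "H \<noteq> [] \<and> H ! 0 = E - all_edges T \<and> triangles (H ! num_steps H) = {}
      \<and> (\<forall>i < num_steps H. \<exists>T \<in> triangles (H ! i). H ! Suc i = H ! i - all_edges T)"
      using "1.IH"[of T H] False "1.prems"(1) T H supp by simp
    then have steps: "num_steps G = Suc (num_steps H)"
      by (cases H) (auto simp: G num_steps_def)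
    show ?thesis
    proof (intro conjI allI impI)
      fix i assume "i < num_steps G"
      then show "\<exists>T \<in> triangles (G ! i). G ! Suc i = G ! i - all_edges T"
        using IH T by (cases i) (auto simp: G steps[unfolded G])
    qed (use IH in \<open>auto simp: G steps[unfolded G]\<close>)
  qed
qed

end

theory Submission
  imports Defs
begin

text \<open>Write \<open>p\<close> for the edge density, \<open>c = n p\<^sup>2\<close> for the expected codegree, \<open>L = ln n\<close> and
  \<open>\<beta> = L / sqrt (n p\<^sup>3)\<close>. Down to density \<open>n\<^bsup>-1/3\<^esup> L\<^sup>4\<close> the following quantities stay within
  relative error \<open>O(\<beta>) = o(1)\<close> of their values in a random graph of density \<open>p\<close>: the number of
  triangles, the number of common neighbours of one, two and three vertices, and, for
  \<open>u \<in> R\<close> with \<open>card R \<le> 2\<close>, the sum over the common neighbours \<open>w\<close> of \<open>R\<close> of the codegree of the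
  edge \<open>uw\<close>. In particular triangles still exist there.

  In logarithmic time \<open>- ln p\<close> the bound \<open>\<beta>\<close> grows at rate \<open>3/2\<close>, so it suffices that the relative
  errors grow at a smaller rate. Bounding the decay of a codegree by the worst codegree deviation
  would give rate \<open>2\<close>. Instead, the deviation of a codegree of \<open>uv\<close> is driven by the average
  deviations \<open>a\<^bsub>uv\<^esub>\<close> of the codegrees of \<open>uw\<close> over common neighbours \<open>w\<close>, and since triple
  codegrees are concentrated, \<open>a\<^bsub>uv\<^esub>\<close> changes at rate \<open>- avg\<^sub>w a\<^bsub>wu\<^esub> - a\<^bsub>u\<^esub>\<close> only, where
  \<open>a\<^bsub>u\<^esub>\<close>, the average over all neighbours of \<open>u\<close>, is itself self-correcting.

  Concentration is obtained from the potential \<open>\<Sum> exp (M (\<plusminus> deviation / bound - 1))\<close>, with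
  \<open>M = 4000 L\<close>: it is at least 1 as soon as some bound fails, tiny for the complete graph, and up
  to a negligible additive term it does not grow in expectation as long as all bounds hold. Hence
  the probability of failure is bounded by recursion along the trajectory.\<close>

section \<open>Counting configurations destroyed by a triangle\<close>

text \<open>The \<open>p\<^sup>3\<close> under the root of \<beta> comes from the smallest tracked
  quantities, the triple codegrees of size \<open>n p\<^sup>3\<close>: a count of size
  \<open>X\<close> fed by bounded steps fluctuates by about \<open>sqrt X\<close>, so the relative
  fluctuation is at most about \<open>1 / sqrt (n p\<^sup>3)\<close>. The numerator \<open>L\<close>
  of \<beta> pays for the exponential: it gives \<open>\<beta>\<^sup>2 X \<ge> L\<^sup>2\<close>,
  whereas \<open>M\<close> has only order \<open>L\<close>, so the second-order term of the
  exponential is smaller than the drift by a factor of order \<open>L\<close>. All quantities share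
  the same \<beta>; whether the estimates close is decided by the constants in front of it alone.

  The link sums are compared with \<open>n p\<^sup>2\<close> times the actual codegree rather than
  with \<open>n\<^sup>2 p ^ (card R + 2)\<close>. The loss of common neighbours then cancels from
  their drift to first order, up to the natural decay of the deviation, and only the other two edges
  of the counted paths drive them.\<close>

definition nb :: "graph \<Rightarrow> nat set \<Rightarrow> nat set" where
  "nb E R = {w. \<forall>u\<in>R. {u, w} \<in> E}"

definition cod :: "graph \<Rightarrow> nat set \<Rightarrow> real" where
  "cod E R = real (card (nb E R))"

definition tri_deg :: "graph \<Rightarrow> nat set \<Rightarrow> real" where
  "tri_deg E e = real (card {T \<in> triangles E. e \<in> all_edges T})"

text \<open>The edge set on which a common neighbour \<open>w\<close> of \<open>R\<close> depends:
  \<open>w\<close> is lost exactly when a removed edge lies in it.\<close>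

definition star :: "nat set \<Rightarrow> nat \<Rightarrow> graph" where
  "star R w = (\<lambda>r. {r, w}) ` R"

lemma all_edges_triple:
  assumes "a \<noteq> b" "b \<noteq> c" "a \<noteq> c"
  shows "all_edges {a, b, c} = {{a, b}, {a, c}, {b, c}}"
proof
  show "all_edges {a, b, c} \<subseteq> {{a, b}, {a, c}, {b, c}}"
  proof
    fix e assume "e \<in> all_edges {a, b, c}"
    then have e: "e \<subseteq> {a, b, c}" "card e = 2" by (auto simp: all_edges_def)
    then obtain x y where "e = {x, y}" "x \<noteq> y" by (auto simp: card_2_iff)
    then show "e \<in> {{a, b}, {a, c}, {b, c}}" using e(1) by auto
  qed
qed (use assms in \<open>auto simp: all_edges_def card_2_iff\<close>)

lemma card_all_edges_triple: "card T = 3 \<Longrightarrow> card (all_edges T) = 3"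
proof -
  assume "card T = 3"
  then obtain a b c where T: "T = {a, b, c}" "a \<noteq> b" "b \<noteq> c" "a \<noteq> c"
    by (auto simp: card_3_iff)
  then show ?thesis by (simp add: all_edges_triple doubleton_eq_iff)
qed

lemma all_edges_determine:
  assumes "card T = 3" "e \<in> all_edges T" "f \<in> all_edges T" "e \<noteq> f"
  shows "T = e \<union> f"
proof -
  obtain a b c where "T = {a, b, c}" "a \<noteq> b" "b \<noteq> c" "a \<noteq> c"
    using assms(1) by (auto simp: card_3_iff)
  then show ?thesis using assms by (auto simp: all_edges_triple)
qed

lemma finite_all_edges: "finite V \<Longrightarrow> finite (all_edges V)"
  by (rule finite_subset[of _ "Pow V"]) (auto simp: all_edges_def)

lemma card_star_le: "finite R \<Longrightarrow> card (star R w) \<le> card R"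
  unfolding star_def by (rule card_image_le)

text \<open>These are the pairs counted by the sum of codegrees \<open>lsum E u R\<close>. Reading
  that sum as a count of configurations lets it lose whole configurations when edges vanish, just as
  a codegree does.\<close>

definition paths :: "graph \<Rightarrow> nat \<Rightarrow> nat set \<Rightarrow> (nat \<times> nat) set" where
  "paths E u R = (SIGMA w:nb E R. nb E {u, w})"

text \<open>Divided by \<open>cod E R\<close> and compared with \<open>c\<close>, this is the
  average deviation of the overview, over common neighbours for \<open>R = {u, v}\<close> and over
  all neighbours for \<open>R = {u}\<close>.\<close>

definition lsum :: "graph \<Rightarrow> nat \<Rightarrow> nat set \<Rightarrow> real" where
  "lsum E u R = (\<Sum>w\<in>nb E R. cod E {u, w})"

definition path_edges :: "nat \<Rightarrow> nat set \<Rightarrow> nat \<times> nat \<Rightarrow> graph" where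
  "path_edges u R = (\<lambda>(w, x). star R w \<union> {{u, x}, {w, x}})"

lemma card_filter_drop:
  assumes "finite K" "K' = {\<kappa> \<in> K. \<not> P \<kappa>}"
  shows "real (card K) - real (card K') = real (card {\<kappa> \<in> K. P \<kappa>})"
proof -
  have "K = K' \<union> {\<kappa> \<in> K. P \<kappa>}" "K' \<inter> {\<kappa> \<in> K. P \<kappa>} = {}" using assms(2) by auto
  then have "card K = card K' + card {\<kappa> \<in> K. P \<kappa>}"
    using assms by (metis (no_types, lifting) card_Un_disjoint finite_Un)
  then show ?thesis by simp
qed

section \<open>Triangles meeting a given edge set\<close>

locale graph_on =
  fixes V :: "nat set" and E :: graph
  assumes finite_V: "finite V" and E_sub: "E \<subseteq> all_edges V"
begin

lemma finite_E: "finite E"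
  using E_sub finite_all_edges[OF finite_V] finite_subset by blast

lemma edgeD: assumes "{u, w} \<in> E" shows "u \<noteq> w" "u \<in> V" "w \<in> V"
proof -
  have "{u, w} \<subseteq> V" "card {u, w} = 2" using assms E_sub by (auto simp: all_edges_def)
  then show "u \<noteq> w" "u \<in> V" "w \<in> V" by auto
qed

lemma finite_tri: "finite (triangles E)"
  by (rule finite_triangles[OF finite_E])

lemma nb_sub: "R \<noteq> {} \<Longrightarrow> nb E R \<subseteq> V"
  using edgeD by (auto simp: nb_def)

lemma finite_nb: "R \<noteq> {} \<Longrightarrow> finite (nb E R)"
  using nb_sub finite_V finite_subset by blast

lemma edge_pair: assumes "e \<in> E" obtains u w where "e = {u, w}" "u \<noteq> w"
  using assms E_sub by (auto simp: all_edges_def card_2_iff)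

lemma tri_deg_eq_cod:
  assumes "{u, w} \<in> E"
  shows "tri_deg E {u, w} = cod E {u, w}"
proof -
  have uw: "u \<noteq> w" using edgeD[OF assms] by simp
  have "bij_betw (\<lambda>x. {u, w, x}) (nb E {u, w}) {T \<in> triangles E. {u, w} \<in> all_edges T}"
  proof (rule bij_betwI')
    fix x y assume "x \<in> nb E {u, w}" "y \<in> nb E {u, w}"
    then have "x \<noteq> u" "x \<noteq> w" "y \<noteq> u" "y \<noteq> w" using edgeD by (auto simp: nb_def)
    then show "({u, w, x} = {u, w, y}) = (x = y)" by auto
  next
    fix x assume x: "x \<in> nb E {u, w}"
    then have "x \<noteq> u" "x \<noteq> w" using edgeD by (auto simp: nb_def)
    then show "{u, w, x} \<in> {T \<in> triangles E. {u, w} \<in> all_edges T}"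
      using x assms uw by (auto simp: triangles_def nb_def all_edges_triple)
  next
    fix T assume T: "T \<in> {T \<in> triangles E. {u, w} \<in> all_edges T}"
    then have "{u, w} \<subseteq> T" "card T = 3" by (auto simp: triangles_def all_edges_def)
    then have "card (T - {u, w}) = 1"
      using uw by (subst card_Diff_subset) auto
    then obtain x where x: "T - {u, w} = {x}" by (auto simp: card_1_singleton_iff)
    then have "T = {u, w, x}" "x \<noteq> u" "x \<noteq> w" using \<open>{u, w} \<subseteq> T\<close> by auto
    moreover from this have "x \<in> nb E {u, w}"
      using T uw by (auto simp: triangles_def nb_def all_edges_triple)
    ultimately show "\<exists>x\<in>nb E {u, w}. T = {u, w, x}" by blast
  qed
  then show ?thesis by (simp add: tri_deg_def cod_def bij_betw_same_card)
qed

text \<open>Double counting of the pairs \<open>(T, e)\<close> with \<open>e\<close> in both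
  \<open>all_edges T\<close> and \<open>F\<close>.\<close>

lemma sum_inter_tri_deg:
  assumes "F \<subseteq> E"
  shows "(\<Sum>T\<in>triangles E. real (card (all_edges T \<inter> F))) = (\<Sum>e\<in>F. tri_deg E e)"
proof -
  have fin: "finite F" using assms finite_E finite_subset by blast
  have "(\<Sum>T\<in>triangles E. real (card (all_edges T \<inter> F)))
      = (\<Sum>T\<in>triangles E. \<Sum>e\<in>F. if e \<in> all_edges T then 1 else 0)"
    by (intro sum.cong refl) (simp add: sum.If_cases[OF fin] Int_commute Int_def)
  also have "\<dots> = (\<Sum>e\<in>F. \<Sum>T\<in>triangles E. if e \<in> all_edges T then 1 else 0)"
    by (rule sum.swap)
  also have "\<dots> = (\<Sum>e\<in>F. tri_deg E e)"
    by (intro sum.cong refl) (simp add: tri_deg_def sum.If_cases[OF finite_tri] Int_def)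
  finally show ?thesis .
qed

definition hits :: "graph \<Rightarrow> real" where
  "hits F = real (card {T \<in> triangles E. all_edges T \<inter> F \<noteq> {}})"

text \<open>Inclusion-exclusion, cut off after one term and after two. Two distinct edges lie in at
  most one common triangle, so all pairs of edges of \<open>F\<close> together cost at most
  \<open>card F ^ 2\<close>, while each term of the main sum is a codegree.\<close>

lemma hits_bounds:
  assumes "F \<subseteq> E"
  shows "hits F \<le> (\<Sum>e\<in>F. tri_deg E e)"
    and "(\<Sum>e\<in>F. tri_deg E e) - real (card F)^2 \<le> hits F"
proof -
  have fin: "finite F" using assms finite_E finite_subset by blast
  have hits_sum: "hits F = (\<Sum>T\<in>triangles E. if all_edges T \<inter> F \<noteq> {} then 1 else 0)"
    by (simp add: hits_def sum.If_cases[OF finite_tri] Int_def)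
  show "hits F \<le> (\<Sum>e\<in>F. tri_deg E e)"
    unfolding hits_sum sum_inter_tri_deg[OF assms, symmetric]
  proof (rule sum_mono)
    fix T
    have "finite (all_edges T \<inter> F)" using fin by simp
    then show "(if all_edges T \<inter> F \<noteq> {} then 1 else 0) \<le> real (card (all_edges T \<inter> F))"
      by (auto simp: Suc_le_eq card_gt_0_iff)
  qed
  define P where "P = {(e, f) \<in> F \<times> F. e \<noteq> f}"
  have "finite P" unfolding P_def by (rule finite_subset[of _ "F \<times> F"]) (use fin in auto)
  have le1: "(\<Sum>T\<in>triangles E. if e \<in> all_edges T \<and> f \<in> all_edges T then 1 else 0) \<le> (1::real)"
    if "(e, f) \<in> P" for e f
  proof -
    have "{T \<in> triangles E. e \<in> all_edges T \<and> f \<in> all_edges T} \<subseteq> {e \<union> f}"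
      using that all_edges_determine by (auto simp: P_def triangles_def)
    then have "card {T \<in> triangles E. e \<in> all_edges T \<and> f \<in> all_edges T} \<le> 1"
      using card_mono[of "{e \<union> f}"] by simp
    then show ?thesis by (simp add: sum.If_cases[OF finite_tri] Int_def)
  qed
  have "(\<Sum>e\<in>F. tri_deg E e) - hits F
      = (\<Sum>T\<in>triangles E. real (card (all_edges T \<inter> F)) - (if all_edges T \<inter> F \<noteq> {} then 1 else 0))"
    unfolding hits_sum sum_inter_tri_deg[OF assms, symmetric] sum_subtractf ..
  \<comment> \<open>A triangle with \<open>k > 0\<close> edges in \<open>F\<close> is counted
    \<open>k - 1\<close> times too often. Fixing one of these edges, the other \<open>k - 1\<close>
    already provide that many ordered pairs.\<close>
  also have "\<dots> \<le> (\<Sum>T\<in>triangles E. \<Sum>(e, f)\<in>P. if e \<in> all_edges T \<and> f \<in> all_edges T then 1 else 0)"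
  proof (rule sum_mono)
    fix T
    let ?I = "all_edges T \<inter> F"
    have I: "finite ?I" using fin by simp
    have "(\<Sum>(e, f)\<in>P. if e \<in> all_edges T \<and> f \<in> all_edges T then 1 else (0::real))
        = (\<Sum>x\<in>P. if fst x \<in> all_edges T \<and> snd x \<in> all_edges T then 1 else 0)"
      by (simp add: case_prod_unfold)
    also have "\<dots> = real (card (P \<inter> {x. fst x \<in> all_edges T \<and> snd x \<in> all_edges T}))"
      by (simp add: sum.If_cases[OF \<open>finite P\<close>])
    also have "P \<inter> {x. fst x \<in> all_edges T \<and> snd x \<in> all_edges T} = {(e, f) \<in> ?I \<times> ?I. e \<noteq> f}"
      unfolding P_def by auto
    finally have eq: "(\<Sum>(e, f)\<in>P. if e \<in> all_edges T \<and> f \<in> all_edges T then 1 else (0::real))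
        = card {(e, f) \<in> ?I \<times> ?I. e \<noteq> f}" .
    have fin2: "finite {(e, f) \<in> ?I \<times> ?I. e \<noteq> f}"
      by (rule finite_subset[of _ "?I \<times> ?I"]) (use I in auto)
    show "real (card ?I) - (if ?I \<noteq> {} then 1 else 0)
      \<le> (\<Sum>(e, f)\<in>P. if e \<in> all_edges T \<and> f \<in> all_edges T then 1 else 0)"
    proof (cases "?I = {}")
      case False
      then obtain e where e: "e \<in> ?I" by blast
      have "card (?I - {e}) = card ((\<lambda>f. (e, f)) ` (?I - {e}))"
        by (subst card_image) (auto simp: inj_on_def)
      also have "\<dots> \<le> card {(e, f) \<in> ?I \<times> ?I. e \<noteq> f}"
        by (rule card_mono[OF fin2]) (use e in blast)
      finally have "card ?I \<le> card {(e, f) \<in> ?I \<times> ?I. e \<noteq> f} + 1" using e I by simp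
      then show ?thesis unfolding eq using False by simp
    qed (simp add: sum_nonneg case_prod_unfold)
  qed
  also have "\<dots> = (\<Sum>(e, f)\<in>P. \<Sum>T\<in>triangles E. if e \<in> all_edges T \<and> f \<in> all_edges T then 1 else 0)"
    by (subst sum.swap) (simp add: case_prod_unfold)
  also have "\<dots> \<le> (\<Sum>(e, f)\<in>P. 1)" by (rule sum_mono) (use le1 in auto)
  also have "\<dots> \<le> real (card F)^2"
  proof -
    have "card P \<le> card (F \<times> F)" by (rule card_mono) (use fin in \<open>auto simp: P_def\<close>)
    then have "real (card P) \<le> real (card (F \<times> F))" by linarith
    then show ?thesis by (simp add: case_prod_unfold card_cartesian_product power2_eq_square)
  qed
  finally show "(\<Sum>e\<in>F. tri_deg E e) - real (card F)^2 \<le> hits F" by simp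
qed

text \<open>\<open>K\<close> is a set of configurations present in \<open>E\<close> and \<open>F \<kappa>\<close> the edge set that \<open>\<kappa>\<close> needs.\<close>

lemma sum_drop:
  assumes "finite K" and F: "\<And>\<kappa>. \<kappa> \<in> K \<Longrightarrow> F \<kappa> \<subseteq> E" "\<And>\<kappa>. \<kappa> \<in> K \<Longrightarrow> card (F \<kappa>) \<le> k"
  defines "dr \<equiv> \<lambda>T. real (card {\<kappa> \<in> K. all_edges T \<inter> F \<kappa> \<noteq> {}})"
  shows "(\<Sum>T\<in>triangles E. dr T) \<le> (\<Sum>\<kappa>\<in>K. \<Sum>e\<in>F \<kappa>. tri_deg E e)"
    and "(\<Sum>\<kappa>\<in>K. \<Sum>e\<in>F \<kappa>. tri_deg E e) - real k^2 * real (card K) \<le> (\<Sum>T\<in>triangles E. dr T)"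
proof -
  have "(\<Sum>T\<in>triangles E. dr T)
      = (\<Sum>T\<in>triangles E. \<Sum>\<kappa>\<in>K. if all_edges T \<inter> F \<kappa> \<noteq> {} then 1 else 0)"
    unfolding dr_def by (simp add: sum.If_cases[OF assms(1)] Int_def)
  also have "\<dots> = (\<Sum>\<kappa>\<in>K. \<Sum>T\<in>triangles E. if all_edges T \<inter> F \<kappa> \<noteq> {} then 1 else 0)"
    by (rule sum.swap)
  also have "\<dots> = (\<Sum>\<kappa>\<in>K. hits (F \<kappa>))"
    by (simp add: hits_def sum.If_cases[OF finite_tri] Int_def)
  finally have eq: "(\<Sum>T\<in>triangles E. dr T) = (\<Sum>\<kappa>\<in>K. hits (F \<kappa>))" .
  show "(\<Sum>T\<in>triangles E. dr T) \<le> (\<Sum>\<kappa>\<in>K. \<Sum>e\<in>F \<kappa>. tri_deg E e)"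
    unfolding eq by (intro sum_mono hits_bounds(1) F(1))
  have "(\<Sum>\<kappa>\<in>K. (\<Sum>e\<in>F \<kappa>. tri_deg E e) - real k^2) \<le> (\<Sum>\<kappa>\<in>K. hits (F \<kappa>))"
  proof (rule sum_mono)
    fix \<kappa> assume "\<kappa> \<in> K"
    have "real (card (F \<kappa>))^2 \<le> real k^2"
      using F(2)[OF \<open>\<kappa> \<in> K\<close>] by (intro power_mono) auto
    then show "(\<Sum>e\<in>F \<kappa>. tri_deg E e) - real k^2 \<le> hits (F \<kappa>)"
      using hits_bounds(2)[OF F(1)[OF \<open>\<kappa> \<in> K\<close>]] by linarith
  qed
  then show "(\<Sum>\<kappa>\<in>K. \<Sum>e\<in>F \<kappa>. tri_deg E e) - real k^2 * real (card K) \<le> (\<Sum>T\<in>triangles E. dr T)"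
    unfolding eq by (simp add: sum_subtractf mult.commute)
qed

lemma triangle_card: "T \<in> triangles E \<Longrightarrow> card T = 3"
  by (simp add: triangles_def)

lemma triangle_finite: "T \<in> triangles E \<Longrightarrow> finite T"
  using triangle_card card.infinite by fastforce

lemma triangle_sub: "T \<in> triangles E \<Longrightarrow> all_edges T \<subseteq> E"
  by (simp add: triangles_def)

lemma graph_on_diff: "graph_on V (E - F)"
  using finite_V E_sub by unfold_locales auto

lemma card_diff_triangle:
  assumes "T \<in> triangles E"
  shows "real (card (E - all_edges T)) = real (card E) - 3"
proof -
  have "card (all_edges T) = 3" using assms by (simp add: card_all_edges_triple triangle_card)
  moreover have "finite (all_edges T)" using triangle_sub[OF assms] finite_E finite_subset by blast
  moreover have "card (all_edges T) \<le> card E" by (rule card_mono[OF finite_E triangle_sub[OF assms]])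
  ultimately show ?thesis using triangle_sub[OF assms] by (simp add: card_Diff_subset)
qed

lemma star_sub: "w \<in> nb E R \<Longrightarrow> star R w \<subseteq> E"
  by (auto simp: star_def nb_def)

lemma sum_star:
  assumes "w \<in> nb E R"
  shows "(\<Sum>e\<in>star R w. tri_deg E e) = (\<Sum>r\<in>R. cod E {r, w})"
proof -
  have "inj_on (\<lambda>r. {r, w}) R" by (auto simp: inj_on_def doubleton_eq_iff)
  then have "(\<Sum>e\<in>star R w. tri_deg E e) = (\<Sum>r\<in>R. tri_deg E {r, w})"
    by (simp add: star_def sum.reindex)
  also have "\<dots> = (\<Sum>r\<in>R. cod E {r, w})"
    by (intro sum.cong refl tri_deg_eq_cod) (use assms in \<open>auto simp: nb_def\<close>)
  finally show ?thesis .
qed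

section \<open>Mean loss of codegrees\<close>

lemma cod_drop:
  assumes "R \<noteq> {}"
  shows "cod E R - cod (E - F) R = real (card {w \<in> nb E R. F \<inter> star R w \<noteq> {}})"
  unfolding cod_def
  by (rule card_filter_drop[OF finite_nb[OF assms]]) (auto simp: nb_def star_def)

lemma cod_drop_nonneg: "R \<noteq> {} \<Longrightarrow> 0 \<le> cod E R - cod (E - F) R"
  using cod_drop by simp

text \<open>A lost common neighbour is an endpoint of a removed edge, hence one of the three
  vertices of \<open>T\<close>.\<close>

lemma cod_drop_le:
  assumes "R \<noteq> {}" "T \<in> triangles E"
  shows "cod E R - cod (E - all_edges T) R \<le> 3"
proof -
  have "{w \<in> nb E R. all_edges T \<inter> star R w \<noteq> {}} \<subseteq> T" by (auto simp: all_edges_def star_def)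
  from card_mono[OF triangle_finite[OF assms(2)] this] show ?thesis
    using triangle_card[OF assms(2)] by (simp add: cod_drop[OF assms(1)])
qed

text \<open>On graphs satisfying the bounds \<open>W\<close> has order \<open>c * cod E R\<close>.
  The correction lacks the factor \<open>c\<close>, which makes it a term of second order in \<beta>
  by \<open>one_le_\<beta>c\<close>.\<close>

lemma cod_drop_sum:
  assumes R: "R \<noteq> {}" "finite R"
  defines "W \<equiv> \<Sum>w\<in>nb E R. \<Sum>r\<in>R. cod E {r, w}"
  shows "(\<Sum>T\<in>triangles E. cod E R - cod (E - all_edges T) R) \<le> W"
    and "W - real (card R)^2 * cod E R \<le> (\<Sum>T\<in>triangles E. cod E R - cod (E - all_edges T) R)"
proof -
  have W: "(\<Sum>w\<in>nb E R. \<Sum>e\<in>star R w. tri_deg E e) = W"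
    unfolding W_def by (intro sum.cong refl sum_star)
  note * = sum_drop[OF finite_nb[OF R(1)], of "star R" "card R",
      OF star_sub card_star_le[OF R(2)], unfolded W cod_drop[OF R(1), symmetric]]
  show "(\<Sum>T\<in>triangles E. cod E R - cod (E - all_edges T) R) \<le> W" by (rule *(1))
  show "W - real (card R)^2 * cod E R \<le> (\<Sum>T\<in>triangles E. cod E R - cod (E - all_edges T) R)"
    using *(2) by (simp add: cod_def)
qed

text \<open>This is how link sums enter: they govern the mean loss of a codegree, and they are
  tracked with a smaller relative error than the single codegrees they consist of.\<close>

lemma sum_cod_eq:
  assumes "finite R"
  shows "(\<Sum>w\<in>nb E R. \<Sum>r\<in>R. cod E {r, w}) = (\<Sum>r\<in>R. lsum E r R)"
  unfolding lsum_def by (rule sum.swap)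

section \<open>Mean loss of link sums\<close>

lemma finite_paths: "R \<noteq> {} \<Longrightarrow> finite (paths E u R)"
  unfolding paths_def by (intro finite_SigmaI finite_nb) auto

lemma lsum_eq_card: "R \<noteq> {} \<Longrightarrow> lsum E u R = real (card (paths E u R))"
  unfolding lsum_def paths_def cod_def by (subst card_SigmaI) (auto intro!: finite_nb)

lemma lsum_drop:
  assumes "u \<in> R"
  shows "lsum E u R - lsum (E - F) u R
    = real (card {\<kappa> \<in> paths E u R. F \<inter> path_edges u R \<kappa> \<noteq> {}})"
proof -
  interpret E': graph_on V "E - F" by (rule graph_on_diff)
  have R: "R \<noteq> {}" using assms by auto
  show ?thesis unfolding lsum_eq_card[OF R] E'.lsum_eq_card[OF R]
    by (rule card_filter_drop[OF finite_paths[OF R]])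
       (use assms in \<open>auto simp: paths_def nb_def path_edges_def star_def\<close>)
qed

text \<open>A destroyed path \<open>(w, x)\<close> has \<open>w\<close> or \<open>x\<close> among
  the three vertices of \<open>T\<close>. Given \<open>w\<close>, the candidates for
  \<open>x\<close> are common neighbours of \<open>u\<close> and \<open>w\<close>; given
  \<open>x\<close>, the candidates for \<open>w\<close> are common neighbours of \<open>u\<close>
  and \<open>x\<close>, because \<open>u \<in> R\<close>. Each of the six cases allows at most
  \<open>K\<close> paths.\<close>

lemma lsum_drop_le:
  fixes K :: real
  assumes u: "u \<in> R" and T: "T \<in> triangles E"
    and K: "\<And>u w. {u, w} \<in> E \<Longrightarrow> cod E {u, w} \<le> K"
  shows "lsum E u R - lsum (E - all_edges T) u R \<le> 6 * K"
proof -
  have R: "R \<noteq> {}" using u by auto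
  note finT = triangle_finite[OF T]
  let ?A = "SIGMA w:nb E R \<inter> T. nb E {u, w}" and ?B = "SIGMA x:nb E {u} \<inter> T. nb E {u, x}"
  have fA: "finite ?A" using finT by (intro finite_SigmaI finite_nb) auto
  have fB: "finite ?B" using finT by (intro finite_SigmaI finite_nb) auto
  have "{\<kappa> \<in> paths E u R. all_edges T \<inter> path_edges u R \<kappa> \<noteq> {}} \<subseteq> ?A \<union> (\<lambda>(x, w). (w, x)) ` ?B"
  proof
    fix \<kappa> assume "\<kappa> \<in> {\<kappa> \<in> paths E u R. all_edges T \<inter> path_edges u R \<kappa> \<noteq> {}}"
    then obtain w x where \<kappa>: "\<kappa> = (w, x)" "w \<in> nb E R" "x \<in> nb E {u, w}"
      and hit: "all_edges T \<inter> path_edges u R (w, x) \<noteq> {}"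
      by (auto simp: paths_def)
    then have "w \<in> T \<or> x \<in> T" by (auto simp: path_edges_def star_def all_edges_def)
    then show "\<kappa> \<in> ?A \<union> (\<lambda>(x, w). (w, x)) ` ?B"
    proof
      assume "x \<in> T"
      then have "(x, w) \<in> ?B" using \<kappa> u by (auto simp: nb_def insert_commute)
      then show ?thesis using \<kappa> by (auto intro!: image_eqI[of _ _ "(x, w)"])
    qed (use \<kappa> in auto)
  qed
  then have "card {\<kappa> \<in> paths E u R. all_edges T \<inter> path_edges u R \<kappa> \<noteq> {}}
      \<le> card (?A \<union> (\<lambda>(x, w). (w, x)) ` ?B)"
    by (intro card_mono) (use fA fB in auto)
  also have "\<dots> \<le> card ?A + card ((\<lambda>(x, w). (w, x)) ` ?B)" by (rule card_Un_le)
  also have "\<dots> \<le> card ?A + card ?B" using card_image_le[OF fB] by auto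
  finally have le: "real (card {\<kappa> \<in> paths E u R. all_edges T \<inter> path_edges u R \<kappa> \<noteq> {}})
      \<le> real (card ?A) + real (card ?B)" by linarith
  have sig: "real (card (SIGMA w:S \<inter> T. nb E {u, w})) \<le> 3 * K" if S: "S \<subseteq> nb E {u}" for S
  proof (cases "S \<inter> T = {}")
    case False
    then obtain w where "w \<in> S" by blast
    then have "0 \<le> K" using K[of u w] S by (auto simp: nb_def cod_def intro: order_trans)
    have "real (card (SIGMA w:S \<inter> T. nb E {u, w})) = (\<Sum>w\<in>S \<inter> T. cod E {u, w})"
      using finT by (subst card_SigmaI) (auto intro!: finite_nb simp: cod_def)
    also have "\<dots> \<le> (\<Sum>w\<in>S \<inter> T. K)"
      by (intro sum_mono K) (use S in \<open>auto simp: nb_def\<close>)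
    also have "\<dots> \<le> 3 * K"
    proof -
      have "card (S \<inter> T) \<le> 3" using card_mono[OF finT, of "S \<inter> T"] triangle_card[OF T] by simp
      then show ?thesis using \<open>0 \<le> K\<close> by (simp add: mult_right_mono)
    qed
    finally show ?thesis .
  next
    case True
    have "all_edges T \<noteq> {}" using card_all_edges_triple[OF triangle_card[OF T]] by force
    then obtain e where "e \<in> E" using triangle_sub[OF T] by blast
    then obtain a b where "{a, b} \<in> E" using edge_pair by metis
    then have "0 \<le> K" using K[of a b] by (auto simp: cod_def intro: order_trans)
    then show ?thesis using True by simp
  qed
  have "nb E R \<subseteq> nb E {u}" using u by (auto simp: nb_def)
  from sig[OF this] sig[of "nb E {u}"] le show ?thesis
    unfolding lsum_drop[OF u] by simp
qed

text \<open>A path needs the star of \<open>w\<close> and the two further sides of the triangle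
  \<open>u\<close>, \<open>w\<close>, \<open>x\<close>. The only possible coincidence among these
  edges is \<open>x \<in> R\<close>, when \<open>{w, x}\<close> is already a star edge; this is the
  correction in the last bound.\<close>

lemma path_edges_sum:
  assumes u: "u \<in> R" and \<kappa>: "(w, x) \<in> paths E u R" and "finite R"
  defines "s \<equiv> (\<Sum>r\<in>R. cod E {r, w}) + cod E {u, x} + cod E {w, x}"
  shows "path_edges u R (w, x) \<subseteq> E" "card (path_edges u R (w, x)) \<le> card R + 2"
    "(\<Sum>e\<in>path_edges u R (w, x). tri_deg E e) \<le> s"
    "s - (if x \<in> R then cod E {w, x} else 0) \<le> (\<Sum>e\<in>path_edges u R (w, x). tri_deg E e)"
proof -
  have w: "w \<in> nb E R" and ux: "{u, x} \<in> E" and wx: "{w, x} \<in> E"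
    using \<kappa> by (auto simp: paths_def nb_def)
  have uw: "{u, w} \<in> E" using w u by (auto simp: nb_def)
  note ne = edgeD(1)[OF ux] edgeD(1)[OF wx] edgeD(1)[OF uw]
  show "path_edges u R (w, x) \<subseteq> E" using star_sub[OF w] ux wx by (auto simp: path_edges_def)
  have "card (star R w \<union> {{u, x}, {w, x}}) \<le> card (star R w) + card {{u, x}, {w, x}}"
    by (rule card_Un_le)
  also have "\<dots> \<le> card R + 2"
    by (intro add_mono card_star_le assms(3)) (simp add: card_insert_if)
  finally show "card (path_edges u R (w, x)) \<le> card R + 2" by (simp add: path_edges_def)
  have fin: "finite (star R w)" using assms(3) by (simp add: star_def)
  have d1: "{u, x} \<notin> star R w" using ne by (auto simp: star_def doubleton_eq_iff)
  have d2: "{u, x} \<noteq> {w, x}" using ne by (auto simp: doubleton_eq_iff)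
  have d3: "{w, x} \<in> star R w \<longleftrightarrow> x \<in> R"
  proof
    assume "{w, x} \<in> star R w"
    then obtain r where "r \<in> R" "{w, x} = {r, w}" by (auto simp: star_def)
    then show "x \<in> R" using ne by (metis doubleton_eq_iff)
  next
    assume "x \<in> R"
    then show "{w, x} \<in> star R w" unfolding star_def by (intro image_eqI[of _ _ x]) auto
  qed
  have "(\<Sum>e\<in>path_edges u R (w, x). tri_deg E e)
      = (\<Sum>e\<in>star R w. tri_deg E e) + tri_deg E {u, x} + (if x \<in> R then 0 else tri_deg E {w, x})"
  proof (cases "x \<in> R")
    case True
    then have "path_edges u R (w, x) = insert {u, x} (star R w)"
      using d3 by (auto simp: path_edges_def)
    then show ?thesis using d1 fin True by simp
  next
    case False
    have "path_edges u R (w, x) = insert {u, x} (insert {w, x} (star R w))"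
      by (auto simp: path_edges_def)
    then show ?thesis using d1 d2 d3 fin False by simp
  qed
  then have eq: "(\<Sum>e\<in>path_edges u R (w, x). tri_deg E e)
      = s - (if x \<in> R then cod E {w, x} else 0)"
    unfolding s_def sum_star[OF w] tri_deg_eq_cod[OF ux] tri_deg_eq_cod[OF wx] by simp
  then show "(\<Sum>e\<in>path_edges u R (w, x). tri_deg E e) \<le> s"
    "s - (if x \<in> R then cod E {w, x} else 0) \<le> (\<Sum>e\<in>path_edges u R (w, x). tri_deg E e)"
    by (auto simp: cod_def)
qed

text \<open>For the edges \<open>{u, x}\<close> the order of summation is exchanged: with
  \<open>x\<close> fixed, the possible \<open>w\<close> are the common neighbours of
  \<open>insert x R\<close>, so a codegree with one more vertex appears. The edges
  \<open>{w, x}\<close> with \<open>w\<close> fixed sum to a link sum of the pair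
  \<open>{w, u}\<close>.\<close>

lemma sum_paths_eq:
  assumes u: "u \<in> R" "finite R"
  shows "(\<Sum>(w, x)\<in>paths E u R. (\<Sum>r\<in>R. cod E {r, w}) + cod E {u, x} + cod E {w, x})
    = (\<Sum>w\<in>nb E R. cod E {u, w} * (\<Sum>r\<in>R. cod E {r, w}))
      + (\<Sum>x\<in>nb E {u}. cod E (insert x R) * cod E {u, x})
      + (\<Sum>w\<in>nb E R. lsum E w {w, u})"
proof -
  have R: "R \<noteq> {}" using u by auto
  have fin: "finite (nb E R)" "\<And>w. finite (nb E {u, w})" "finite (nb E {u})"
    using finite_nb R by auto
  have 1: "(\<Sum>(w, x)\<in>paths E u R. (\<Sum>r\<in>R. cod E {r, w})) = (\<Sum>w\<in>nb E R. cod E {u, w} * (\<Sum>r\<in>R. cod E {r, w}))"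
    unfolding paths_def by (subst sum.Sigma[symmetric]) (auto simp: fin cod_def)
  have 3: "(\<Sum>(w, x)\<in>paths E u R. cod E {w, x}) = (\<Sum>w\<in>nb E R. lsum E w {w, u})"
    unfolding paths_def lsum_def by (subst sum.Sigma[symmetric]) (auto simp: fin insert_commute intro!: finite_nb)
  have "(\<Sum>(w, x)\<in>paths E u R. cod E {u, x})
      = (\<Sum>(x, w)\<in>(SIGMA x:nb E {u}. nb E (insert x R)). cod E {u, x})"
    by (rule sum.reindex_bij_witness[of _ "\<lambda>(x, w). (w, x)" "\<lambda>(w, x). (x, w)"])
       (use u in \<open>auto simp: paths_def nb_def insert_commute\<close>)
  also have "\<dots> = (\<Sum>x\<in>nb E {u}. cod E (insert x R) * cod E {u, x})"
    by (subst sum.Sigma[symmetric]) (auto simp: fin cod_def intro!: finite_nb)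
  finally have 2: "(\<Sum>(w, x)\<in>paths E u R. cod E {u, x})
      = (\<Sum>x\<in>nb E {u}. cod E (insert x R) * cod E {u, x})" .
  show ?thesis unfolding 1[symmetric] 2[symmetric] 3[symmetric]
    by (simp add: case_prod_unfold sum.distrib)
qed

text \<open>The first correction covers degenerate paths with \<open>x \<in> R\<close>, at most
  \<open>card R\<close> for each \<open>w\<close>. The second covers triangles that meet several of
  the at most \<open>card R + 2\<close> edges of a path.\<close>

lemma lsum_drop_sum:
  fixes K :: real
  assumes u: "u \<in> R" "finite R" and K: "\<And>u w. {u, w} \<in> E \<Longrightarrow> cod E {u, w} \<le> K" "0 \<le> K"
  defines "P \<equiv> (\<Sum>w\<in>nb E R. cod E {u, w} * (\<Sum>r\<in>R. cod E {r, w}))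
      + (\<Sum>x\<in>nb E {u}. cod E (insert x R) * cod E {u, x})
      + (\<Sum>w\<in>nb E R. lsum E w {w, u})"
  shows "(\<Sum>T\<in>triangles E. lsum E u R - lsum (E - all_edges T) u R) \<le> P"
    and "P - real (card R) * K * cod E R - real (card R + 2)^2 * lsum E u R
      \<le> (\<Sum>T\<in>triangles E. lsum E u R - lsum (E - all_edges T) u R)"
proof -
  have R: "R \<noteq> {}" using u by auto
  let ?s = "\<lambda>w x. (\<Sum>r\<in>R. cod E {r, w}) + cod E {u, x} + cod E {w, x}"
  have F: "path_edges u R \<kappa> \<subseteq> E" "card (path_edges u R \<kappa>) \<le> card R + 2" if "\<kappa> \<in> paths E u R" for \<kappa>
    using path_edges_sum(1,2)[OF u(1) _ u(2)] that by (cases \<kappa>; auto)+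
  note * = sum_drop[OF finite_paths[OF R], of u "path_edges u R" "card R + 2",
      OF F, unfolded lsum_drop[OF u(1), symmetric]]
  have P: "P = (\<Sum>(w, x)\<in>paths E u R. ?s w x)"
    unfolding P_def sum_paths_eq[OF u] ..
  have up: "(\<Sum>\<kappa>\<in>paths E u R. \<Sum>e\<in>path_edges u R \<kappa>. tri_deg E e) \<le> P"
    unfolding P by (rule sum_mono) (auto intro: path_edges_sum(3)[OF u(1) _ u(2)])
  then show "(\<Sum>T\<in>triangles E. lsum E u R - lsum (E - all_edges T) u R) \<le> P"
    using *(1) by linarith
  have "(\<Sum>(w, x)\<in>paths E u R. if x \<in> R then cod E {w, x} else 0)
      = (\<Sum>w\<in>nb E R. \<Sum>x\<in>nb E {u, w}. if x \<in> R then cod E {w, x} else 0)"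
    unfolding paths_def using finite_nb R by (subst sum.Sigma[symmetric]) auto
  also have "\<dots> \<le> (\<Sum>w\<in>nb E R. real (card R) * K)"
  proof (rule sum_mono)
    fix w assume "w \<in> nb E R"
    have "(\<Sum>x\<in>nb E {u, w}. if x \<in> R then cod E {w, x} else 0)
        = (\<Sum>x\<in>nb E {u, w} \<inter> R. cod E {w, x})"
      by (simp add: sum.inter_restrict finite_nb)
    also have "\<dots> \<le> (\<Sum>x\<in>nb E {u, w} \<inter> R. K)"
      by (intro sum_mono K) (auto simp: nb_def)
    also have "\<dots> \<le> real (card R) * K"
      using K(2) card_mono[OF u(2), of "nb E {u, w} \<inter> R"] by (simp add: mult_right_mono)
    finally show "(\<Sum>x\<in>nb E {u, w}. if x \<in> R then cod E {w, x} else 0) \<le> real (card R) * K" .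
  qed
  finally have err: "(\<Sum>(w, x)\<in>paths E u R. if x \<in> R then cod E {w, x} else 0) \<le> real (card R) * K * cod E R"
    by (simp add: cod_def mult_ac)
  have "P - (\<Sum>(w, x)\<in>paths E u R. if x \<in> R then cod E {w, x} else 0)
      = (\<Sum>(w, x)\<in>paths E u R. ?s w x - (if x \<in> R then cod E {w, x} else 0))"
    unfolding P by (simp add: sum_subtractf[symmetric] case_prod_unfold)
  also have "\<dots> \<le> (\<Sum>\<kappa>\<in>paths E u R. \<Sum>e\<in>path_edges u R \<kappa>. tri_deg E e)"
    by (rule sum_mono) (auto intro: path_edges_sum(4)[OF u(1) _ u(2)] split del: if_split)
  finally have low: "P - (\<Sum>(w, x)\<in>paths E u R. if x \<in> R then cod E {w, x} else 0)
      \<le> (\<Sum>\<kappa>\<in>paths E u R. \<Sum>e\<in>path_edges u R \<kappa>. tri_deg E e)" .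
  show "P - real (card R) * K * cod E R - real (card R + 2)^2 * lsum E u R
      \<le> (\<Sum>T\<in>triangles E. lsum E u R - lsum (E - all_edges T) u R)"
    using *(2) low err unfolding lsum_eq_card[OF R] by linarith
qed

section \<open>Mean loss of triangles\<close>

lemma sum_tri_deg: "(\<Sum>e\<in>E. tri_deg E e) = 3 * real (card (triangles E))"
proof -
  have "(\<Sum>e\<in>E. tri_deg E e) = (\<Sum>T\<in>triangles E. real (card (all_edges T \<inter> E)))"
    by (rule sum_inter_tri_deg[symmetric]) simp
  also have "\<dots> = (\<Sum>T\<in>triangles E. 3)"
    by (intro sum.cong refl)
       (use triangle_sub triangle_card card_all_edges_triple in \<open>force simp: Int_absorb2\<close>)
  finally show ?thesis by simp
qed

lemma tri_drop:
  "real (card (triangles E)) - real (card (triangles (E - F)))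
    = real (card {T' \<in> triangles E. F \<inter> all_edges T' \<noteq> {}})"
  by (rule card_filter_drop[OF finite_tri]) (auto simp: triangles_def)

lemma tri_drop_le:
  fixes K :: real
  assumes T: "T \<in> triangles E" and K: "\<And>e. e \<in> E \<Longrightarrow> tri_deg E e \<le> K"
  shows "real (card (triangles E)) - real (card (triangles (E - all_edges T))) \<le> 3 * K"
proof -
  have "real (card {T' \<in> triangles E. all_edges T \<inter> all_edges T' \<noteq> {}}) = hits (all_edges T)"
    by (simp add: hits_def Int_commute)
  also have "\<dots> \<le> (\<Sum>e\<in>all_edges T. tri_deg E e)" by (rule hits_bounds(1)[OF triangle_sub[OF T]])
  also have "\<dots> \<le> (\<Sum>e\<in>all_edges T. K)" by (intro sum_mono K) (use triangle_sub[OF T] in auto)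
  also have "\<dots> = 3 * K" by (simp add: card_all_edges_triple[OF triangle_card[OF T]])
  finally show ?thesis by (simp add: tri_drop)
qed

text \<open>An edge \<open>e\<close> is removed by \<open>tri_deg E e\<close> choices of
  \<open>T\<close>, and its removal destroys as many triangles; hence the second moment of the
  codegrees.\<close>

lemma tri_drop_sum:
  "(\<Sum>T\<in>triangles E. real (card (triangles E)) - real (card (triangles (E - all_edges T))))
    \<le> (\<Sum>e\<in>E. (tri_deg E e)\<^sup>2)"
  "(\<Sum>e\<in>E. (tri_deg E e)\<^sup>2) - 9 * real (card (triangles E))
    \<le> (\<Sum>T\<in>triangles E. real (card (triangles E)) - real (card (triangles (E - all_edges T))))"
proof -
  have "(\<Sum>T\<in>triangles E. \<Sum>e\<in>all_edges T. tri_deg E e)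
      = (\<Sum>T\<in>triangles E. \<Sum>e\<in>E. if e \<in> all_edges T then tri_deg E e else 0)"
  proof (rule sum.cong[OF refl])
    fix T assume "T \<in> triangles E"
    then have "all_edges T = E \<inter> all_edges T" using triangle_sub by auto
    then show "(\<Sum>e\<in>all_edges T. tri_deg E e) = (\<Sum>e\<in>E. if e \<in> all_edges T then tri_deg E e else 0)"
      using sum.inter_restrict[OF finite_E, of "tri_deg E" "all_edges T"] by simp
  qed
  also have "\<dots> = (\<Sum>e\<in>E. \<Sum>T\<in>triangles E. if e \<in> all_edges T then tri_deg E e else 0)"
    by (rule sum.swap)
  also have "\<dots> = (\<Sum>e\<in>E. (tri_deg E e)\<^sup>2)"
    by (intro sum.cong refl) (simp add: sum.If_cases[OF finite_tri] tri_deg_def Int_def power2_eq_square)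
  finally have eq: "(\<Sum>T\<in>triangles E. \<Sum>e\<in>all_edges T. tri_deg E e) = (\<Sum>e\<in>E. (tri_deg E e)\<^sup>2)" .
  have c3: "card (all_edges T) \<le> 3" if "T \<in> triangles E" for T
    using card_all_edges_triple[OF triangle_card[OF that]] by simp
  note * = sum_drop[OF finite_tri, of all_edges 3, OF triangle_sub c3, unfolded eq tri_drop[symmetric]]
  show "(\<Sum>T\<in>triangles E. real (card (triangles E)) - real (card (triangles (E - all_edges T))))
    \<le> (\<Sum>e\<in>E. (tri_deg E e)\<^sup>2)" by (rule *(1))
  show "(\<Sum>e\<in>E. (tri_deg E e)\<^sup>2) - 9 * real (card (triangles E))
    \<le> (\<Sum>T\<in>triangles E. real (card (triangles E)) - real (card (triangles (E - all_edges T))))"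
    using *(2) by simp
qed

end

section \<open>Exponential supermartingales and the trajectory\<close>

lemma exp_le_quadratic:
  fixes z :: real
  assumes "\<bar>z\<bar> \<le> 1"
  shows "exp z \<le> 1 + z + z\<^sup>2"
proof (cases "0 \<le> z")
  case True then show ?thesis using exp_bound[of z] assms by simp
next
  case False
  define y where "y = - z"
  have y: "0 \<le> y" "y \<le> 1" using False assms by (auto simp: y_def)
  have "exp (- y) \<le> 1 / (1 + y + y\<^sup>2 / 2)"
    using exp_lower_Taylor_quadratic[of y] y
    by (simp add: exp_minus inverse_eq_divide add_pos_nonneg frac_le)
  also have "\<dots> \<le> 1 - y + y\<^sup>2"
  proof -
    have "1 \<le> (1 - y + y\<^sup>2) * (1 + y + y\<^sup>2 / 2)"
    proof -
      have "(1 - y + y\<^sup>2) * (1 + y + y\<^sup>2 / 2) = 1 + y\<^sup>2 / 2 + y^3 / 2 + y^4 / 2"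
        by (simp add: field_simps power2_eq_square power3_eq_cube power4_eq_xxxx)
      then show ?thesis using y by simp
    qed
    then show ?thesis using y
      by (subst pos_divide_le_eq) (auto intro!: add_pos_nonneg)
  qed
  finally show ?thesis by (simp add: y_def)
qed

text \<open>Here \<open>\<rho>\<close> is a deviation divided by its bound, which a step multiplies by \<open>1 + g\<close>. Far below
  the bound the summand \<open>exp (- M / 200)\<close> suffices, so the drift only matters for \<open>\<rho> \<ge> 99/100\<close>; this
  is what makes self-correction usable.\<close>

lemma exp_ratio_step:
  fixes \<delta> :: "'a \<Rightarrow> real" and \<rho> M h \<kappa> G B g :: real
  assumes S: "finite S" "S \<noteq> {}" and \<rho>: "\<bar>\<rho>\<bar> \<le> 1" and M: "100 \<le> M"
    and h: "0 < h" and \<kappa>: "0 < \<kappa>" and G: "0 \<le> G"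
    and \<delta>B: "\<And>T. T \<in> S \<Longrightarrow> \<bar>\<delta> T\<bar> \<le> B" and \<delta>G: "(\<Sum>T\<in>S. \<bar>\<delta> T\<bar>) \<le> G * h * card S"
    and BG: "16 * M * (B * G) \<le> \<kappa>" and B: "8 * M * B \<le> 1"
    and g: "8 * M * \<bar>g\<bar> \<le> 1" and g2: "16 * M * g\<^sup>2 \<le> \<kappa> * h"
    and drift: "99/100 \<le> \<rho> \<Longrightarrow> (\<Sum>T\<in>S. \<delta> T) \<le> (g * \<rho> - \<kappa> * h) * card S"
  shows "(\<Sum>T\<in>S. exp (M * ((\<rho> + \<delta> T) / (1 + g) - 1))) / card S
     \<le> exp (M * (\<rho> - 1)) + exp (- M / 200)"
proof -
  have N: "real (card S) > 0" using S by (simp add: card_gt_0_iff)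
  have M0: "M > 0" using M by simp
  have g1: "\<bar>g\<bar> \<le> 1/800"
  proof -
    have "8 * 100 * \<bar>g\<bar> \<le> 8 * M * \<bar>g\<bar>" using M by (intro mult_right_mono) auto
    then show ?thesis using g by linarith
  qed
  define z where "z T = M * ((\<rho> + \<delta> T) / (1 + g) - \<rho>)" for T
  have z_eq: "z T = M * (\<delta> T - g * \<rho>) / (1 + g)" for T
    unfolding z_def using g1 by (simp add: field_simps)
  have num: "\<bar>M * (\<delta> T - g * \<rho>)\<bar> \<le> 1/4" if "T \<in> S" for T
  proof -
    have "\<bar>\<delta> T - g * \<rho>\<bar> \<le> \<bar>\<delta> T\<bar> + \<bar>g\<bar> * \<bar>\<rho>\<bar>" by (metis abs_mult abs_triangle_ineq4)
    also have "\<dots> \<le> B + \<bar>g\<bar>" using \<delta>B[OF that] mult_left_mono[OF \<rho>, of "\<bar>g\<bar>"] by simp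
    finally have "M * \<bar>\<delta> T - g * \<rho>\<bar> \<le> M * (B + \<bar>g\<bar>)" using M0 by simp
    moreover have "\<bar>M * (\<delta> T - g * \<rho>)\<bar> = M * \<bar>\<delta> T - g * \<rho>\<bar>" using M0 by (simp add: abs_mult)
    moreover have "M * (B + \<bar>g\<bar>) = M * B + M * \<bar>g\<bar>" by (rule distrib_left)
    ultimately show ?thesis using B g by linarith
  qed
  have zb: "\<bar>z T\<bar> \<le> 2/7" if "T \<in> S" for T
  proof -
    have "\<bar>z T\<bar> = \<bar>M * (\<delta> T - g * \<rho>)\<bar> / (1 + g)" unfolding z_eq using g1 by (simp add: abs_divide)
    also have "\<dots> \<le> (1/4) / (7/8)" using num[OF that] g1 by (intro frac_le) auto
    finally show ?thesis by simp
  qed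
  have split: "M * ((\<rho> + \<delta> T) / (1 + g) - 1) = M * (\<rho> - 1) + z T" for T
    by (simp add: z_def algebra_simps)
  show ?thesis
  proof (cases "99/100 \<le> \<rho>")
    case False
    have "exp (M * ((\<rho> + \<delta> T) / (1 + g) - 1)) \<le> exp (- M / 200)" if "T \<in> S" for T
    proof -
      have "M * (\<rho> - 1) \<le> M * (-1/100)" using False M0 by (intro mult_left_mono) auto
      \<comment> \<open>The change of the exponent is at most 2/7, and \<open>M / 200\<close> is at
        least 1/2, so an exponent of at most \<open>- M / 100\<close> stays below
        \<open>- M / 200\<close>.\<close>
      then have "M * (\<rho> - 1) + z T \<le> - M / 200" using zb[OF that] M by linarith
      then show ?thesis unfolding split by simp
    qed
    then have "(\<Sum>T\<in>S. exp (M * ((\<rho> + \<delta> T) / (1 + g) - 1))) \<le> card S * exp (- M / 200)"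
      using sum_bounded_above[of S "\<lambda>T. exp (M * ((\<rho> + \<delta> T) / (1 + g) - 1))" "exp (- M / 200)"] by simp
    then have "(\<Sum>T\<in>S. exp (M * ((\<rho> + \<delta> T) / (1 + g) - 1))) / card S \<le> exp (- M / 200)"
      using N by (simp add: field_simps)
    then show ?thesis using exp_ge_zero[of "M * (\<rho> - 1)"] by linarith
  next
    case True
    have s1: "(\<Sum>T\<in>S. z T) \<le> M * (- \<kappa> * h) * card S / (1 + g)"
    proof -
      have "(\<Sum>T\<in>S. z T) = M * ((\<Sum>T\<in>S. \<delta> T) - g * \<rho> * card S) / (1 + g)"
        unfolding z_eq by (simp add: sum_divide_distrib[symmetric] sum_distrib_left[symmetric] sum_subtractf)
      also have "\<dots> \<le> M * ((- \<kappa> * h) * card S) / (1 + g)"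
        using drift[OF True] M0 g1 by (intro divide_right_mono mult_left_mono) (auto simp: algebra_simps)
      finally show ?thesis by simp
    qed
    \<comment> \<open>Each square is at most \<open>B\<close> times
      \<open>\<bar>\<delta> T\<bar>\<close>, whose mean is at most \<open>G * h\<close>. By
      \<open>BG\<close> and \<open>g2\<close> the parts coming from \<delta> and from
      \<open>g\<close> are each an eighth of the negative drift. Hence the quadratic term loses at
      most a quarter of that drift, up to powers of \<open>1 + g\<close>.\<close>
    have s2: "(\<Sum>T\<in>S. (z T)\<^sup>2) \<le> M * (\<kappa> * h) * card S / (4 * (1 + g)\<^sup>2)"
    proof -
      have "(\<Sum>T\<in>S. (\<delta> T)\<^sup>2) \<le> (\<Sum>T\<in>S. B * \<bar>\<delta> T\<bar>)"
      proof (rule sum_mono)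
        fix T assume "T \<in> S"
        have "(\<delta> T)\<^sup>2 = \<bar>\<delta> T\<bar> * \<bar>\<delta> T\<bar>" by (simp add: power2_eq_square)
        also have "\<dots> \<le> B * \<bar>\<delta> T\<bar>" using \<delta>B[OF \<open>T \<in> S\<close>] by (intro mult_right_mono) auto
        finally show "(\<delta> T)\<^sup>2 \<le> B * \<bar>\<delta> T\<bar>" .
      qed
      also have "\<dots> \<le> B * (G * h * card S)"
        unfolding sum_distrib_left[symmetric]
      proof (rule mult_left_mono[OF \<delta>G])
        obtain T where "T \<in> S" using S by blast
        then show "0 \<le> B" using \<delta>B[of T] by linarith
      qed
      finally have d2: "16 * M * (\<Sum>T\<in>S. (\<delta> T)\<^sup>2) \<le> 16 * M * (B * G) * (h * card S)"
        using M0 by (simp add: algebra_simps)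
      also have "\<dots> \<le> \<kappa> * (h * card S)" using BG h by (intro mult_right_mono) auto
      finally have d2: "16 * M * (\<Sum>T\<in>S. (\<delta> T)\<^sup>2) \<le> \<kappa> * h * card S" by simp
      have "(z T)\<^sup>2 \<le> M\<^sup>2 * (2 * (\<delta> T)\<^sup>2 + 2 * g\<^sup>2) / (1 + g)\<^sup>2" for T
      proof -
        have "(\<delta> T - g * \<rho>)\<^sup>2 \<le> 2 * (\<delta> T)\<^sup>2 + 2 * (g * \<rho>)\<^sup>2"
          using zero_le_power2[of "\<delta> T + g * \<rho>"] by (simp add: power2_eq_square algebra_simps)
        also have "(g * \<rho>)\<^sup>2 \<le> g\<^sup>2"
          using \<rho> by (simp add: power_mult_distrib mult_left_le abs_square_le_1)
        finally have "(\<delta> T - g * \<rho>)\<^sup>2 \<le> 2 * (\<delta> T)\<^sup>2 + 2 * g\<^sup>2" by simp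
        then show ?thesis unfolding z_eq power_divide power_mult_distrib
          by (intro divide_right_mono mult_left_mono) auto
      qed
      then have "(\<Sum>T\<in>S. (z T)\<^sup>2) \<le> (\<Sum>T\<in>S. M\<^sup>2 * (2 * (\<delta> T)\<^sup>2 + 2 * g\<^sup>2) / (1 + g)\<^sup>2)"
        by (rule sum_mono)
      also have "\<dots> = M * (2 * (M * (\<Sum>T\<in>S. (\<delta> T)\<^sup>2)) + 2 * (M * g\<^sup>2) * card S) / (1 + g)\<^sup>2"
      proof -
        have "(\<Sum>T\<in>S. 2 * (\<delta> T)\<^sup>2 + 2 * g\<^sup>2) = 2 * (\<Sum>T\<in>S. (\<delta> T)\<^sup>2) + 2 * g\<^sup>2 * card S"
          by (simp add: sum.distrib sum_distrib_left)
        then have "(\<Sum>T\<in>S. M\<^sup>2 * (2 * (\<delta> T)\<^sup>2 + 2 * g\<^sup>2) / (1 + g)\<^sup>2)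
            = M\<^sup>2 * (2 * (\<Sum>T\<in>S. (\<delta> T)\<^sup>2) + 2 * g\<^sup>2 * card S) / (1 + g)\<^sup>2"
          by (simp only: sum_divide_distrib[symmetric] sum_distrib_left[symmetric])
        then show ?thesis by (simp add: power2_eq_square[of M] algebra_simps)
      qed
      also have "\<dots> \<le> M * (\<kappa> * h * card S / 4) / (1 + g)\<^sup>2"
      proof -
        have "16 * M * g\<^sup>2 * card S \<le> \<kappa> * h * card S" using g2 by (intro mult_right_mono) auto
        then have "2 * (M * (\<Sum>T\<in>S. (\<delta> T)\<^sup>2)) + 2 * (M * g\<^sup>2) * card S \<le> \<kappa> * h * card S / 4"
          using d2 by linarith
        then show ?thesis using M0 by (intro divide_right_mono mult_left_mono) auto
      qed
      finally show ?thesis by simp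
    qed
    have neg: "(\<Sum>T\<in>S. z T) + (\<Sum>T\<in>S. (z T)\<^sup>2) \<le> 0"
    proof -
      define W where "W = M * (\<kappa> * h) * card S / (1 + g)"
      have W: "W \<ge> 0" unfolding W_def using M0 \<kappa> h g1 by simp
      have "M * (\<kappa> * h) * card S / (4 * (1 + g)\<^sup>2) = W * (1 / (4 * (1 + g)))"
        unfolding W_def by (simp add: power2_eq_square)
      also have "\<dots> \<le> W * 1" using W g1 by (intro mult_left_mono) (auto simp: field_simps)
      finally show ?thesis using s1 s2 by (simp add: W_def)
    qed
    have "(\<Sum>T\<in>S. exp (M * ((\<rho> + \<delta> T) / (1 + g) - 1))) = exp (M * (\<rho> - 1)) * (\<Sum>T\<in>S. exp (z T))"
      unfolding split by (simp add: exp_add sum_distrib_left)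
    also have "\<dots> \<le> exp (M * (\<rho> - 1)) * (\<Sum>T\<in>S. 1 + z T + (z T)\<^sup>2)"
      using zb by (intro mult_left_mono sum_mono exp_le_quadratic) force+
    also have "\<dots> \<le> exp (M * (\<rho> - 1)) * card S"
      using neg by (intro mult_left_mono) (auto simp: sum.distrib)
    finally have "(\<Sum>T\<in>S. exp (M * ((\<rho> + \<delta> T) / (1 + g) - 1))) / card S \<le> exp (M * (\<rho> - 1))"
      using N by (simp add: field_simps)
    then show ?thesis using exp_ge_zero[of "- M / 200"] by linarith
  qed
qed

text \<open>Used with \<open>\<gamma> = expo v - 3/2\<close>, which lies between -1/2 and 5/2: a
  step multiplies the bound of \<open>v\<close> by this power.\<close>

lemma one_minus_powr_approx:
  fixes h \<gamma> :: real
  assumes h: "0 \<le> h" "h \<le> 1/100" and \<gamma>: "\<bar>\<gamma>\<bar> \<le> 5/2"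
  shows "\<bar>(1 - h) powr \<gamma> - 1 + \<gamma> * h\<bar> \<le> 20 * h\<^sup>2"
proof -
  define l where "l = ln (1 - h)"
  have l: "\<bar>l + h\<bar> \<le> 2 * h\<^sup>2"
    using abs_ln_one_plus_x_minus_x_bound_nonpos[of "-h"] h by (simp add: l_def)
  have hh: "h\<^sup>2 \<le> h / 100" using h mult_left_mono[of h "1/100" h] by (simp add: power2_eq_square)
  have labs: "\<bar>l\<bar> \<le> (51/50) * h" using l hh by linarith
  define z where "z = \<gamma> * l"
  have zl: "\<bar>z\<bar> \<le> (51/20) * h"
  proof -
    have "\<bar>z\<bar> = \<bar>\<gamma>\<bar> * \<bar>l\<bar>" by (simp add: z_def abs_mult)
    also have "\<dots> \<le> (5/2) * ((51/50) * h)" using \<gamma> labs by (intro mult_mono) auto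
    finally show ?thesis by simp
  qed
  have "\<bar>exp z - 1 - z\<bar> \<le> z\<^sup>2"
  proof -
    have "\<bar>z\<bar> \<le> 1" using zl h by linarith
    then show ?thesis using exp_le_quadratic[of z] exp_ge_add_one_self[of z] by linarith
  qed
  also have "z\<^sup>2 \<le> ((51/20) * h)\<^sup>2" using zl h by (simp add: abs_le_square_iff[symmetric])
  finally have e: "\<bar>exp z - 1 - z\<bar> \<le> 7 * h\<^sup>2" by (simp add: power_mult_distrib power2_eq_square)
     (smt (verit) h mult_nonneg_nonneg)
  have "\<bar>z + \<gamma> * h\<bar> = \<bar>\<gamma>\<bar> * \<bar>l + h\<bar>" unfolding z_def by (simp add: abs_mult[symmetric] algebra_simps)
  also have "\<dots> \<le> (5/2) * (2 * h\<^sup>2)" using \<gamma> l by (intro mult_mono) auto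
  finally have "\<bar>z + \<gamma> * h\<bar> \<le> 5 * h\<^sup>2" by simp
  moreover have "(1 - h) powr \<gamma> = exp z" using h by (simp add: powr_def z_def l_def)
  ultimately show ?thesis using e by linarith
qed

section \<open>Failure probability along the trajectory\<close>

lemma prob_bind_pmf:
  "measure_pmf.prob (bind_pmf p f) A = measure_pmf.expectation p (\<lambda>x. measure_pmf.prob (f x) A)"
  unfolding measure_pmf_bind
  by (rule measure_pmf.measure_bind[where N = "count_space UNIV"])
    (auto simp: space_subprob_algebra subprob_space_measure_pmf)

lemma trajectory_last:
  assumes "finite E" "G \<in> set_pmf (trajectory E)"
  shows "G \<noteq> []"
  using trajectory_stops_at_triangle_free[OF assms] by blast

lemma trajectory_card_last_le:
  assumes "finite E" "G \<in> set_pmf (trajectory E)"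
  shows "card (G ! num_steps G) \<le> card E"
proof -
  note st = trajectory_stops_at_triangle_free[OF assms]
  have "G ! i \<subseteq> E" if "i \<le> num_steps G" for i
    using that
  proof (induction i)
    case 0 then show ?case using st by simp
  next
    case (Suc i)
    then obtain T where "G ! Suc i = G ! i - all_edges T" using st by (meson Suc_le_lessD)
    then show ?case using Suc by auto
  qed
  then show ?thesis using assms(1) by (simp add: card_mono)
qed

text \<open>The recursion of \<open>trajectory\<close> takes the place of a stopping time. With at
  most \<open>thr\<close> edges the event is impossible, because graphs only shrink; once
  \<open>good\<close> fails the claim is trivial, because \<open>\<Phi> E\<close> is at least 1;
  otherwise a step costs \<delta>. Each step removes an edge, so \<open>card E\<close> bounds the
  number of steps that are paid for.\<close>

lemma trajectory_fail_bound:
  fixes \<Phi> :: "graph \<Rightarrow> real"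
  assumes \<Phi>: "\<And>E. 0 \<le> \<Phi> E" and \<delta>: "0 \<le> \<delta>"
    and inv: "\<And>E T. Inv E \<Longrightarrow> Inv (E - all_edges T)"
    and bad: "\<And>E. Inv E \<Longrightarrow> thr < real (card E) \<Longrightarrow> \<not> good E \<Longrightarrow> 1 \<le> \<Phi> E"
    and tri: "\<And>E. Inv E \<Longrightarrow> thr < real (card E) \<Longrightarrow> good E \<Longrightarrow> triangles E \<noteq> {}"
    and step: "\<And>E. Inv E \<Longrightarrow> thr < real (card E) \<Longrightarrow> good E \<Longrightarrow>
      (\<Sum>T\<in>triangles E. \<Phi> (E - all_edges T)) / card (triangles E) \<le> \<Phi> E + \<delta>"
    and "finite E" "Inv E"
  shows "measure_pmf.prob (trajectory E) {G. thr < real (card (G ! num_steps G))}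
    \<le> \<Phi> E + real (card E) * \<delta>"
  using assms(7,8)
proof (induction E rule: trajectory.induct)
  case (1 E)
  let ?A = "{G. thr < real (card (G ! num_steps G))}"
  consider "real (card E) \<le> thr" | "thr < real (card E)" "\<not> good E"
    | "thr < real (card E)" "good E" by linarith
  then show ?case
  proof cases
    case a: 1
    have "measure_pmf.prob (trajectory E) ?A = 0"
      unfolding measure_pmf_zero_iff using trajectory_card_last_le[OF "1.prems"(1)] a by fastforce
    then show ?thesis using \<Phi>[of E] \<delta> by simp
  next
    case 2
    have "measure_pmf.prob (trajectory E) ?A \<le> 1" by simp
    moreover have "0 \<le> real (card E) * \<delta>" using \<delta> by simp
    ultimately show ?thesis using bad[OF "1.prems"(2) 2] by linarith
  next
    case 3
    have ne: "triangles E \<noteq> {}" using tri[OF "1.prems"(2) 3] .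
    note fin = finite_triangles[OF "1.prems"(1)]
    have N: "real (card (triangles E)) > 0" using fin ne by (simp add: card_gt_0_iff)
    have each: "measure_pmf.prob (map_pmf ((#) E) (trajectory (E - all_edges T))) ?A
        \<le> \<Phi> (E - all_edges T) + (real (card E) - 1) * \<delta>" if T: "T \<in> triangles E" for T
    proof -
      have "measure_pmf.prob (map_pmf ((#) E) (trajectory (E - all_edges T))) ?A
        = measure_pmf.prob (trajectory (E - all_edges T)) ((#) E -` ?A)"
        by simp
      also have "\<dots> \<le> measure_pmf.prob (trajectory (E - all_edges T)) ?A"
      proof -
        have "measure_pmf.prob (trajectory (E - all_edges T)) ((#) E -` ?A)
          = measure_pmf.prob (trajectory (E - all_edges T)) (((#) E -` ?A) \<inter> set_pmf (trajectory (E - all_edges T)))"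
          by (simp add: measure_Int_set_pmf)
        also have "\<dots> \<le> measure_pmf.prob (trajectory (E - all_edges T)) ?A"
        proof (rule measure_pmf.finite_measure_mono)
          show "(#) E -` ?A \<inter> set_pmf (trajectory (E - all_edges T)) \<subseteq> ?A"
          proof
            fix G assume G: "G \<in> (#) E -` ?A \<inter> set_pmf (trajectory (E - all_edges T))"
            then have "G \<noteq> []" using trajectory_last "1.prems"(1) by blast
            then have "(E # G) ! num_steps (E # G) = G ! num_steps G"
              by (cases G) (auto simp: num_steps_def)
            then show "G \<in> ?A" using G by simp
          qed
        qed simp
        finally show ?thesis .
      qed
      also have "\<dots> \<le> \<Phi> (E - all_edges T) + real (card (E - all_edges T)) * \<delta>"
        using "1.IH"[of T] "1.prems" ne fin T inv by (simp)
      also have "real (card (E - all_edges T)) * \<delta> \<le> (real (card E) - 1) * \<delta>"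
        using card_remove_triangle[OF "1.prems"(1) T] \<delta> by (intro mult_right_mono) auto
      finally show ?thesis by simp
    qed
    have "measure_pmf.prob (trajectory E) ?A
      = measure_pmf.expectation (pmf_of_set (triangles E))
          (\<lambda>T. measure_pmf.prob (map_pmf ((#) E) (trajectory (E - all_edges T))) ?A)"
      using "1.prems"(1) ne
      by (subst trajectory.simps) (simp only: simp_thms if_True not_False_eq_True prob_bind_pmf)
    also have "\<dots> = (\<Sum>T\<in>triangles E. measure_pmf.prob (map_pmf ((#) E) (trajectory (E - all_edges T))) ?A) / card (triangles E)"
      by (rule integral_pmf_of_set[OF ne fin])
    also have "\<dots> \<le> (\<Sum>T\<in>triangles E. \<Phi> (E - all_edges T) + (real (card E) - 1) * \<delta>) / card (triangles E)"
      by (intro divide_right_mono sum_mono each) auto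
    also have "\<dots> = (\<Sum>T\<in>triangles E. \<Phi> (E - all_edges T)) / card (triangles E) + (real (card E) - 1) * \<delta>"
      using N by (simp add: sum.distrib add_divide_distrib)
    also have "\<dots> \<le> \<Phi> E + \<delta> + (real (card E) - 1) * \<delta>"
      using step[OF "1.prems"(2) 3] by simp
    finally show ?thesis by (simp add: algebra_simps)
  qed
qed

section \<open>Drift of the tracked quantities\<close>

text \<open>Normalised by \<open>n\<^sup>2 / 2\<close> instead of the number of pairs, so that
  \<open>card E\<close> is exactly \<open>n\<^sup>2 p / 2\<close>; the complete graph then has
  density \<open>1 - 1/n\<close>.\<close>

definition dens :: "nat \<Rightarrow> graph \<Rightarrow> real" where
  "dens n E = 2 * real (card E) / (real n)\<^sup>2"

definition rel_err :: "nat \<Rightarrow> graph \<Rightarrow> real" where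
  "rel_err n E = ln (real n) / sqrt (real n * dens n E ^ 3)"

text \<open>Indices of the tracked quantities: \<open>dev\<close> is the deviation from the random-graph value, which
  is of order \<open>base n v * p ^ expo v\<close>. For \<open>Link u R\<close> it is the sum over \<open>w \<in> nb E R\<close> of
  \<open>cod E {u, w} - n p\<^sup>2\<close>.\<close>

datatype var = Tri | Cod "nat set" | Link nat "nat set"

fun expo :: "var \<Rightarrow> nat" where
  "expo Tri = 3"
| "expo (Cod R) = card R"
| "expo (Link u R) = card R + 2"

fun base :: "nat \<Rightarrow> var \<Rightarrow> real" where
  "base n Tri = real n ^ 3 / 6"
| "base n (Cod R) = real n"
| "base n (Link u R) = (real n)\<^sup>2"

text \<open>In units of \<open>\<beta>\<close>, a drift of at most \<open>a\<close> is compensated by the growth of the bound as soon as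
  \<open>a < 3/2 coef v\<close>. This asks for \<open>coef (Link u {u}) + 1 < 3/2\<close>, \<open>1 < 5/2 coef (Link u {u})\<close>
  (self-correction adds 1 to the rate here),
  \<open>2 < 3/2 coef (Cod {u, v})\<close> and \<open>3 coef (Cod {u, v}) < 3/2 coef (Cod {u, v, w})\<close>.\<close>

fun coef :: "var \<Rightarrow> real" where
  "coef Tri = 1/100"
| "coef (Cod R) = (if card R = 1 then 1 else if card R = 2 then 3/2 else 4)"
| "coef (Link u R) = (if card R = 1 then 21/50 else 1)"

fun dev :: "nat \<Rightarrow> graph \<Rightarrow> var \<Rightarrow> real" where
  "dev n E Tri = real (card (triangles E)) - base n Tri * dens n E ^ 3"
| "dev n E (Cod R) = cod E R - real n * dens n E ^ card R"
| "dev n E (Link u R) = lsum E u R - real n * (dens n E)\<^sup>2 * cod E R"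

definition bnd :: "nat \<Rightarrow> graph \<Rightarrow> var \<Rightarrow> real" where
  "bnd n E v = coef v * (base n v * dens n E ^ expo v) * rel_err n E"

definition vars :: "nat \<Rightarrow> var set" where
  "vars n = {Tri} \<union> Cod ` {R. R \<subseteq> {1..n} \<and> card R \<in> {1, 2, 3}}
     \<union> (\<lambda>(u, R). Link u R) ` {(u, R). R \<subseteq> {1..n} \<and> card R \<in> {1, 2} \<and> u \<in> R}"

lemma card_all_edges_interval: "card (all_edges {1..n}) = n choose 2"
  using n_subsets[of "{1..n}" 2] by (simp add: all_edges_def)

lemma dens_le_1:
  assumes "E \<subseteq> all_edges {1..n}"
  shows "dens n E \<le> 1"
proof -
  have "card E \<le> n choose 2"
    using card_mono[OF finite_all_edges assms] unfolding card_all_edges_interval by simp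
  then have "real (card E) \<le> real (n choose 2)" by linarith
  also have "\<dots> \<le> (real n)\<^sup>2 / 2"
    by (cases n) (auto simp: choose_two power2_eq_square real_of_nat_div field_simps)
  finally show ?thesis by (cases "n = 0") (auto simp: dens_def field_simps)
qed

text \<open>The difference is \<open>(t * q - e) / (1 + q)\<close>. In the applications
  \<open>q\<close> is the relative error of the triangle count, bounded by
  \<open>\<beta> / 100\<close> because of \<open>coef Tri\<close>. This accounts for
  \<open>r * \<beta> / 100\<close>; the rest of 21/2000 is slack for \<open>e\<close> and for
  \<open>t\<close> differing from \<open>r\<close>.\<close>

lemma ratio_err:
  fixes \<beta> :: real
  assumes "0 < \<beta>" "\<beta> \<le> 1/1000000000" "\<bar>q\<bar> \<le> \<beta> / 100" "1 \<le> r" "\<bar>t - r\<bar> \<le> r / 1000000" "\<bar>e\<bar> \<le> \<beta> / 1000000"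
  shows "\<bar>t - (t + e) / (1 + q)\<bar> \<le> 21/2000 * r * \<beta>"
proof -
  have q: "1 + q \<ge> 999/1000" "1 + q > 0" using assms by linarith+
  have "t - (t + e) / (1 + q) = (t * q - e) / (1 + q)" using q by (simp add: field_simps)
  then have "\<bar>t - (t + e) / (1 + q)\<bar> = \<bar>t * q - e\<bar> / (1 + q)" using q by (simp add: abs_divide)
  also have "\<dots> \<le> (r * (1 + 1/1000000) * (\<beta> / 100) + \<beta> / 1000000) / (1 + q)"
  proof (rule divide_right_mono)
    have "\<bar>t\<bar> \<le> r + r / 1000000" using assms(4,5) by linarith
    also have "\<dots> = r * (1 + 1/1000000)" by (simp add: algebra_simps)
    finally have tb: "\<bar>t\<bar> \<le> r * (1 + 1/1000000)" .
    have "\<bar>t * q\<bar> \<le> r * (1 + 1/1000000) * (\<beta> / 100)"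
      unfolding abs_mult by (rule mult_mono[OF tb assms(3)]) (use assms in auto)
    then show "\<bar>t * q - e\<bar> \<le> r * (1 + 1/1000000) * (\<beta> / 100) + \<beta> / 1000000" using assms(6) by linarith
  qed (use q in simp)
  also have "\<dots> \<le> (r * (1 + 1/1000000) * (\<beta> / 100) + r * \<beta> / 1000000) / (999/1000)"
    by (rule frac_le) (use assms q in \<open>auto simp: mult_le_cancel_right1\<close>)
  also have "\<dots> \<le> 21/2000 * r * \<beta>" using assms by (simp add: field_simps)
  finally show ?thesis .
qed

section \<open>Size estimates on a graph where all bounds hold\<close>

locale good_graph =
  fixes n :: nat and E :: graph
  assumes sub: "E \<subseteq> all_edges {1..n}"
    and L_ge: "1000000000000 \<le> ln (real n)"
    and D: "ln (real n) ^ 12 \<le> real n * dens n E ^ 3"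
    and small: "\<And>v. v \<in> vars n \<Longrightarrow> \<bar>dev n E v\<bar> \<le> bnd n E v"
begin

sublocale graph_on "{1..n}" E
  by unfold_locales (use sub in auto)

text \<open>Removing a triangle multiplies the density by \<open>1 - h\<close>, so \<open>h\<close> is the logarithmic time of one
  step.\<close>

definition "p = dens n E"
definition "c = real n * p\<^sup>2"
definition "h = 3 / real (card E)"
definition "\<beta> = rel_err n E"
definition "Q = real (card (triangles E))"
definition "Q0 = real n ^ 3 / 6 * p ^ 3"

lemma L: "1000000000 \<le> ln (real n)" using L_ge by simp

lemma n_ge: "real n \<ge> 1000000000"
proof -
  have "n > 0" using L by (cases n) auto
  then have "ln (real n) \<le> real n - 1" by (intro ln_le_minus_one) auto
  then show ?thesis using L by linarith
qed

lemma n_pos: "real n > 0" using n_ge by linarith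

lemma D_ge: "1 \<le> real n * p ^ 3"
proof -
  have "1 \<le> ln (real n) ^ 12" using L by (intro one_le_power) simp
  then show ?thesis using D by (simp add: p_def)
qed

lemma p_pos: "p > 0"
proof -
  have "p ^ 3 > 0" using D_ge n_pos by (smt (verit) zero_less_mult_iff zero_less_power zero_le_power)
  then show ?thesis by (simp add: zero_less_power_eq_numeral odd_pos power_less_zero_eq zero_less_power_eq)
qed

lemma p_le: "p \<le> 1" unfolding p_def by (rule dens_le_1[OF sub])

lemma card_E: "real (card E) = (real n)\<^sup>2 * p / 2"
  using n_pos by (simp add: p_def dens_def)

lemma card_E_pos: "real (card E) > 0" unfolding card_E using n_pos p_pos by simp

lemma h_eq: "h = 6 / ((real n)\<^sup>2 * p)" unfolding h_def card_E by simp

lemma h_pos: "h > 0" using card_E_pos by (simp add: h_def)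

lemma pow_le: "i \<le> j \<Longrightarrow> p ^ j \<le> p ^ i"
  using p_pos p_le by (intro power_decreasing) auto

lemma np_ge: "r \<le> 3 \<Longrightarrow> real n * p ^ 3 \<le> real n * p ^ r"
  using pow_le n_pos by simp

lemma np_pos: "real n * p ^ r > 0" using n_pos p_pos by simp

lemma c_pos: "c > 0" using n_pos p_pos by (simp add: c_def)

text \<open>An edge lies in about \<open>c\<close> of about \<open>Q0\<close> triangles, so a step
  removes it with probability about \<open>h\<close>. Consequently dividing a sum over triangles by
  \<open>h * Q\<close> turns it into a rate per unit of logarithmic time.\<close>

lemma hQ0: "h * Q0 = c"
  using n_pos p_pos by (simp add: h_eq Q0_def c_def field_simps power2_eq_square power3_eq_cube)

lemma Q0_pos: "Q0 > 0" using n_pos p_pos by (simp add: Q0_def)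

lemma h_np: assumes "1 \<le> r" shows "h * (real n * p ^ r) \<le> 1/100000000"
proof -
  have "h * (real n * p ^ r) \<le> h * (real n * p ^ 1)"
    using pow_le[OF assms] n_pos h_pos by (intro mult_left_mono) auto
  also have "\<dots> = 6 / real n" using n_pos p_pos by (simp add: h_eq field_simps power2_eq_square)
  also have "\<dots> \<le> 6 / 1000000000" using n_ge by (intro divide_left_mono) auto
  finally show ?thesis by simp
qed

lemma \<beta>_eq: "\<beta> = ln (real n) / sqrt (real n * p ^ 3)" by (simp add: \<beta>_def rel_err_def p_def)

lemma \<beta>_sq: "\<beta>\<^sup>2 * (real n * p ^ 3) = (ln (real n))\<^sup>2"
  using n_pos p_pos by (simp add: \<beta>_eq power_divide)

lemma \<beta>_pos: "\<beta> > 0" using np_pos[of 3] L by (simp add: \<beta>_eq)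

text \<open>By \<open>D\<close> the denominator of \<beta> is at least \<open>L ^ 6\<close>, and the
  numerator takes back one power of \<open>L\<close>.\<close>

lemma \<beta>_L: "\<beta> * ln (real n) ^ 5 \<le> 1"
proof -
  have L0: "ln (real n) > 0" using L by linarith
  have "ln (real n) ^ 6 = sqrt (ln (real n) ^ 12)"
    using L0 by (intro real_sqrt_unique[symmetric]) (auto simp: power_mult[symmetric])
  also have "\<dots> \<le> sqrt (real n * p ^ 3)" using D by (simp add: p_def)
  finally show ?thesis unfolding \<beta>_eq using np_pos[of 3] by (simp add: divide_le_eq power_Suc[symmetric] del: power_Suc)
qed

lemma \<beta>_le: "\<beta> \<le> 1/1000000000"
proof -
  have "\<beta> * 1000000000 \<le> \<beta> * ln (real n) ^ 5"
  proof (intro mult_left_mono)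
    have "(1000000000::real) \<le> 1000000000^5" by simp
    also have "\<dots> \<le> ln (real n) ^ 5" by (intro power_mono L) simp
    finally show "(1000000000::real) \<le> ln (real n) ^ 5" .
  qed (use \<beta>_pos in simp)
  then show ?thesis using \<beta>_L by simp
qed

text \<open>Supplies \<open>exp_step\<close> with the size \<open>X = n p ^ r\<close>; triple
  codegrees are the extreme case.\<close>

lemma Lsq_le: assumes "r \<le> 3" shows "(ln (real n))\<^sup>2 \<le> \<beta>\<^sup>2 * (real n * p ^ r)"
proof -
  have "(ln (real n))\<^sup>2 = \<beta>\<^sup>2 * (real n * p ^ 3)" by (simp add: \<beta>_sq)
  also have "\<dots> \<le> \<beta>\<^sup>2 * (real n * p ^ r)" by (rule mult_left_mono[OF np_ge[OF assms]]) simp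
  finally show ?thesis .
qed

lemma one_le_\<beta>sq: assumes "r \<le> 3" shows "1 \<le> \<beta>\<^sup>2 * (real n * p ^ r)"
proof -
  have "1 \<le> (ln (real n))\<^sup>2" using L by (simp add: abs_le_square_iff[of 1, simplified])
  then show ?thesis using Lsq_le[OF assms] by linarith
qed

text \<open>A term that lacks a factor \<open>c\<close> compared with the main term is therefore of
  relative size \<open>\<beta>\<^sup>2\<close>, negligible against \<beta>.\<close>

lemma one_le_\<beta>c: "1 \<le> \<beta>\<^sup>2 * c" using one_le_\<beta>sq[of 2] by (simp add: c_def)

lemma h_le: "h \<le> \<beta>\<^sup>2 / 100000000"
proof -
  have "h * 1 \<le> h * (\<beta>\<^sup>2 * (real n * p ^ 3))"
    using one_le_\<beta>sq[of 3] h_pos by (intro mult_left_mono) auto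
  also have "\<dots> = \<beta>\<^sup>2 * (h * (real n * p ^ 3))" by simp
  also have "\<dots> \<le> \<beta>\<^sup>2 * (1/100000000)" by (intro mult_left_mono h_np) auto
  finally show ?thesis by simp
qed

lemma \<beta>sq_le: "\<beta>\<^sup>2 \<le> \<beta> / 1000000000"
  using \<beta>_pos mult_left_mono[OF \<beta>_le, of \<beta>] by (simp add: power2_eq_square)

lemma h_le': "h \<le> \<beta> / 100000000000000000" using h_le \<beta>sq_le by linarith

lemma h_le'': "h \<le> 1/100000000000000000000000000" using h_le' \<beta>_le by linarith

lemma Tri_bd: "\<bar>Q - Q0\<bar> \<le> \<beta> / 100 * Q0"
  using small[of Tri] by (simp add: vars_def bnd_def Q_def Q0_def p_def \<beta>_def mult_ac)

lemma Cod_bd: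
  assumes "R \<subseteq> {1..n}" "card R \<in> {1, 2, 3}"
  shows "\<bar>cod E R - real n * p ^ card R\<bar> \<le> coef (Cod R) * \<beta> * (real n * p ^ card R)"
  using small[of "Cod R"] assms by (simp add: vars_def bnd_def p_def \<beta>_def mult_ac)

lemma Link_bd:
  assumes "R \<subseteq> {1..n}" "card R \<in> {1, 2}" "u \<in> R"
  shows "\<bar>lsum E u R - c * cod E R\<bar> \<le> coef (Link u R) * \<beta> * (real n * p ^ card R * c)"
proof -
  have "Link u R \<in> vars n" using assms by (auto simp: vars_def)
  from small[OF this] show ?thesis
    by (simp add: bnd_def p_def \<beta>_def c_def power_add power2_eq_square mult_ac)
qed

lemma coef_Cod_le: "coef (Cod R) \<le> 4" by simp

lemma cod_near:
  assumes "R \<subseteq> {1..n}" "card R \<in> {1, 2, 3}"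
  shows "cod E R \<le> (1 + 1/100000000) * (real n * p ^ card R)" "(1 - 1/100000000) * (real n * p ^ card R) \<le> cod E R"
proof -
  have "coef (Cod R) * \<beta> * (real n * p ^ card R) \<le> (4 * (1/1000000000)) * (real n * p ^ card R)"
    using \<beta>_le \<beta>_pos np_pos by (intro mult_right_mono mult_mono) (auto simp: less_imp_le)
  also have "\<dots> \<le> 1/100000000 * (real n * p ^ card R)" using np_pos[of "card R"] by (intro mult_right_mono) auto
  finally show "cod E R \<le> (1 + 1/100000000) * (real n * p ^ card R)" "(1 - 1/100000000) * (real n * p ^ card R) \<le> cod E R"
    using Cod_bd[OF assms] by (simp_all add: algebra_simps abs_le_iff)
qed

lemma edge_cod:
  assumes "{u, w} \<in> E"
  shows "\<bar>cod E {u, w} - c\<bar> \<le> 3/2 * \<beta> * c" "cod E {u, w} \<le> (1 + 1/100000000) * c"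
proof -
  have *: "{u, w} \<subseteq> {1..n}" "card {u, w} = 2" using edgeD[OF assms] by auto
  show "\<bar>cod E {u, w} - c\<bar> \<le> 3/2 * \<beta> * c" using Cod_bd[OF *(1)] *(2) by (simp add: c_def)
  show "cod E {u, w} \<le> (1 + 1/100000000) * c" using cod_near(1)[OF *(1)] *(2) by (simp add: c_def)
qed

lemma Q_pos: "Q > 0" and Q_ratio: "\<bar>Q / Q0 - 1\<bar> \<le> \<beta> / 100" and hQ: "h * Q = c * (Q / Q0)"
proof -
  have "Q - Q0 = (Q / Q0 - 1) * Q0" using Q0_pos by (simp add: field_simps)
  then have "\<bar>Q / Q0 - 1\<bar> * Q0 \<le> \<beta> / 100 * Q0" using Tri_bd Q0_pos by (simp add: abs_mult)
  then show r: "\<bar>Q / Q0 - 1\<bar> \<le> \<beta> / 100" using Q0_pos by simp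
  then have "Q / Q0 > 0" using \<beta>_le by linarith
  then show "Q > 0" using Q0_pos by (simp add: zero_less_divide_iff)
  show "h * Q = c * (Q / Q0)" using hQ0 Q0_pos by (simp add: field_simps)
qed

lemma triangles_nonempty: "triangles E \<noteq> {}"
  using Q_pos by (auto simp: Q_def)

lemma dens_diff:
  assumes "T \<in> triangles E"
  shows "dens n (E - all_edges T) = p * (1 - h)"
  unfolding dens_def card_diff_triangle[OF assms] p_def h_def
  using card_E_pos n_pos by (simp add: divide_simps)

section \<open>Drift of the codegrees and of the triangle count\<close>

lemma one_minus_pow:
  assumes "r \<in> {1, 2, 3::nat}"
  shows "\<bar>(1 - (1 - h) ^ r) / h - r\<bar> \<le> 3 * h" "(1 - h) ^ r \<le> 1" "0 \<le> (1 - h) ^ r"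
    "1 - (1 - h) ^ r \<le> r * h"
proof -
  have hs: "0 < h" "h \<le> 1/100000000000000000000000000" using h_pos h_le'' by auto
  have e: "(1 - (1 - h) ^ 1) / h = 1" "(1 - (1 - h) ^ 2) / h = 2 - h" "(1 - (1 - h) ^ 3) / h = 3 - 3 * h + h\<^sup>2"
    using hs by (simp_all add: field_simps power2_eq_square power3_eq_cube)
  have "h\<^sup>2 \<le> h" using hs by (simp add: power2_eq_square mult_left_le)
  then show "\<bar>(1 - (1 - h) ^ r) / h - r\<bar> \<le> 3 * h"
    using assms e hs zero_le_power2[of h] by (auto simp: abs_le_iff simp del: power_one_right zero_le_power2)
  show "(1 - h) ^ r \<le> 1" "0 \<le> (1 - h) ^ r" using hs by (auto intro!: power_le_one)
  show "1 - (1 - h) ^ r \<le> r * h"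
    using Bernoulli_inequality[of "-h" r] hs by simp
qed

text \<open>Per unit of logarithmic time the deviation \<open>cod E R - x\<close> drifts by
  \<open>- card R\<close> times itself minus the link deviations divided by \<open>c\<close>. The
  mean loss is \<open>W / Q\<close> up to lower order, \<open>W\<close> is
  \<open>card R * c * cod E R\<close> plus the link deviations, and \<open>h * Q\<close> is close to
  \<open>c\<close>. A decay at rate \<open>card R\<close> is the scaling of \<open>x\<close> itself,
  so the relative deviation is driven by the link deviations and the error of the triangle count
  only.\<close>

lemma Cod_drift:
  assumes R: "R \<subseteq> {1..n}" "card R \<in> {1, 2, 3}"
  defines "x \<equiv> real n * p ^ card R"
  defines "S \<equiv> (\<Sum>T\<in>triangles E. cod E R - cod (E - all_edges T) R)"
  shows "\<bar>x * ((1 - (1 - h) ^ card R) / h) - S / (h * Q) + card R * (cod E R - x)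
      + (\<Sum>u\<in>R. lsum E u R - c * cod E R) / c\<bar> \<le> 11/1000 * card R * \<beta> * x"
    and "S \<le> 4 * x * (h * Q)"
proof -
  have R0: "R \<noteq> {}" "finite R" using R finite_subset[OF R(1)] by auto
  define r where "r = real (card R)"
  have r: "1 \<le> r" "r \<le> 3" using R(2) by (auto simp: r_def)
  have x: "x > 0" unfolding x_def by (rule np_pos)
  define W where "W = (\<Sum>u\<in>R. lsum E u R)"
  define q where "q = Q / Q0 - 1"
  define t where "t = W / (c * x)"
  have SW: "S \<le> W" "W - r\<^sup>2 * cod E R \<le> S"
    using cod_drop_sum[OF R0] unfolding S_def W_def r_def sum_cod_eq[OF R0(2)] by auto
  have Y: "cod E R \<le> (1 + 1/100000000) * x" "(1 - 1/100000000) * x \<le> cod E R"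
    using cod_near[OF R] by (auto simp: x_def)
  have Y0: "cod E R \<ge> 0" by (simp add: cod_def)
  \<comment> \<open>This crude bound serves only to place \<open>t\<close> near \<open>r\<close>.
    The link deviations themselves are kept in the claim and cancel exactly against it.\<close>
  have lk: "\<bar>lsum E u R - c * cod E R\<bar> \<le> 2/1000000000 * c * cod E R" if "u \<in> R" for u
  proof -
    have "lsum E u R - c * cod E R = (\<Sum>w\<in>nb E R. cod E {u, w} - c)"
      by (simp add: lsum_def sum_subtractf cod_def mult.commute)
    also have "\<bar>\<dots>\<bar> \<le> (\<Sum>w\<in>nb E R. \<bar>cod E {u, w} - c\<bar>)" by (rule sum_abs)
    also have "\<dots> \<le> (\<Sum>w\<in>nb E R. 2/1000000000 * c)"
    proof (rule sum_mono)
      fix w assume "w \<in> nb E R"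
      then have "\<bar>cod E {u, w} - c\<bar> \<le> 3/2 * \<beta> * c" using that by (intro edge_cod) (auto simp: nb_def)
      also have "\<dots> \<le> 2/1000000000 * c" using \<beta>_le c_pos by (intro mult_right_mono) auto
      finally show "\<bar>cod E {u, w} - c\<bar> \<le> 2/1000000000 * c" .
    qed
    also have "\<dots> = 2/1000000000 * c * cod E R" by (simp add: cod_def mult_ac)
    finally show ?thesis .
  qed
  have Wlk: "(\<Sum>u\<in>R. lsum E u R - c * cod E R) = W - r * (c * cod E R)"
    by (simp add: W_def sum_subtractf r_def)
  have "\<bar>W - r * (c * cod E R)\<bar> \<le> (\<Sum>u\<in>R. 2/1000000000 * c * cod E R)"
    unfolding Wlk[symmetric] by (rule order_trans[OF sum_abs sum_mono]) (rule lk)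
  then have Wb: "\<bar>W - r * (c * cod E R)\<bar> \<le> r * (2/1000000000 * c * cod E R)" by (simp add: r_def)
  have tr: "\<bar>t - r\<bar> \<le> r / 1000000"
  proof -
    have "\<bar>cod E R - x\<bar> \<le> 1/100000000 * x" unfolding abs_le_iff using Y by (simp add: algebra_simps)
    then have "r * c * \<bar>cod E R - x\<bar> \<le> r * c * (1/100000000 * x)" using r c_pos by (intro mult_left_mono) auto
    moreover have "\<bar>r * (c * cod E R) - r * (c * x)\<bar> = r * c * \<bar>cod E R - x\<bar>"
    proof -
      have "r * (c * cod E R) - r * (c * x) = (r * c) * (cod E R - x)" by (simp add: algebra_simps)
      then show ?thesis using r c_pos by (simp add: abs_mult)
    qed
    moreover have "r * (2/1000000000 * c * cod E R) \<le> r * (2/1000000000 * c * (2 * x))"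
      using r c_pos Y(1) x by (intro mult_left_mono) auto
    ultimately have "\<bar>W - r * (c * x)\<bar> \<le> r * (2/1000000000 * c * (2 * x)) + r * c * (1/100000000 * x)"
      using Wb by linarith
    also have "\<dots> \<le> r / 1000000 * (c * x)" using r c_pos x by (simp add: field_simps)
    finally have "\<bar>W - r * (c * x)\<bar> \<le> r / 1000000 * (c * x)" .
    moreover have "W - r * (c * x) = (t - r) * (c * x)" unfolding t_def using c_pos x by (simp add: field_simps)
    ultimately have "\<bar>t - r\<bar> * (c * x) \<le> r / 1000000 * (c * x)" using c_pos x by (simp add: abs_mult)
    then show ?thesis using c_pos x by simp
  qed
  define e where "e = S / (c * x) - t"
  have e: "\<bar>e\<bar> \<le> \<beta> / 1000000"
  proof -
    have r2: "r\<^sup>2 \<le> 9" using r power_mono[of r 3 2] by simp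
    have "r\<^sup>2 * cod E R \<le> 9 * (2 * x)" using Y(1) Y0 x r2 by (intro mult_mono) auto
    then have a: "\<bar>S - W\<bar> \<le> 18 * x" using SW by linarith
    have "18 * x = 18 * x * 1" by simp
    also have "\<dots> \<le> 18 * x * (\<beta>\<^sup>2 * c)" using one_le_\<beta>c x by (intro mult_left_mono) auto
    also have "\<dots> \<le> 18 * x * (\<beta> / 1000000000 * c)"
      using \<beta>sq_le x c_pos by (intro mult_left_mono mult_right_mono) auto
    also have "\<dots> \<le> \<beta> / 1000000 * (c * x)" using x c_pos \<beta>_pos by (simp add: field_simps)
    finally have "\<bar>S - W\<bar> \<le> \<beta> / 1000000 * (c * x)" using a by linarith
    moreover have "S - W = e * (c * x)" unfolding e_def t_def using c_pos x by (simp add: field_simps)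
    ultimately have "\<bar>e\<bar> * (c * x) \<le> \<beta> / 1000000 * (c * x)" using c_pos x by (simp add: abs_mult)
    then show ?thesis using c_pos x by simp
  qed
  have q: "\<bar>q\<bar> \<le> \<beta> / 100" unfolding q_def by (rule Q_ratio)
  have q1: "1 + q \<ge> 99/100" using q \<beta>_le by linarith
  have hQ': "h * Q = c * (1 + q)" using hQ by (simp add: q_def)
  have SQ: "S / (h * Q) = x * ((t + e) / (1 + q))"
    unfolding hQ' e_def using x by simp
  have main: "\<bar>t - (t + e) / (1 + q)\<bar> \<le> 21/2000 * r * \<beta>"
    by (rule ratio_err[OF \<beta>_pos \<beta>_le q r(1) tr e])
  have pw: "\<bar>(1 - (1 - h) ^ card R) / h - r\<bar> \<le> 3 * h"
    unfolding r_def by (rule one_minus_pow(1)[OF R(2)])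
  have Wt: "(\<Sum>u\<in>R. lsum E u R - c * cod E R) / c = x * t - r * cod E R"
    unfolding Wlk t_def using c_pos x by (simp add: field_simps)
  have "x * ((1 - (1 - h) ^ card R) / h) - S / (h * Q) + card R * (cod E R - x)
      + (\<Sum>u\<in>R. lsum E u R - c * cod E R) / c
    = x * (((1 - (1 - h) ^ card R) / h - r) + (t - (t + e) / (1 + q)))"
    unfolding SQ Wt r_def[symmetric] by (simp add: algebra_simps)
  also have "\<bar>\<dots>\<bar> = x * \<bar>((1 - (1 - h) ^ card R) / h - r) + (t - (t + e) / (1 + q))\<bar>"
    using x by (simp add: abs_mult)
  also have "\<dots> \<le> x * (3 * h + 21/2000 * r * \<beta>)"
    using pw main x by (intro mult_left_mono) linarith+
  also have "\<dots> \<le> x * (11/1000 * r * \<beta>)"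
  proof (rule mult_left_mono)
    have "3 * h \<le> \<beta> / 1000000" using h_le' \<beta>_pos by simp
    also have "\<dots> \<le> r * \<beta> / 1000000" using r \<beta>_pos by (simp add: divide_right_mono)
    finally have "3 * h \<le> (r * \<beta>) / 1000000" by simp
    moreover have "0 \<le> r * \<beta>" using r \<beta>_pos by simp
    ultimately have "3 * h + 21/2000 * (r * \<beta>) \<le> 11/1000 * (r * \<beta>)" by linarith
    then show "3 * h + 21/2000 * r * \<beta> \<le> 11/1000 * r * \<beta>" by (simp only: mult.assoc)
  qed (use x in simp)
  finally show "\<bar>x * ((1 - (1 - h) ^ card R) / h) - S / (h * Q) + card R * (cod E R - x)
      + (\<Sum>u\<in>R. lsum E u R - c * cod E R) / c\<bar> \<le> 11/1000 * card R * \<beta> * x"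
    by (simp add: r_def mult_ac)
  have "(t + e) / (1 + q) \<le> 4"
  proof -
    have "t + e \<le> 39/10" using tr e r \<beta>_le by linarith
    then show ?thesis using q1 by (simp add: divide_le_eq)
  qed
  then have "S / (h * Q) \<le> x * 4" unfolding SQ using x by (intro mult_left_mono) auto
  then show "S \<le> 4 * x * (h * Q)" using h_pos Q_pos by (simp add: divide_le_eq mult_ac)
qed

text \<open>The mean loss is the second moment of the codegrees of edges. Since their sum is exactly
  \<open>3 * Q\<close>, their deviations from \<open>c\<close> contribute no linear term beyond one
  in \<open>Q\<close>; what remains is the variance \<open>Z\<close>, of relative order
  \<open>\<beta>\<^sup>2\<close>. So the triangle count drives its own error, and a coefficient as
  small as 1/100 is sustainable.\<close>

lemma Tri_drift:
  defines "S \<equiv> (\<Sum>T\<in>triangles E. Q - real (card (triangles (E - all_edges T))))"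
  shows "\<bar>Q0 * ((1 - (1 - h) ^ 3) / h) - S / (h * Q) + 3 * (Q - Q0)\<bar> \<le> \<beta> / 1000000 * Q0"
    and "S \<le> 4 * Q0 * (h * Q)"
proof -
  define q where "q = Q / Q0 - 1"
  define s2 where "s2 = (\<Sum>e\<in>E. (tri_deg E e)\<^sup>2)"
  define Z where "Z = (\<Sum>e\<in>E. (tri_deg E e - c)\<^sup>2)"
  have q: "\<bar>q\<bar> \<le> \<beta> / 100" unfolding q_def by (rule Q_ratio)
  have q1: "1 + q \<ge> 99/100" using q \<beta>_le by linarith
  have Qq: "Q = Q0 * (1 + q)" using Q0_pos by (simp add: q_def)
  have m: "real (card E) = 3 / h" using card_E_pos by (simp add: h_def)
  have td: "\<bar>tri_deg E e - c\<bar> \<le> 3/2 * \<beta> * c" if e: "e \<in> E" for e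
  proof -
    obtain u w where "e = {u, w}" using edge_pair[OF e] by blast
    then show ?thesis using edge_cod(1)[of u w] tri_deg_eq_cod[of u w] e by simp
  qed
  have "(\<Sum>e\<in>E. (tri_deg E e)\<^sup>2) = (\<Sum>e\<in>E. (tri_deg E e - c)\<^sup>2 + 2 * c * tri_deg E e - c\<^sup>2)"
    by (intro sum.cong refl) (simp add: power2_eq_square algebra_simps)
  also have "\<dots> = Z + 2 * c * (3 * Q) - c\<^sup>2 * (3 / h)"
    unfolding sum_subtractf sum.distrib sum_distrib_left[symmetric] sum_tri_deg Z_def Q_def m[symmetric]
    by simp
  finally have s2: "s2 = Z + 6 * c * Q - 3 * c\<^sup>2 / h" by (simp add: s2_def)
  have Z: "0 \<le> Z" "Z \<le> 3 * (\<beta>\<^sup>2 * c * Q0) * (9/4)"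
  proof -
    show "0 \<le> Z" unfolding Z_def by (intro sum_nonneg) simp
    have "Z \<le> (\<Sum>e\<in>E. (3/2 * \<beta> * c)\<^sup>2)"
      unfolding Z_def
    proof (rule sum_mono)
      fix e assume "e \<in> E"
      then show "(tri_deg E e - c)\<^sup>2 \<le> (3/2 * \<beta> * c)\<^sup>2"
        using td[of e] c_pos \<beta>_pos by (simp add: abs_le_square_iff[symmetric])
    qed
    also have "\<dots> = 3 / h * (9/4 * \<beta>\<^sup>2 * c\<^sup>2)" by (simp add: m power_mult_distrib power_divide)
    also have "\<dots> = 3 * (\<beta>\<^sup>2 * c * (c / h)) * (9/4)" by (simp add: power2_eq_square)
    also have "c / h = Q0" using hQ0 h_pos by (simp add: field_simps)
    finally show "Z \<le> 3 * (\<beta>\<^sup>2 * c * Q0) * (9/4)" .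
  qed
  have cc: "3 * c\<^sup>2 / h = 3 * c * Q0" using hQ0 h_pos by (simp add: field_simps power2_eq_square)
  have S: "S \<le> s2" "s2 - 9 * Q \<le> S" using tri_drop_sum unfolding S_def s2_def Q_def by auto
  define e where "e = (S - (6 * c * Q - 3 * c * Q0)) / (c * Q0)"
  have Q0c: "0 < c * Q0" using c_pos Q0_pos by simp
  have e: "\<bar>e\<bar> \<le> 20 * \<beta>\<^sup>2"
  proof -
    have "9 * Q \<le> 10 * Q0" using q \<beta>_le Q0_pos unfolding Qq by simp
    also have "10 * Q0 * 1 \<le> 10 * Q0 * (\<beta>\<^sup>2 * c)" using one_le_\<beta>c Q0_pos by (intro mult_left_mono) auto
    finally have "9 * Q \<le> 10 * (\<beta>\<^sup>2 * c * Q0)" by (simp add: mult_ac)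
    then have "\<bar>S - (6 * c * Q - 3 * c * Q0)\<bar> \<le> 10 * (\<beta>\<^sup>2 * c * Q0)"
      using S Z unfolding s2 cc by linarith
    also have "\<dots> = 10 * \<beta>\<^sup>2 * (c * Q0)" by simp
    also have "\<dots> \<le> 20 * \<beta>\<^sup>2 * (c * Q0)" using Q0c by (intro mult_right_mono) auto
    finally show ?thesis using Q0c unfolding e_def by (simp add: abs_divide divide_le_eq)
  qed
  have Seq: "S = (3 + 6 * q + e) * (c * Q0)"
    unfolding e_def Qq using c_pos Q0_pos by (simp add: field_simps)
  have hQ': "h * Q = c * (1 + q)" using hQ by (simp add: q_def)
  have SQ: "S / (h * Q) = Q0 * ((3 + 6 * q + e) / (1 + q))"
    unfolding Seq hQ' using c_pos by simp
  have pw: "\<bar>(1 - (1 - h) ^ 3) / h - 3\<bar> \<le> 3 * h" using one_minus_pow(1)[of 3] by simp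
  \<comment> \<open>The terms linear in \<open>q\<close> cancel, leaving \<open>q\<^sup>2\<close>
    and \<open>e\<close>.\<close>
  have "3 - (3 + 6 * q + e) / (1 + q) + 3 * q = (3 * q\<^sup>2 - e) / (1 + q)"
    using q1 by (simp add: field_simps power2_eq_square)
  also have "\<bar>\<dots>\<bar> \<le> 30 * \<beta>\<^sup>2"
  proof -
    have "q\<^sup>2 \<le> (\<beta> / 100)\<^sup>2" using q by (simp add: abs_le_square_iff[symmetric])
    then have "q\<^sup>2 \<le> \<beta>\<^sup>2 / 10000" by (simp add: power_divide)
    then have "3 * q\<^sup>2 \<le> \<beta>\<^sup>2" using zero_le_power2[of q] by linarith
    then have "\<bar>3 * q\<^sup>2 - e\<bar> \<le> 21 * \<beta>\<^sup>2" using e zero_le_power2[of q] by linarith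
    also have "\<dots> \<le> 30 * \<beta>\<^sup>2 * (99/100)" by simp
    also have "\<dots> \<le> 30 * \<beta>\<^sup>2 * (1 + q)" using q1 by (intro mult_left_mono) auto
    finally show ?thesis using q1 by (simp add: abs_divide divide_le_eq)
  qed
  finally have main: "\<bar>3 - (3 + 6 * q + e) / (1 + q) + 3 * q\<bar> \<le> 30 * \<beta>\<^sup>2" .
  have "Q0 * ((1 - (1 - h) ^ 3) / h) - S / (h * Q) + 3 * (Q - Q0)
    = Q0 * (((1 - (1 - h) ^ 3) / h - 3) + (3 - (3 + 6 * q + e) / (1 + q) + 3 * q))"
    unfolding SQ by (simp add: Qq algebra_simps)
  also have "\<bar>\<dots>\<bar> = Q0 * \<bar>((1 - (1 - h) ^ 3) / h - 3) + (3 - (3 + 6 * q + e) / (1 + q) + 3 * q)\<bar>"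
    using Q0_pos by (simp add: abs_mult)
  also have "\<dots> \<le> Q0 * (3 * h + 30 * \<beta>\<^sup>2)"
    using pw main Q0_pos by (intro mult_left_mono) linarith+
  also have "\<dots> \<le> Q0 * (\<beta> / 1000000)"
    using h_le' \<beta>sq_le \<beta>_pos Q0_pos by (intro mult_left_mono) auto
  finally show "\<bar>Q0 * ((1 - (1 - h) ^ 3) / h) - S / (h * Q) + 3 * (Q - Q0)\<bar> \<le> \<beta> / 1000000 * Q0"
    by (simp add: mult.commute)
  have "\<beta>\<^sup>2 \<le> 1/1000" using \<beta>sq_le \<beta>_le by linarith
  then have "3 + 6 * q + e \<le> 4 + 4 * q" using e q \<beta>_le by linarith
  then have "3 + 6 * q + e \<le> 4 * (1 + q)" by simp
  then have "(3 + 6 * q + e) / (1 + q) \<le> 4" using q1 by (simp add: divide_le_eq)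
  then have "S / (h * Q) \<le> Q0 * 4" unfolding SQ using Q0_pos by (intro mult_left_mono) auto
  then show "S \<le> 4 * Q0 * (h * Q)" using h_pos Q_pos by (simp add: divide_le_eq mult_ac)
qed

section \<open>Drift of the link sums\<close>

lemma sum_insert_cod:
  assumes u: "u \<in> R" "finite R"
  shows "(\<Sum>x\<in>nb E {u}. cod E (insert x R)) = lsum E u R"
proof -
  have R: "R \<noteq> {}" using u by auto
  \<comment> \<open>Both sides of the claim count the paths, grouped by \<open>x\<close> on the left
    and by \<open>w\<close> on the right.\<close>
  have "(\<Sum>x\<in>nb E {u}. cod E (insert x R)) = real (card (SIGMA x:nb E {u}. nb E (insert x R)))"
    unfolding cod_def by (subst card_SigmaI) (auto intro!: finite_nb)
  also have "card (SIGMA x:nb E {u}. nb E (insert x R)) = card (paths E u R)"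
    by (rule bij_betw_same_card[of "\<lambda>(x, w). (w, x)"], rule bij_betw_byWitness[of _ "\<lambda>(w, x). (x, w)"])
       (use u in \<open>auto simp: paths_def nb_def insert_commute\<close>)
  finally show ?thesis by (simp add: lsum_eq_card[OF R])
qed

text \<open>Expanding every codegree around \<open>c\<close>, and \<open>cod E (insert y R)\<close> around its expected value,
  leaves only terms linear in tracked deviations; this is where the triple codegrees enter.\<close>

lemma Link_drift_main:
  assumes R: "R \<subseteq> {1..n}" "card R \<in> {1, 2}" "u \<in> R"
  defines "x \<equiv> real n * p ^ card R" and "A \<equiv> lsum E u R - c * cod E R"
  defines "P \<equiv> (\<Sum>w\<in>nb E R. cod E {u, w} * (\<Sum>r\<in>R. cod E {r, w}))
      + (\<Sum>y\<in>nb E {u}. cod E (insert y R) * cod E {u, y})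
      + (\<Sum>w\<in>nb E R. lsum E w {w, u})"
    and "W \<equiv> (\<Sum>w\<in>nb E R. \<Sum>r\<in>R. cod E {r, w})"
  shows "\<bar>P - c * W - (real (card R + 2) * c * A + 2 * c\<^sup>2 * cod E R
       + real n * p ^ (card R + 1) * (lsum E u {u} - c * cod E {u})
       + (\<Sum>w\<in>nb E R. lsum E w {w, u} - c * cod E {w, u}))\<bar> \<le> 40 * \<beta>\<^sup>2 * (x * c\<^sup>2)"
proof -
  have finR: "finite R" and R0: "R \<noteq> {}" using R finite_subset[OF R(1)] by auto
  define r where "r = real (card R)"
  have r: "1 \<le> r" "r \<le> 2" using R(2) by (auto simp: r_def)
  have x: "x > 0" unfolding x_def by (rule np_pos)
  define x' where "x' = real n * p ^ (card R + 1)"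
  have x'x: "x' = x * p" by (simp add: x'_def x_def)
  have x': "0 < x'" "x' \<le> x" using x p_pos p_le by (auto simp: x'x mult_le_cancel_left1)
  have Y: "cod E R \<le> (1 + 1/100000000) * x" using cod_near(1)[OF R(1)] R(2) by (auto simp: x_def)
  define z where "z w v = cod E {w, v} - c" for w v
  have z: "\<bar>z w v\<bar> \<le> 3/2 * \<beta> * c" if "{w, v} \<in> E" for w v
    unfolding z_def by (rule edge_cod(1)[OF that])
  have A_eq: "A = (\<Sum>w\<in>nb E R. z u w)"
    by (simp add: A_def lsum_def z_def sum_subtractf cod_def mult.commute)
  define E1 where "E1 = (\<Sum>w\<in>nb E R. z u w * (\<Sum>s\<in>R. z s w))"
  have P1: "(\<Sum>w\<in>nb E R. cod E {u, w} * (\<Sum>s\<in>R. cod E {s, w})) - c * W = r * c * A + E1"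
  proof -
    have "(\<Sum>w\<in>nb E R. cod E {u, w} * (\<Sum>s\<in>R. cod E {s, w})) - c * W
        = (\<Sum>w\<in>nb E R. z u w * (\<Sum>s\<in>R. cod E {s, w}))"
      unfolding W_def z_def by (simp add: sum_distrib_left[of c "\<lambda>w. \<Sum>r\<in>R. cod E {r, w}"] sum_subtractf[symmetric] left_diff_distrib)
    also have "\<dots> = (\<Sum>w\<in>nb E R. z u w * (r * c) + z u w * (\<Sum>s\<in>R. z s w))"
      by (intro sum.cong refl) (simp add: z_def sum_subtractf r_def distrib_left[symmetric])
    also have "\<dots> = r * c * A + E1"
      by (simp add: sum.distrib A_eq E1_def sum_distrib_left mult_ac)
    finally show ?thesis .
  qed
  have E1: "\<bar>E1\<bar> \<le> 10 * \<beta>\<^sup>2 * (x * c\<^sup>2)"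
  proof -
    have "\<bar>E1\<bar> \<le> (\<Sum>w\<in>nb E R. \<bar>z u w * (\<Sum>s\<in>R. z s w)\<bar>)" unfolding E1_def by (rule sum_abs)
    also have "\<dots> \<le> (\<Sum>w\<in>nb E R. (3/2 * \<beta> * c) * (r * (3/2 * \<beta> * c)))"
    proof (rule sum_mono)
      fix w assume w: "w \<in> nb E R"
      have "\<bar>\<Sum>s\<in>R. z s w\<bar> \<le> (\<Sum>s\<in>R. 3/2 * \<beta> * c)"
        by (rule order_trans[OF sum_abs sum_mono], rule z) (use w in \<open>auto simp: nb_def\<close>)
      then have "\<bar>\<Sum>s\<in>R. z s w\<bar> \<le> r * (3/2 * \<beta> * c)" by (simp add: r_def)
      then show "\<bar>z u w * (\<Sum>s\<in>R. z s w)\<bar> \<le> (3/2 * \<beta> * c) * (r * (3/2 * \<beta> * c))"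
        unfolding abs_mult using w R(3) z[of u w] \<beta>_pos c_pos
        by (intro mult_mono) (auto simp: nb_def)
    qed
    also have "\<dots> = cod E R * (9/4 * r * \<beta>\<^sup>2 * c\<^sup>2)" by (simp add: cod_def power2_eq_square)
    also have "\<dots> \<le> (2 * x) * (9/4 * 2 * \<beta>\<^sup>2 * c\<^sup>2)"
      using Y x r \<beta>_pos c_pos by (intro mult_mono) (auto simp: cod_def)
    also have "\<dots> \<le> 10 * \<beta>\<^sup>2 * (x * c\<^sup>2)" using x by simp
    finally show ?thesis .
  qed
  define E2 where "E2 = (\<Sum>y\<in>nb E {u}. (cod E (insert y R) - x') * z u y)"
  have P2: "(\<Sum>y\<in>nb E {u}. cod E (insert y R) * cod E {u, y})
      = c * (A + c * cod E R) + x' * (lsum E u {u} - c * cod E {u}) + E2"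
  proof -
    have "(\<Sum>y\<in>nb E {u}. cod E (insert y R) * cod E {u, y})
        = (\<Sum>y\<in>nb E {u}. c * cod E (insert y R) + x' * z u y + (cod E (insert y R) - x') * z u y)"
      by (intro sum.cong refl) (simp add: z_def algebra_simps)
    also have "\<dots> = c * lsum E u R + x' * (\<Sum>y\<in>nb E {u}. z u y) + E2"
      by (simp add: sum.distrib sum_distrib_left[symmetric] sum_insert_cod[OF R(3) finR] E2_def)
    also have "(\<Sum>y\<in>nb E {u}. z u y) = lsum E u {u} - c * cod E {u}"
      by (simp add: lsum_def z_def sum_subtractf cod_def mult.commute)
    finally show ?thesis by (simp add: A_def)
  qed
  have E2: "\<bar>E2\<bar> \<le> 20 * \<beta>\<^sup>2 * (x * c\<^sup>2)"
  proof -
    have u: "u \<in> {1..n}" using R by auto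
    have "\<bar>E2\<bar> \<le> (\<Sum>y\<in>nb E {u}. \<bar>(cod E (insert y R) - x') * z u y\<bar>)" unfolding E2_def by (rule sum_abs)
    \<comment> \<open>The factor 4 is the largest codegree coefficient. For \<open>y \<in> R\<close>
      the set \<open>insert y R\<close> is just \<open>R\<close>, so the codegree is larger than the
      expected \<open>x'\<close>; as there are at most two such \<open>y\<close>, the crude bound
      \<open>2 * x\<close> is affordable.\<close>
    also have "\<dots> \<le> (\<Sum>y\<in>nb E {u}. (4 * \<beta> * x' + (if y \<in> R then 2 * x else 0)) * (3/2 * \<beta> * c))"
    proof (rule sum_mono)
      fix y assume y: "y \<in> nb E {u}"
      then have yn: "y \<in> {1..n}" "{u, y} \<in> E" using edgeD[of u y] by (auto simp: nb_def)
      have "\<bar>cod E (insert y R) - x'\<bar> \<le> 4 * \<beta> * x' + (if y \<in> R then 2 * x else 0)"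
      proof (cases "y \<in> R")
        case True
        then have "insert y R = R" by auto
        moreover have "0 \<le> cod E R" by (simp add: cod_def)
        ultimately have "\<bar>cod E (insert y R) - x'\<bar> \<le> 2 * x" using Y x x' by simp
        moreover have "0 \<le> 4 * \<beta> * x'" using \<beta>_pos x' by simp
        ultimately have "\<bar>cod E (insert y R) - x'\<bar> \<le> 4 * \<beta> * x' + 2 * x" by linarith
        then show ?thesis using True by simp
      next
        case False
        then have cd: "card (insert y R) = card R + 1" using finR by simp
        have "\<bar>cod E (insert y R) - x'\<bar> \<le> coef (Cod (insert y R)) * \<beta> * x'"
          using Cod_bd[of "insert y R"] R yn unfolding x'_def cd by auto
        also have "\<dots> \<le> 4 * \<beta> * x'" using coef_Cod_le \<beta>_pos x' by (intro mult_right_mono) auto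
        finally show ?thesis using False by simp
      qed
      then show "\<bar>(cod E (insert y R) - x') * z u y\<bar>
          \<le> (4 * \<beta> * x' + (if y \<in> R then 2 * x else 0)) * (3/2 * \<beta> * c)"
        unfolding abs_mult using z[OF yn(2)] \<beta>_pos c_pos x x' by (intro mult_mono) auto
    qed
    also have "\<dots> = (cod E {u} * (4 * \<beta> * x') + (\<Sum>y\<in>nb E {u}. if y \<in> R then 2 * x else 0)) * (3/2 * \<beta> * c)"
      unfolding sum_distrib_right[symmetric] sum.distrib by (simp add: cod_def)
    also have "\<dots> \<le> (2 * (real n * p) * (4 * \<beta> * x') + 4 * x) * (3/2 * \<beta> * c)"
    proof (intro mult_right_mono add_mono)
      show "cod E {u} \<le> 2 * (real n * p)" using cod_near(1)[of "{u}"] u np_pos[of 1] by simp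
      have "(\<Sum>y\<in>nb E {u}. if y \<in> R then 2 * x else 0) = card (nb E {u} \<inter> R) * (2 * x)"
        by (simp add: sum.If_cases finite_nb Int_def)
      also have "\<dots> \<le> 2 * (2 * x)"
      proof (intro mult_right_mono)
        have "card (nb E {u} \<inter> R) \<le> card R" by (intro card_mono finR) auto
        then show "real (card (nb E {u} \<inter> R)) \<le> 2" using R(2) by auto
      qed (use x in simp)
      finally show "(\<Sum>y\<in>nb E {u}. if y \<in> R then 2 * x else 0) \<le> 4 * x" by simp
    qed (use \<beta>_pos c_pos x' in auto)
    also have "\<dots> = 12 * \<beta>\<^sup>2 * (x * c) * (real n * p * p) + 6 * (\<beta> * x * c)"
      unfolding x'x by (simp add: algebra_simps power2_eq_square)
    also have "real n * p * p = c" by (simp add: c_def power2_eq_square)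
    \<comment> \<open>The exceptional \<open>y\<close> lack a factor \<open>c\<close> in comparison
      with the rest, and \<open>1 \<le> \<beta>\<^sup>2 * c\<close> restores it.\<close>
    also have "6 * (\<beta> * x * c) \<le> 6 * (\<beta>\<^sup>2 * (x * c\<^sup>2))"
    proof -
      have "\<beta> * x * c * 1 \<le> \<beta> * x * c * (\<beta>\<^sup>2 * c)"
        using one_le_\<beta>c \<beta>_pos x c_pos by (intro mult_left_mono) auto
      also have "\<dots> = \<beta> * (\<beta>\<^sup>2 * (x * c\<^sup>2))" by (simp add: power2_eq_square)
      also have "\<dots> \<le> 1 * (\<beta>\<^sup>2 * (x * c\<^sup>2))" using \<beta>_le x by (intro mult_right_mono) auto
      finally show ?thesis by simp
    qed
    finally have "\<bar>E2\<bar> \<le> 12 * \<beta>\<^sup>2 * (x * c) * c + 6 * (\<beta>\<^sup>2 * (x * c\<^sup>2))" by simp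
    also have "\<dots> = 18 * \<beta>\<^sup>2 * (x * c\<^sup>2)" by (simp add: power2_eq_square)
    also have "\<dots> \<le> 20 * \<beta>\<^sup>2 * (x * c\<^sup>2)" using x by (intro mult_right_mono) auto
    finally show ?thesis .
  qed
  have P3: "(\<Sum>w\<in>nb E R. lsum E w {w, u})
      = (\<Sum>w\<in>nb E R. lsum E w {w, u} - c * cod E {w, u}) + c * (A + c * cod E R)"
  proof -
    have "(\<Sum>w\<in>nb E R. c * cod E {w, u}) = c * lsum E u R"
      unfolding lsum_def sum_distrib_left by (intro sum.cong refl) (simp add: insert_commute)
    then show ?thesis by (simp add: sum_subtractf A_def)
  qed
  have "P - c * W - (real (card R + 2) * c * A + 2 * c\<^sup>2 * cod E R
       + real n * p ^ (card R + 1) * (lsum E u {u} - c * cod E {u})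
       + (\<Sum>w\<in>nb E R. lsum E w {w, u} - c * cod E {w, u})) = E1 + E2"
    unfolding P_def P2 P3 x'_def[symmetric] r_def[symmetric] using P1
    by (simp add: algebra_simps power2_eq_square r_def)
  then show ?thesis using E1 E2 by linarith
qed

lemma lsum_le:
  assumes "u \<in> R"
  shows "lsum E u R \<le> cod E R * ((1 + 1/100000000) * c)"
proof -
  have "lsum E u R \<le> (\<Sum>w\<in>nb E R. (1 + 1/100000000) * c)"
    unfolding lsum_def by (intro sum_mono edge_cod(2)) (use assms in \<open>auto simp: nb_def\<close>)
  then show ?thesis by (simp add: cod_def)
qed

text \<open>The two terms that drive a link deviation, in units of \<open>\<beta> * x * c\<close>:
  one comes from the average over all neighbours of \<open>u\<close>, the other from the link
  deviations of the pairs \<open>{w, u}\<close>. The constants 21/50 and 1 are the link coefficients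
  for one and for two vertices.\<close>

lemma Link_terms:
  assumes R: "R \<subseteq> {1..n}" "card R \<in> {1, 2}" "u \<in> R"
  defines "x \<equiv> real n * p ^ card R"
  shows "\<bar>p ^ (card R - 1) * (lsum E u {u} - c * cod E {u})\<bar> \<le> 21/50 * \<beta> * (x * c)"
    and "\<bar>(\<Sum>w\<in>nb E R. lsum E w {w, u} - c * cod E {w, u}) / c\<bar> \<le> (1 + 1/100000000) * \<beta> * (x * c)"
proof -
  have u: "{u} \<subseteq> {1..n}" using R by auto
  have "\<bar>p ^ (card R - 1) * (lsum E u {u} - c * cod E {u})\<bar>
      \<le> p ^ (card R - 1) * (21/50 * \<beta> * (real n * p * c))"
    using Link_bd[OF u, of u] p_pos by (simp add: abs_mult)
  also have "\<dots> = 21/50 * \<beta> * (x * c)"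
    using R(2) by (auto simp: x_def power2_eq_square)
  finally show "\<bar>p ^ (card R - 1) * (lsum E u {u} - c * cod E {u})\<bar> \<le> 21/50 * \<beta> * (x * c)" .
  have "\<bar>\<Sum>w\<in>nb E R. lsum E w {w, u} - c * cod E {w, u}\<bar> \<le> (\<Sum>w\<in>nb E R. \<beta> * (c * c))"
  proof (rule order_trans[OF sum_abs sum_mono])
    fix w assume "w \<in> nb E R"
    then have "{u, w} \<in> E" using R(3) by (simp add: nb_def)
    then have "{w, u} \<subseteq> {1..n}" "card {w, u} = 2" using edgeD[of u w] by auto
    then show "\<bar>lsum E w {w, u} - c * cod E {w, u}\<bar> \<le> \<beta> * (c * c)"
      using Link_bd[of "{w, u}" w] by (simp add: c_def[symmetric])
  qed
  also have "\<dots> = cod E R * (\<beta> * c) * c" by (simp add: cod_def)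
  also have "\<dots> \<le> ((1 + 1/100000000) * x) * (\<beta> * c) * c"
    using cod_near(1)[OF R(1)] R(2) \<beta>_pos c_pos unfolding x_def
    by (intro mult_right_mono) auto
  finally have "\<bar>\<Sum>w\<in>nb E R. lsum E w {w, u} - c * cod E {w, u}\<bar> \<le> ((1 + 1/100000000) * \<beta> * (x * c)) * c"
    by (simp add: mult_ac)
  then show "\<bar>(\<Sum>w\<in>nb E R. lsum E w {w, u} - c * cod E {w, u}) / c\<bar> \<le> (1 + 1/100000000) * \<beta> * (x * c)"
    using c_pos by (simp add: abs_divide divide_le_eq)
qed

text \<open>Product rule: the deviation moves through the link sum, through the codegree and through
  \<open>c\<close>, which becomes \<open>c * (1 - h)\<^sup>2\<close>. In the proof \<open>B\<close>
  is the first-order value of \<open>SS - c * SY\<close>; its main part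
  \<open>2 * c\<^sup>2 * Y\<close> is cancelled by the decrease of \<open>c\<close>, and
  \<open>G\<close> is what is left. In \<open>G\<close> the term with \<open>A\<close> is the
  scaling rate \<open>expo\<close>, the other two are the driving terms.\<close>

lemma Link_drift:
  assumes R: "R \<subseteq> {1..n}" "card R \<in> {1, 2}" "u \<in> R"
  defines "x \<equiv> real n * p ^ card R" and "A \<equiv> lsum E u R - c * cod E R"
  defines "SS \<equiv> (\<Sum>T\<in>triangles E. lsum E u R - lsum (E - all_edges T) u R)"
    and "SY \<equiv> (\<Sum>T\<in>triangles E. cod E R - cod (E - all_edges T) R)"
  defines "G \<equiv> real (card R + 2) * A + p ^ (card R - 1) * (lsum E u {u} - c * cod E {u})
       + (\<Sum>w\<in>nb E R. lsum E w {w, u} - c * cod E {w, u}) / c"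
  shows "\<bar>(- SS + c * (1 - h)\<^sup>2 * SY) / (h * Q) + c * ((1 - (1 - h)\<^sup>2) / h) * cod E R + G\<bar>
       \<le> 22/1000 * \<beta> * (x * c)"
    and "SS \<le> 6 * (x * c) * (h * Q)"
proof -
  have finR: "finite R" and R0: "R \<noteq> {}" using R finite_subset[OF R(1)] by auto
  have R3: "card R \<in> {1, 2, 3}" using R(2) by auto
  define r where "r = real (card R)"
  have r: "1 \<le> r" "r \<le> 2" using R(2) by (auto simp: r_def)
  have x: "x > 0" unfolding x_def by (rule np_pos)
  define Y where "Y = cod E R"
  have Y: "Y \<le> (1 + 1/100000000) * x" "(1 - 1/100000000) * x \<le> Y" "0 \<le> Y"
    using cod_near[OF R(1)] R(2) by (auto simp: x_def Y_def cod_def)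
  define P where "P = (\<Sum>w\<in>nb E R. cod E {u, w} * (\<Sum>r\<in>R. cod E {r, w}))
      + (\<Sum>y\<in>nb E {u}. cod E (insert y R) * cod E {u, y})
      + (\<Sum>w\<in>nb E R. lsum E w {w, u})"
  define W where "W = (\<Sum>w\<in>nb E R. \<Sum>r\<in>R. cod E {r, w})"
  define K where "K = (1 + 1/100000000) * c"
  have K: "0 \<le> K" "c \<le> K" "K \<le> 101/100 * c" using c_pos by (auto simp: K_def)
  have Kb: "cod E {v, w} \<le> K" if "{v, w} \<in> E" for v w
    unfolding K_def by (rule edge_cod(2)[OF that])
  have ls: "lsum E u R \<le> Y * K" using lsum_le[OF R(3)] by (simp add: Y_def K_def)
  have xc2: "0 < x * c\<^sup>2" using x c_pos by simp
  have SS: "SS \<le> P" "P - r * K * Y - (r + 2)\<^sup>2 * lsum E u R \<le> SS"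
    using lsum_drop_sum[OF R(3) finR Kb K(1)] unfolding SS_def P_def r_def Y_def
    by (auto simp: add.commute)
  have SY: "SY \<le> W" "W - r\<^sup>2 * Y \<le> SY" "0 \<le> SY"
    using cod_drop_sum[OF R0 finR] cod_drop_nonneg[OF R0]
    unfolding SY_def W_def r_def Y_def by (auto intro: sum_nonneg)
  have W: "W \<le> 3 * (x * c)"
  proof -
    have "W \<le> (\<Sum>w\<in>nb E R. \<Sum>r\<in>R. K)"
      unfolding W_def by (intro sum_mono Kb) (auto simp: nb_def)
    also have "\<dots> = Y * (r * K)" by (simp add: Y_def cod_def r_def)
    also have "\<dots> \<le> (11/10 * x) * (2 * (101/100 * c))"
      using Y r K x by (intro mult_mono) auto
    also have "\<dots> \<le> 3 * (x * c)" using x c_pos by simp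
    finally show ?thesis .
  qed
  define B where "B = real (card R + 2) * c * A + 2 * c\<^sup>2 * Y
       + real n * p ^ (card R + 1) * (lsum E u {u} - c * cod E {u})
       + (\<Sum>w\<in>nb E R. lsum E w {w, u} - c * cod E {w, u})"
  have main: "\<bar>P - c * W - B\<bar> \<le> 40 * \<beta>\<^sup>2 * (x * c\<^sup>2)"
    using Link_drift_main[OF R] unfolding P_def W_def B_def Y_def x_def A_def .
  have GB: "G = B / c - 2 * c * Y"
  proof -
    have "real n * p ^ (card R + 1) = c * p ^ (card R - 1)"
      using R(2) by (auto simp: c_def power2_eq_square)
    then show ?thesis unfolding G_def B_def using c_pos by (simp add: field_simps power2_eq_square)
  qed
  define e' where "e' = SS - c * (1 - h)\<^sup>2 * SY - B"
  have xc: "x * c \<le> \<beta>\<^sup>2 * (x * c\<^sup>2)"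
    using mult_left_mono[OF one_le_\<beta>c, of "x * c"] x c_pos by (simp add: power2_eq_square mult_ac)
  have e': "\<bar>e'\<bar> \<le> 100 * \<beta>\<^sup>2 * (x * c\<^sup>2)"
  proof -
    have a: "\<bar>SS - P\<bar> \<le> 30 * (x * c)"
    proof -
      have YK: "Y * K \<le> (11/10 * x) * (101/100 * c)" using Y K x by (intro mult_mono) auto
      have "r * (K * Y) \<le> 2 * (K * Y)" using r K Y by (intro mult_right_mono) auto
      moreover have "(r + 2)\<^sup>2 * lsum E u R \<le> 16 * (Y * K)"
      proof -
        have "(r + 2)\<^sup>2 \<le> 4\<^sup>2" using r by (intro power_mono) auto
        then show ?thesis using ls by (intro mult_mono) (auto simp: lsum_def cod_def intro!: sum_nonneg)
      qed
      ultimately have "r * K * Y + (r + 2)\<^sup>2 * lsum E u R \<le> 18 * (Y * K)" by (simp add: mult_ac)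
      then show ?thesis using SS YK x c_pos by (simp add: abs_le_iff)
    qed
    have b: "\<bar>c * W - c * SY\<bar> \<le> 5 * (x * c)"
    proof -
      have "r\<^sup>2 \<le> 2\<^sup>2" using r by (intro power_mono) auto
      then have "r\<^sup>2 * Y \<le> 4 * (11/10 * x)" using Y x by (intro mult_mono) auto
      then have "\<bar>W - SY\<bar> \<le> 5 * x" using SY x by linarith
      then have "c * \<bar>W - SY\<bar> \<le> c * (5 * x)" using c_pos by (intro mult_left_mono) auto
      moreover have "\<bar>c * W - c * SY\<bar> = c * \<bar>W - SY\<bar>"
        unfolding right_diff_distrib[symmetric] using c_pos by (simp add: abs_mult)
      ultimately show ?thesis by (simp add: mult_ac)
    qed
    have d: "\<bar>c * SY - c * (1 - h)\<^sup>2 * SY\<bar> \<le> 1 * (x * c)"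
    proof -
      have "c * SY - c * (1 - h)\<^sup>2 * SY = (1 - (1 - h)\<^sup>2) * (c * SY)" by (simp add: algebra_simps)
      moreover have "0 \<le> 1 - (1 - h)\<^sup>2" "1 - (1 - h)\<^sup>2 \<le> 2 * h" using one_minus_pow(2,4)[of 2] by auto
      moreover have "(1 - (1 - h)\<^sup>2) * (c * SY) \<le> (2 * h) * (c * (3 * (x * c)))"
        using SY W c_pos h_pos calculation(2,3) by (intro mult_mono) auto
      moreover have "(2 * h) * (c * (3 * (x * c))) = 6 * (h * c) * (x * c)" by simp
      moreover have "6 * (h * c) * (x * c) \<le> 1 * (x * c)"
        using h_np[of 2] x c_pos by (intro mult_right_mono) (auto simp: c_def)
      moreover have "0 \<le> (1 - (1 - h)\<^sup>2) * (c * SY)" using calculation SY c_pos by simp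
      ultimately show ?thesis by linarith
    qed
    have "e' = (SS - P) + (P - c * W - B) + (c * W - c * SY) + (c * SY - c * (1 - h)\<^sup>2 * SY)"
      by (simp add: e'_def)
    then have "\<bar>e'\<bar> \<le> 36 * (x * c) + 40 * \<beta>\<^sup>2 * (x * c\<^sup>2)" using a b d main by linarith
    also have "\<dots> \<le> 100 * \<beta>\<^sup>2 * (x * c\<^sup>2)"
    proof -
      have "0 \<le> \<beta>\<^sup>2 * (x * c\<^sup>2)" using xc2 by simp
      then show ?thesis using xc unfolding mult.assoc by linarith
    qed
    finally show ?thesis .
  qed
  define q where "q = Q / Q0 - 1"
  have q: "\<bar>q\<bar> \<le> \<beta> / 100" unfolding q_def by (rule Q_ratio)
  have q1: "1 + q \<ge> 99/100" using q \<beta>_le by linarith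
  have hQ': "h * Q = c * (1 + q)" using hQ by (simp add: q_def)
  define t where "t = B / (x * c\<^sup>2)"
  define e where "e = e' / (x * c\<^sup>2)"
  have e: "\<bar>e\<bar> \<le> \<beta> / 1000000"
  proof -
    have "100 * \<beta>\<^sup>2 * (x * c\<^sup>2) \<le> \<beta> / 1000000 * (x * c\<^sup>2)"
      using \<beta>sq_le xc2 \<beta>_pos by (intro mult_right_mono) auto
    then have "\<bar>e'\<bar> \<le> \<beta> / 1000000 * (x * c\<^sup>2)" using e' by linarith
    then show ?thesis using xc2 unfolding e_def by (simp add: abs_divide divide_le_eq)
  qed
  have Gb: "\<bar>G - real (card R + 2) * A\<bar> \<le> 2 * \<beta> * (x * c)"
  proof -
    have "(1 + 1/100000000) * \<beta> * (x * c) + 21/50 * \<beta> * (x * c) \<le> 2 * \<beta> * (x * c)"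
      using \<beta>_pos x c_pos by simp
    then show ?thesis using Link_terms[OF R] unfolding G_def x_def[symmetric] by linarith
  qed
  have t: "\<bar>t - 2\<bar> \<le> 2 / 1000000"
  proof -
    have "coef (Link u R) * \<beta> * (x * c) \<le> 1 * \<beta> * (x * c)"
      using \<beta>_pos x c_pos by (intro mult_right_mono) auto
    then have "\<bar>A\<bar> \<le> \<beta> * (x * c)" using Link_bd[OF R] by (simp add: A_def x_def)
    then have "\<bar>real (card R + 2) * A\<bar> \<le> 4 * (\<beta> * (x * c))"
      unfolding abs_mult using R(2) by (intro mult_mono) auto
    then have G6: "\<bar>G\<bar> \<le> 6 * \<beta> * (x * c)" using Gb by linarith
    have "\<bar>Y - x\<bar> \<le> 1/100000000 * x" unfolding abs_le_iff using Y by (simp add: algebra_simps)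
    then have "c * \<bar>Y - x\<bar> \<le> c * (1/100000000 * x)" using c_pos by (intro mult_left_mono) auto
    moreover have "\<bar>c * Y - c * x\<bar> = c * \<bar>Y - x\<bar>"
      unfolding right_diff_distrib[symmetric] using c_pos by (simp add: abs_mult)
    ultimately have Yx: "\<bar>c * Y - c * x\<bar> \<le> 1/100000000 * (x * c)" by (simp add: mult_ac)
    define d where "d = c * Y - c * x"
    have "B / c - 2 * (x * c) = G + 2 * d" unfolding GB d_def by (simp add: algebra_simps)
    then have "\<bar>B / c - 2 * (x * c)\<bar> \<le> \<bar>G\<bar> + 2 * \<bar>d\<bar>" by linarith
    also have "\<dots> \<le> 6 * \<beta> * (x * c) + 2 * (1/100000000 * (x * c))"
      by (intro add_mono mult_left_mono G6 Yx[folded d_def]) auto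
    finally have "\<bar>B / c - 2 * (x * c)\<bar> \<le> 6 * \<beta> * (x * c) + 2/100000000 * (x * c)" by simp
    also have "6 * \<beta> * (x * c) + 2/100000000 * (x * c) = (6 * \<beta> + 2/100000000) * (x * c)" by (simp add: algebra_simps)
    also have "\<dots> \<le> 2/1000000 * (x * c)" using \<beta>_le x c_pos by (intro mult_right_mono) auto
    finally have *: "\<bar>B / c - 2 * (x * c)\<bar> \<le> 2/1000000 * (x * c)" .
    have "B / c - 2 * (x * c) = (t - 2) * (x * c)"
      unfolding t_def using x c_pos by (simp add: field_simps power2_eq_square)
    then show ?thesis using * x c_pos by (simp add: abs_mult)
  qed
  have ratio: "\<bar>t - (t + e) / (1 + q)\<bar> \<le> 21/2000 * 2 * \<beta>"
    by (rule ratio_err[OF \<beta>_pos \<beta>_le q _ t e]) simp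
  have pw: "\<bar>(1 - (1 - h)\<^sup>2) / h - 2\<bar> \<le> 3 * h" using one_minus_pow(1)[of 2] by simp
  have Be: "B + e' = (t + e) * (x * c\<^sup>2)"
    unfolding t_def e_def using x c_pos by (simp add: distrib_right)
  have Bc: "B / c = x * c * t" unfolding t_def using x c_pos by (simp add: power2_eq_square)
  define t' where "t' = (t + e) / (1 + q)"
  define v where "v = (1 - (1 - h)\<^sup>2) / h"
  have sum: "(- SS + c * (1 - h)\<^sup>2 * SY) / (h * Q) = - (x * c) * t'"
  proof -
    have "- SS + c * (1 - h)\<^sup>2 * SY = - ((t + e) * (x * c\<^sup>2))" using Be by (simp add: e'_def)
    then show ?thesis unfolding hQ' t'_def using c_pos by (simp add: power2_eq_square)
  qed
  have "(- SS + c * (1 - h)\<^sup>2 * SY) / (h * Q) + c * v * Y + G = x * c * (t - t') + c * Y * (v - 2)"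
    unfolding GB Bc sum by (simp add: algebra_simps)
  also have "\<bar>\<dots>\<bar> \<le> \<bar>x * c * (t - t')\<bar> + \<bar>c * Y * (v - 2)\<bar>"
    by (rule abs_triangle_ineq)
  also have "\<dots> \<le> x * c * (21/2000 * 2 * \<beta>) + c * (11/10 * x) * (3 * h)"
    unfolding abs_mult using ratio[folded t'_def] pw[folded v_def] x c_pos Y
    by (intro add_mono mult_mono) auto
  also have "\<dots> = (21/1000 * \<beta> + 33/10 * h) * (x * c)" by (simp add: algebra_simps)
  also have "\<dots> \<le> 22/1000 * \<beta> * (x * c)"
    using h_le' \<beta>_pos x c_pos by (intro mult_right_mono) auto
  finally show "\<bar>(- SS + c * (1 - h)\<^sup>2 * SY) / (h * Q) + c * ((1 - (1 - h)\<^sup>2) / h) * cod E R + G\<bar>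
       \<le> 22/1000 * \<beta> * (x * c)"
    by (simp add: Y_def v_def)
  \<comment> \<open>The total \<open>SS\<close> is at most \<open>P\<close>, and \<open>P\<close> is
    \<open>c * W + B\<close> up to a small error, which gives 3 + 21/10 + 1/10 = 52/10.\<close>
  have "B = t * (x * c\<^sup>2)" unfolding t_def using x c_pos by simp
  moreover have "t \<le> 21/10" using t by linarith
  moreover have "t * (x * c\<^sup>2) \<le> 21/10 * (x * c\<^sup>2)" if "t \<le> 21/10"
    using that by (rule mult_right_mono) (use xc2 in simp)
  ultimately have "B \<le> 21/10 * (x * c\<^sup>2)" by simp
  moreover have "c * W \<le> 3 * (x * c\<^sup>2)" using mult_left_mono[OF W, of c] c_pos by (simp add: power2_eq_square mult_ac)
  moreover have "40 * \<beta>\<^sup>2 * (x * c\<^sup>2) \<le> 1/10 * (x * c\<^sup>2)"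
    using \<beta>sq_le \<beta>_le xc2 by (intro mult_right_mono) auto
  ultimately have "SS \<le> 52/10 * (x * c\<^sup>2)" using SS(1) main by linarith
  also have "\<dots> \<le> 6 * (x * c) * (h * Q)"
  proof -
    have "52/10 * (x * c\<^sup>2) = (x * c\<^sup>2) * (52/10)" by simp
    also have "\<dots> \<le> (x * c\<^sup>2) * (6 * (1 + q))" using q1 xc2 by (intro mult_left_mono) auto
    also have "\<dots> = 6 * (x * c) * (h * Q)" unfolding hQ' by (simp add: power2_eq_square)
    finally show ?thesis .
  qed
  finally show "SS \<le> 6 * (x * c) * (h * Q)" .
qed

section \<open>One step of the potential\<close>

lemma h_Lsq: "h * (ln (real n))\<^sup>2 \<le> \<beta>\<^sup>2 / 100000000"
proof -
  have "h * (ln (real n))\<^sup>2 = \<beta>\<^sup>2 * (h * (real n * p ^ 3))" using \<beta>_sq by simp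
  also have "\<dots> \<le> \<beta>\<^sup>2 * (1/100000000)" by (intro mult_left_mono h_np) auto
  finally show ?thesis by simp
qed

text \<open>With the factor 4000, \<open>exp (- M / 200)\<close> is \<open>1 / n ^ 20\<close>, which
  outweighs order \<open>n ^ 3\<close> quantities times order \<open>n\<^sup>2\<close>
  steps.\<close>

definition "M = 4000 * ln (real n)"

lemma M_ge: "100 \<le> M" using L by (simp add: M_def)

lemma M_h: "M * h \<le> 1/1000000"
proof -
  have "ln (real n) * 1 \<le> ln (real n) * ln (real n) ^ 4" using L by (intro mult_left_mono one_le_power) auto
  then have "\<beta> * ln (real n) \<le> \<beta> * ln (real n) ^ 5"
    using \<beta>_pos by (intro mult_left_mono) (auto simp: power_numeral_reduce)
  then have bL: "\<beta> * ln (real n) \<le> 1" using \<beta>_L by linarith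
  have "M * h \<le> M * (\<beta> / 100000000000000000)" using h_le' M_ge by (intro mult_left_mono) auto
  also have "\<dots> = 4000 / 100000000000000000 * (\<beta> * ln (real n))" by (simp add: M_def)
  also have "\<dots> \<le> 4000 / 100000000000000000 * 1" using bL by (intro mult_left_mono) auto
  finally show ?thesis by simp
qed

lemma expo_bounds: "v \<in> vars n \<Longrightarrow> 1 \<le> expo v \<and> expo v \<le> 4"
  by (auto simp: vars_def)

lemma bnd_pos: "bnd n E v > 0"
proof -
  have "coef v > 0" by (cases v) auto
  moreover have "base n v > 0" using n_pos by (cases v) auto
  ultimately show ?thesis using \<beta>_pos p_pos by (simp add: bnd_def \<beta>_def p_def)
qed

text \<open>As a function of the density the bound is a multiple of
  \<open>p powr (expo v - 3/2)\<close>, where 3/2 comes from the denominator of \<beta>.\<close>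

lemma bnd_diff:
  assumes T: "T \<in> triangles E"
  shows "bnd n (E - all_edges T) v = bnd n E v * (1 - h) powr (real (expo v) - 3/2)"
proof -
  have h1: "0 < 1 - h" using h_le'' by simp
  have "sqrt (real n * (p * (1 - h)) ^ 3) = sqrt (real n * p ^ 3) * (1 - h) powr (3/2)"
  proof -
    have "sqrt ((1 - h) ^ 3) = ((1 - h) powr 3) powr (1/2)"
      using h1 powr_realpow[OF h1, of 3] by (simp add: powr_half_sqrt)
    also have "\<dots> = (1 - h) powr (3/2)" by (simp add: powr_powr)
    finally have "sqrt ((1 - h) ^ 3) = (1 - h) powr (3/2)" .
    moreover have "real n * (p * (1 - h)) ^ 3 = (real n * p ^ 3) * (1 - h) ^ 3"
      by (simp add: power_mult_distrib)
    ultimately show ?thesis by (simp only: real_sqrt_mult)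
  qed
  moreover have "(1 - h) powr (real (expo v) - 3/2) = (1 - h) ^ expo v / (1 - h) powr (3/2)"
    using h1 by (simp add: powr_diff powr_realpow)
  ultimately show ?thesis
    unfolding bnd_def rel_err_def dens_diff[OF T] p_def[symmetric]
    by (simp add: power_mult_distrib)
qed

text \<open>Decay at rate \<open>expo v\<close> keeps a deviation constant relative to the expected
  size, while the bound decays at rate \<open>expo v - 3/2\<close> only, a gain of
  \<open>3/2 * \<rho>\<close>. For \<open>\<rho> \<ge> 99/100\<close> the gain is at least
  1485/1000; reserving 1/100 for \<kappa> and 1/1000 for the approximation of \<open>g\<close>
  leaves 1474/1000. The number 24 is set by the link sums, where a step of \<open>10 * c\<close>
  meets the coefficient 21/50, and 700 by the triangle count, where a total of \<open>7 * Q0\<close>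
  meets 1/100.\<close>

lemma exp_step:
  assumes v: "v \<in> vars n" and \<sigma>: "\<bar>\<sigma>\<bar> = 1" and X: "0 < X" "(ln (real n))\<^sup>2 \<le> \<beta>\<^sup>2 * X"
  defines "\<Delta> \<equiv> \<lambda>T. dev n (E - all_edges T) v - dev n E v" and "b \<equiv> bnd n E v"
  assumes max: "\<And>T. T \<in> triangles E \<Longrightarrow> \<bar>\<Delta> T\<bar> \<le> 24 * b / (\<beta> * X)"
    and tot: "(\<Sum>T\<in>triangles E. \<bar>\<Delta> T\<bar>) \<le> 700 * b / \<beta> * (h * Q)"
    and drift: "99/100 * b \<le> \<sigma> * dev n E v \<Longrightarrow>
      \<sigma> * (\<Sum>T\<in>triangles E. \<Delta> T) \<le> h * Q * (- real (expo v) * (\<sigma> * dev n E v) + 1474/1000 * b)"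
  shows "(\<Sum>T\<in>triangles E. exp (M * (\<sigma> * dev n (E - all_edges T) v / bnd n (E - all_edges T) v - 1)))
      / card (triangles E) \<le> exp (M * (\<sigma> * dev n E v / b - 1)) + exp (- M / 200)"
proof -
  have b: "b > 0" unfolding b_def by (rule bnd_pos)
  define \<rho> where "\<rho> = \<sigma> * dev n E v / b"
  define \<gamma> where "\<gamma> = real (expo v) - 3/2"
  define g where "g = (1 - h) powr \<gamma> - 1"
  have k: "1 \<le> real (expo v)" "real (expo v) \<le> 4" using expo_bounds[OF v] by auto
  have \<gamma>b: "\<bar>\<gamma>\<bar> \<le> 5/2" unfolding \<gamma>_def abs_le_iff using k by linarith
  have "\<bar>(1 - h) powr \<gamma> - 1 + \<gamma> * h\<bar> \<le> 20 * h\<^sup>2"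
    by (rule one_minus_powr_approx[OF _ _ \<gamma>b]) (use h_pos h_le'' in auto)
  moreover have hh: "20 * h\<^sup>2 \<le> h / 1000"
    using h_le'' h_pos mult_left_mono[of h "1/20000" h] by (simp add: power2_eq_square)
  ultimately have g\<gamma>: "\<bar>g + \<gamma> * h\<bar> \<le> h / 1000" by (simp add: g_def)
  have "\<bar>\<gamma> * h\<bar> \<le> 5/2 * h"
    unfolding abs_mult using \<gamma>b h_pos by (intro mult_mono) auto
  then have g3: "\<bar>g\<bar> \<le> 3 * h" using g\<gamma> h_pos by linarith
  have \<rho>1: "\<bar>\<rho>\<bar> \<le> 1"
    using small[OF v] b \<sigma> unfolding \<rho>_def b_def by (simp add: abs_mult divide_le_eq)
  have L0: "ln (real n) > 0" using L by simp
  have bX: "0 < \<beta> * X" using X \<beta>_pos by simp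
  have "(\<Sum>T\<in>triangles E. exp (M * ((\<rho> + \<sigma> * \<Delta> T / b) / (1 + g) - 1))) / card (triangles E)
      \<le> exp (M * (\<rho> - 1)) + exp (- M / 200)"
  proof (rule exp_ratio_step[where \<kappa> = "1/100" and h = h and B = "24 / (\<beta> * X)" and G = "700 / \<beta>"])
    show "16 * M * (24 / (\<beta> * X) * (700 / \<beta>)) \<le> 1/100"
    proof -
      \<comment> \<open>One factor \<open>L\<close> from \<open>M\<close> stands against
        \<open>L\<^sup>2\<close> from \<open>X\<close>. The constants require \<open>L\<close> to
        exceed about \<open>10 ^ 11\<close>, which sets the magnitude of the lower bound
        \<open>L_ge\<close>.\<close>
      have "16 * M * (24 / (\<beta> * X) * (700 / \<beta>)) = 1075200000 * ln (real n) / (\<beta>\<^sup>2 * X)"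
        by (simp add: M_def power2_eq_square)
      also have "\<dots> \<le> 1075200000 * ln (real n) / (ln (real n))\<^sup>2"
        using X L0 \<beta>_pos by (intro divide_left_mono) auto
      also have "\<dots> = 1075200000 / ln (real n)" using L0 by (simp add: power2_eq_square)
      also have "\<dots> \<le> 1/100" using L_ge by (simp add: divide_le_eq)
      finally show ?thesis .
    qed
    show "8 * M * (24 / (\<beta> * X)) \<le> 1"
    proof -
      have "8 * M * (24 / (\<beta> * X)) = 768000 * ln (real n) * \<beta> / (\<beta>\<^sup>2 * X)"
        using \<beta>_pos by (simp add: M_def power2_eq_square)
      also have "\<dots> \<le> 768000 * ln (real n) * \<beta> / (ln (real n))\<^sup>2"
        using X L0 \<beta>_pos by (intro divide_left_mono) auto
      also have "\<dots> = 768000 * \<beta> / ln (real n)" using L0 by (simp add: power2_eq_square)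
      also have "\<dots> \<le> 1" using L_ge \<beta>_le \<beta>_pos by (simp add: divide_le_eq)
      finally show ?thesis .
    qed
    show "8 * M * \<bar>g\<bar> \<le> 1"
    proof -
      have "8 * M * \<bar>g\<bar> \<le> 8 * M * (3 * h)" using g3 M_ge by (intro mult_left_mono) auto
      also have "\<dots> = 24 * (M * h)" by simp
      also have "\<dots> \<le> 1" using M_h by simp
      finally show ?thesis .
    qed
    show "16 * M * g\<^sup>2 \<le> 1/100 * h"
    proof -
      have "g\<^sup>2 \<le> (3 * h)\<^sup>2" using g3 h_pos abs_le_square_iff[of g "3 * h"] by simp
      then have "16 * M * g\<^sup>2 \<le> 16 * M * (3 * h)\<^sup>2" using M_ge by (intro mult_left_mono) auto
      also have "\<dots> = 144 * (M * h) * h" by (simp add: power2_eq_square)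
      also have "\<dots> \<le> 1/100 * h" using M_h h_pos by (intro mult_right_mono) auto
      finally show ?thesis .
    qed
    show "\<bar>\<sigma> * \<Delta> T / b\<bar> \<le> 24 / (\<beta> * X)" if "T \<in> triangles E" for T
      using max[OF that] b \<sigma> by (simp add: abs_mult divide_le_eq)
    show "(\<Sum>T\<in>triangles E. \<bar>\<sigma> * \<Delta> T / b\<bar>) \<le> 700 / \<beta> * h * card (triangles E)"
    proof -
      have "(\<Sum>T\<in>triangles E. \<bar>\<sigma> * \<Delta> T / b\<bar>) = (\<Sum>T\<in>triangles E. \<bar>\<Delta> T\<bar>) / b"
        using b \<sigma> by (simp add: abs_mult sum_divide_distrib)
      also have "\<dots> \<le> (700 * b / \<beta> * (h * Q)) / b" using tot b by (intro divide_right_mono) auto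
      also have "\<dots> = 700 / \<beta> * h * card (triangles E)" using b by (simp add: Q_def)
      finally show ?thesis .
    qed
    show "(\<Sum>T\<in>triangles E. \<sigma> * \<Delta> T / b) \<le> (g * \<rho> - 1/100 * h) * card (triangles E)"
      if \<rho>: "99/100 \<le> \<rho>"
    proof -
      have d: "99/100 * b \<le> \<sigma> * dev n E v" using \<rho> b by (simp add: \<rho>_def le_divide_eq)
      have "(\<Sum>T\<in>triangles E. \<sigma> * \<Delta> T / b) = \<sigma> * (\<Sum>T\<in>triangles E. \<Delta> T) / b"
        by (simp add: sum_divide_distrib sum_distrib_left)
      also have "\<dots> \<le> h * Q * (- real (expo v) * (\<sigma> * dev n E v) + 1474/1000 * b) / b"
        using drift[OF d] b by (intro divide_right_mono) auto
      also have "\<dots> = (h * (- real (expo v) * \<rho> + 1474/1000)) * Q"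
      proof -
        have "\<sigma> * dev n E v = \<rho> * b" using b by (simp add: \<rho>_def)
        then show ?thesis using b by (simp add: field_simps)
      qed
      also have "\<dots> \<le> (g * \<rho> - 1/100 * h) * Q"
      proof (rule mult_right_mono)
        have "- (g * \<rho> + \<gamma> * h * \<rho>) \<le> h / 1000"
        proof -
          have "\<bar>(g + \<gamma> * h) * \<rho>\<bar> \<le> (h / 1000) * 1"
            unfolding abs_mult using g\<gamma> \<rho>1 h_pos by (intro mult_mono) auto
          then have "- ((g + \<gamma> * h) * \<rho>) \<le> h / 1000" by linarith
          then show ?thesis by (simp add: distrib_right)
        qed
        moreover have "h * (- real (expo v) * \<rho> + 1474/1000) = - (\<gamma> * h * \<rho>) - 3/2 * (h * \<rho>) + 1474/1000 * h"
          by (simp add: \<gamma>_def algebra_simps)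
        moreover have "99/100 * h \<le> h * \<rho>" using \<rho> h_pos by simp
        ultimately show "h * (- real (expo v) * \<rho> + 1474/1000) \<le> g * \<rho> - 1/100 * h" by linarith
      qed (use Q_pos in simp)
      finally show ?thesis by (simp add: Q_def)
    qed
  qed (use finite_tri triangles_nonempty \<rho>1 M_ge h_pos \<beta>_pos in auto)
  moreover have "(\<rho> + \<sigma> * \<Delta> T / b) / (1 + g) = \<sigma> * dev n (E - all_edges T) v / bnd n (E - all_edges T) v"
    if "T \<in> triangles E" for T
  proof -
    have "\<rho> + \<sigma> * \<Delta> T / b = \<sigma> * dev n (E - all_edges T) v / b"
      by (simp add: \<rho>_def \<Delta>_def add_divide_distrib[symmetric] distrib_left[symmetric])
    then show ?thesis by (simp add: bnd_diff[OF that] b_def g_def \<gamma>_def)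
  qed
  ultimately show ?thesis by (simp add: \<rho>_def cong: sum.cong)
qed

lemma one_minus_pow_eq: "1 - (1 - h) ^ r = h * ((1 - (1 - h) ^ r) / h)"
  using h_pos by simp

text \<open>The size \<open>X\<close> is chosen so that the admissible step
  \<open>24 * bnd / (\<beta> * X)\<close> becomes \<open>7 * c\<close>: removing a triangle destroys
  at most slightly more than \<open>3 * c\<close> triangles, and the expected count moves by at most
  \<open>3 * c\<close>.\<close>

lemma Tri_step:
  assumes \<sigma>: "\<bar>\<sigma>\<bar> = 1"
  shows "(\<Sum>T\<in>triangles E. exp (M * (\<sigma> * dev n (E - all_edges T) Tri / bnd n (E - all_edges T) Tri - 1)))
      / card (triangles E) \<le> exp (M * (\<sigma> * dev n E Tri / bnd n E Tri - 1)) + exp (- M / 200)"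
proof (rule exp_step[OF _ \<sigma>, where X = "24 / (700 * h)"])
  define d where "d T = Q - real (card (triangles (E - all_edges T)))" for T
  define v where "v = (1 - (1 - h) ^ 3) / h"
  have b: "bnd n E Tri = 1/100 * Q0 * \<beta>" by (simp add: bnd_def Q0_def \<beta>_def p_def)
  have dev: "dev n E Tri = Q - Q0" by (simp add: Q_def Q0_def p_def)
  have \<Delta>: "dev n (E - all_edges T) Tri - dev n E Tri = - d T + Q0 * (h * v)"
    if "T \<in> triangles E" for T
  proof -
    have "(1 - h) ^ 3 = 1 - h * v" using one_minus_pow_eq[of 3] unfolding v_def by linarith
    then have "base n Tri * (p * (1 - h)) ^ 3 = Q0 * (1 - h * v)"
      by (simp add: power_mult_distrib Q0_def)
    then have "dev n (E - all_edges T) Tri = (Q - d T) - Q0 * (1 - h * v)"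
      by (simp only: dev.simps dens_diff[OF that] d_def)
    then show ?thesis unfolding dev by (simp add: algebra_simps)
  qed
  have d0: "0 \<le> d T" for T unfolding d_def Q_def tri_drop by simp
  have hv: "0 \<le> h * v" "h * v \<le> 3 * h" using one_minus_pow(2,4)[of 3] h_pos by (auto simp: v_def)
  have qv: "0 \<le> Q0 * (h * v)" "Q0 * (h * v) \<le> 3 * c"
  proof -
    show "0 \<le> Q0 * (h * v)" using hv Q0_pos by simp
    have "Q0 * (h * v) \<le> Q0 * (3 * h)" using hv Q0_pos by (intro mult_left_mono) auto
    then show "Q0 * (h * v) \<le> 3 * c" using hQ0 by (simp add: mult_ac)
  qed
  show "Tri \<in> vars n" by (simp add: vars_def)
  show "0 < 24 / (700 * h)" using h_pos by simp
  show "(ln (real n))\<^sup>2 \<le> \<beta>\<^sup>2 * (24 / (700 * h))"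
  proof -
    have "700 * (h * (ln (real n))\<^sup>2) \<le> 24 * \<beta>\<^sup>2" using h_Lsq zero_le_power2[of \<beta>] by linarith
    then show ?thesis using h_pos by (simp add: le_divide_eq mult_ac)
  qed
  show "\<bar>dev n (E - all_edges T) Tri - dev n E Tri\<bar> \<le> 24 * bnd n E Tri / (\<beta> * (24 / (700 * h)))"
    if T: "T \<in> triangles E" for T
  proof -
    have "24 * bnd n E Tri / (\<beta> * (24 / (700 * h))) = 7 * (h * Q0)"
      unfolding b using \<beta>_pos h_pos by simp
    also have "\<dots> = 7 * c" by (simp add: hQ0)
    finally have rhs: "24 * bnd n E Tri / (\<beta> * (24 / (700 * h))) = 7 * c" .
    have "d T \<le> 3 * ((1 + 1/100000000) * c)"
      unfolding d_def Q_def
    proof (rule tri_drop_le[OF T])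
      fix e assume e: "e \<in> E"
      obtain u w where "e = {u, w}" using edge_pair[OF e] by blast
      then show "tri_deg E e \<le> (1 + 1/100000000) * c"
        using edge_cod(2)[of u w] tri_deg_eq_cod[of u w] e by simp
    qed
    also have "\<dots> \<le> 7 * c" using c_pos by simp
    finally show ?thesis unfolding \<Delta>[OF T] rhs abs_le_iff using d0[of T] qv c_pos by simp
  qed
  have S: "(\<Sum>T\<in>triangles E. d T) \<le> 4 * Q0 * (h * Q)" unfolding d_def by (rule Tri_drift(2))
  show "(\<Sum>T\<in>triangles E. \<bar>dev n (E - all_edges T) Tri - dev n E Tri\<bar>)
      \<le> 700 * bnd n E Tri / \<beta> * (h * Q)"
  proof -
    have "(\<Sum>T\<in>triangles E. \<bar>dev n (E - all_edges T) Tri - dev n E Tri\<bar>)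
        \<le> (\<Sum>T\<in>triangles E. d T + 3 * c)"
    proof (rule sum_mono)
      fix T assume T: "T \<in> triangles E"
      show "\<bar>dev n (E - all_edges T) Tri - dev n E Tri\<bar> \<le> d T + 3 * c"
        unfolding \<Delta>[OF T] abs_le_iff using d0[of T] qv c_pos by simp
    qed
    also have "\<dots> = (\<Sum>T\<in>triangles E. d T) + 3 * (h * Q0) * Q"
      by (simp add: sum.distrib hQ0 Q_def)
    also have "\<dots> \<le> 7 * Q0 * (h * Q)" using S by (simp add: mult_ac)
    also have "\<dots> = 700 * bnd n E Tri / \<beta> * (h * Q)" unfolding b using \<beta>_pos by simp
    finally show ?thesis .
  qed
  show "\<sigma> * (\<Sum>T\<in>triangles E. dev n (E - all_edges T) Tri - dev n E Tri)
      \<le> h * Q * (- real (expo Tri) * (\<sigma> * dev n E Tri) + 1474/1000 * bnd n E Tri)"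
  proof -
    define S where "S = (\<Sum>T\<in>triangles E. d T)"
    have "(\<Sum>T\<in>triangles E. dev n (E - all_edges T) Tri - dev n E Tri)
        = (\<Sum>T\<in>triangles E. - d T + Q0 * (h * v))"
      by (intro sum.cong refl \<Delta>)
    also have "\<dots> = - S + Q * (Q0 * (h * v))"
      unfolding sum.distrib sum_negf S_def by (simp add: Q_def)
    also have "\<dots> = h * Q * (Q0 * v - S / (h * Q))"
      using h_pos Q_pos by (simp add: right_diff_distrib)
    finally have eq: "(\<Sum>T\<in>triangles E. dev n (E - all_edges T) Tri - dev n E Tri)
        = h * Q * (Q0 * v - S / (h * Q))" .
    have "\<bar>Q0 * v - S / (h * Q) + 3 * (Q - Q0)\<bar> \<le> \<beta> / 1000000 * Q0"
      using Tri_drift(1) by (simp add: S_def d_def v_def)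
    then have "\<bar>\<sigma> * (Q0 * v - S / (h * Q) + 3 * (Q - Q0))\<bar> \<le> \<beta> / 1000000 * Q0"
      using \<sigma> by (simp add: abs_mult)
    then have "\<sigma> * (Q0 * v - S / (h * Q) + 3 * (Q - Q0)) \<le> \<beta> / 1000000 * Q0"
      by linarith
    moreover have "\<beta> / 1000000 * Q0 \<le> 1474/1000 * bnd n E Tri"
      unfolding b using \<beta>_pos Q0_pos by simp
    moreover have "\<sigma> * (Q0 * v - S / (h * Q) + 3 * (Q - Q0))
        = \<sigma> * (Q0 * v - S / (h * Q)) + 3 * (\<sigma> * dev n E Tri)"
      unfolding dev by (simp add: distrib_left)
    ultimately have "\<sigma> * (Q0 * v - S / (h * Q)) \<le> - 3 * (\<sigma> * dev n E Tri) + 1474/1000 * bnd n E Tri"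
      by linarith
    then have "\<sigma> * (Q0 * v - S / (h * Q)) \<le> - real (expo Tri) * (\<sigma> * dev n E Tri) + 1474/1000 * bnd n E Tri"
      by simp
    then have "h * Q * (\<sigma> * (Q0 * v - S / (h * Q)))
        \<le> h * Q * (- real (expo Tri) * (\<sigma> * dev n E Tri) + 1474/1000 * bnd n E Tri)"
      using h_pos Q_pos by (intro mult_left_mono) auto
    then show ?thesis unfolding eq by (simp only: mult.left_commute)
  qed
qed

text \<open>This checks that the codegree coefficients absorb the link coefficients. Per vertex of
  \<open>R\<close> the cost is 21/50 or 1 when \<open>R\<close> has one or two vertices. For three
  vertices there is no separate bound on the link sum, and averaging the codegree bound 3/2 gives
  16/10 including slack.\<close>

lemma Link_sum_le:
  assumes R: "R \<subseteq> {1..n}" "card R \<in> {1, 2, 3}"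
  shows "\<bar>(\<Sum>u\<in>R. lsum E u R - c * cod E R) / c\<bar> + 11/1000 * card R * \<beta> * (real n * p ^ card R)
    \<le> 1474/1000 * (coef (Cod R) * \<beta> * (real n * p ^ card R))"
proof -
  define x where "x = real n * p ^ card R"
  have x: "x > 0" unfolding x_def by (rule np_pos)
  have \<beta>x: "0 < \<beta> * x" using \<beta>_pos x by simp
  define a :: real where "a = (if card R = 1 then 21/50 else if card R = 2 then 1 else 16/10)"
  have "\<bar>lsum E u R - c * cod E R\<bar> \<le> a * (\<beta> * x) * c" if u: "u \<in> R" for u
  proof (cases "card R = 3")
    case False
    then show ?thesis using Link_bd[OF R(1) _ u] R(2) by (auto simp: a_def x_def mult_ac)
  next
    case True
    have "lsum E u R - c * cod E R = (\<Sum>w\<in>nb E R. cod E {u, w} - c)"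
      by (simp add: lsum_def sum_subtractf cod_def mult.commute)
    also have "\<bar>\<dots>\<bar> \<le> (\<Sum>w\<in>nb E R. 3/2 * \<beta> * c)"
      by (rule order_trans[OF sum_abs sum_mono], rule edge_cod(1)) (use u in \<open>auto simp: nb_def\<close>)
    also have "\<dots> = cod E R * (3/2 * \<beta> * c)" by (simp add: cod_def)
    also have "\<dots> \<le> ((1 + 1/100000000) * x) * (3/2 * \<beta> * c)"
      using cod_near(1)[OF R] \<beta>_pos c_pos unfolding x_def by (intro mult_right_mono) auto
    also have "\<dots> = (1 + 1/100000000) * 3/2 * (\<beta> * x * c)" by (simp add: mult_ac)
    also have "\<dots> \<le> 16/10 * (\<beta> * x * c)" using \<beta>x c_pos by (intro mult_right_mono) auto
    finally show ?thesis using True by (simp add: a_def mult_ac)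
  qed
  then have "\<bar>\<Sum>u\<in>R. lsum E u R - c * cod E R\<bar> \<le> (\<Sum>u\<in>R. a * (\<beta> * x) * c)"
    by (intro order_trans[OF sum_abs sum_mono])
  then have "\<bar>(\<Sum>u\<in>R. lsum E u R - c * cod E R) / c\<bar> \<le> card R * a * (\<beta> * x)"
    using c_pos by (simp add: abs_divide divide_le_eq mult_ac)
  moreover have "card R * a * (\<beta> * x) + 11/1000 * card R * (\<beta> * x) \<le> 1474/1000 * (coef (Cod R) * (\<beta> * x))"
  proof -
    have "card R * a + 11/1000 * card R \<le> 1474/1000 * coef (Cod R)"
      using R(2) by (auto simp: a_def)
    then have "(card R * a + 11/1000 * card R) * (\<beta> * x) \<le> (1474/1000 * coef (Cod R)) * (\<beta> * x)"
      using \<beta>x by (intro mult_right_mono) auto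
    then show ?thesis by (simp only: distrib_right mult.assoc)
  qed
  ultimately show ?thesis unfolding x_def[symmetric] by (simp only: mult.assoc)
qed

text \<open>Here \<open>X = n p ^ card R\<close>: one step moves the codegree by at most 3 and its
  expected value by at most 1, against a bound of order \<open>\<beta> * X\<close>.\<close>

lemma Cod_step:
  assumes R: "R \<subseteq> {1..n}" "card R \<in> {1, 2, 3}" and \<sigma>: "\<bar>\<sigma>\<bar> = 1"
  shows "(\<Sum>T\<in>triangles E. exp (M * (\<sigma> * dev n (E - all_edges T) (Cod R) / bnd n (E - all_edges T) (Cod R) - 1)))
      / card (triangles E) \<le> exp (M * (\<sigma> * dev n E (Cod R) / bnd n E (Cod R) - 1)) + exp (- M / 200)"
proof (rule exp_step[OF _ \<sigma>, where X = "real n * p ^ card R"])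
  define x where "x = real n * p ^ card R"
  define d where "d T = cod E R - cod (E - all_edges T) R" for T
  define v where "v = (1 - (1 - h) ^ card R) / h"
  have R0: "R \<noteq> {}" using R by auto
  have x: "x > 0" unfolding x_def by (rule np_pos)
  have co: "1 \<le> coef (Cod R)" by simp
  have b: "bnd n E (Cod R) = coef (Cod R) * x * \<beta>" by (simp add: bnd_def x_def \<beta>_def p_def)
  have dev: "dev n E (Cod R) = cod E R - x" by (simp add: x_def p_def)
  have \<Delta>: "dev n (E - all_edges T) (Cod R) - dev n E (Cod R) = - d T + x * (h * v)"
    if "T \<in> triangles E" for T
  proof -
    have "(1 - h) ^ card R = 1 - h * v" using one_minus_pow_eq[of "card R"] unfolding v_def by linarith
    then have "real n * (p * (1 - h)) ^ card R = x * (1 - h * v)"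
      by (simp add: power_mult_distrib x_def)
    then have "dev n (E - all_edges T) (Cod R) = (cod E R - d T) - x * (1 - h * v)"
      by (simp only: dev.simps dens_diff[OF that] d_def)
    then show ?thesis unfolding dev by (simp add: algebra_simps)
  qed
  have d0: "0 \<le> d T" for T unfolding d_def by (rule cod_drop_nonneg[OF R0])
  have hv: "0 \<le> h * v" "h * v \<le> 3 * h"
    using one_minus_pow(2,4)[OF R(2)] h_pos R(2) by (auto simp: v_def)
  have "h * x \<le> 1/100000000" unfolding x_def by (rule h_np) (use R in auto)
  moreover have "x * (h * v) \<le> x * (3 * h)" using hv x by (intro mult_left_mono) auto
  then have "x * (h * v) \<le> 3 * (h * x)" by (simp only: mult_ac)
  moreover have "0 \<le> x * (h * v)" by (rule mult_nonneg_nonneg[OF less_imp_le[OF x] hv(1)])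
  ultimately have qv: "0 \<le> x * (h * v)" "x * (h * v) \<le> 3 * (h * x)" "x * (h * v) \<le> 1"
    by linarith+
  show "Cod R \<in> vars n" using R by (auto simp: vars_def)
  show "0 < real n * p ^ card R" by (rule np_pos)
  show "(ln (real n))\<^sup>2 \<le> \<beta>\<^sup>2 * (real n * p ^ card R)" by (rule Lsq_le) (use R in auto)
  show "\<bar>dev n (E - all_edges T) (Cod R) - dev n E (Cod R)\<bar>
      \<le> 24 * bnd n E (Cod R) / (\<beta> * (real n * p ^ card R))"
    if T: "T \<in> triangles E" for T
  proof -
    have "24 * bnd n E (Cod R) / (\<beta> * (real n * p ^ card R)) = 24 * coef (Cod R)"
      unfolding b x_def[symmetric] using \<beta>_pos x by simp
    moreover have "d T \<le> 3" unfolding d_def by (rule cod_drop_le[OF R0 T])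
    ultimately show ?thesis unfolding \<Delta>[OF T] abs_le_iff using d0[of T] qv co by linarith
  qed
  have S: "(\<Sum>T\<in>triangles E. d T) \<le> 4 * x * (h * Q)"
    unfolding d_def x_def by (rule Cod_drift(2)[OF R])
  show "(\<Sum>T\<in>triangles E. \<bar>dev n (E - all_edges T) (Cod R) - dev n E (Cod R)\<bar>)
      \<le> 700 * bnd n E (Cod R) / \<beta> * (h * Q)"
  proof -
    have "(\<Sum>T\<in>triangles E. \<bar>dev n (E - all_edges T) (Cod R) - dev n E (Cod R)\<bar>)
        \<le> (\<Sum>T\<in>triangles E. d T + 3 * (h * x))"
    proof (rule sum_mono)
      fix T assume T: "T \<in> triangles E"
      show "\<bar>dev n (E - all_edges T) (Cod R) - dev n E (Cod R)\<bar> \<le> d T + 3 * (h * x)"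
        unfolding \<Delta>[OF T] abs_le_iff using d0[of T] qv by linarith
    qed
    also have "\<dots> = (\<Sum>T\<in>triangles E. d T) + 3 * x * (h * Q)"
      by (simp add: sum.distrib Q_def mult_ac)
    also have "\<dots> \<le> 7 * x * (h * Q)" using S by linarith
    also have "\<dots> \<le> 700 * (coef (Cod R) * x) * (h * Q)"
      using co x h_pos Q_pos by (intro mult_right_mono) auto
    also have "\<dots> = 700 * bnd n E (Cod R) / \<beta> * (h * Q)" unfolding b using \<beta>_pos by simp
    finally show ?thesis .
  qed
  show "\<sigma> * (\<Sum>T\<in>triangles E. dev n (E - all_edges T) (Cod R) - dev n E (Cod R))
      \<le> h * Q * (- real (expo (Cod R)) * (\<sigma> * dev n E (Cod R)) + 1474/1000 * bnd n E (Cod R))"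
  proof -
    define S where "S = (\<Sum>T\<in>triangles E. d T)"
    define K where "K = (\<Sum>u\<in>R. lsum E u R - c * cod E R) / c"
    have "(\<Sum>T\<in>triangles E. dev n (E - all_edges T) (Cod R) - dev n E (Cod R))
        = (\<Sum>T\<in>triangles E. - d T + x * (h * v))"
      by (intro sum.cong refl \<Delta>)
    also have "\<dots> = - S + Q * (x * (h * v))"
      unfolding sum.distrib sum_negf S_def by (simp add: Q_def)
    also have "\<dots> = h * Q * (x * v - S / (h * Q))"
      using h_pos Q_pos by (simp add: right_diff_distrib)
    finally have eq: "(\<Sum>T\<in>triangles E. dev n (E - all_edges T) (Cod R) - dev n E (Cod R))
        = h * Q * (x * v - S / (h * Q))" .
    have "\<bar>x * v - S / (h * Q) + card R * (cod E R - x) + K\<bar> \<le> 11/1000 * card R * \<beta> * x"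
      using Cod_drift(1)[OF R] by (simp add: S_def d_def v_def x_def K_def)
    moreover have "\<bar>K\<bar> + 11/1000 * card R * \<beta> * x \<le> 1474/1000 * (coef (Cod R) * \<beta> * x)"
      using Link_sum_le[OF R] by (simp only: K_def x_def)
    ultimately have "\<bar>x * v - S / (h * Q) + card R * (cod E R - x)\<bar> \<le> 1474/1000 * (coef (Cod R) * \<beta> * x)"
      by linarith
    then have "\<bar>\<sigma> * (x * v - S / (h * Q) + card R * (cod E R - x))\<bar> \<le> 1474/1000 * bnd n E (Cod R)"
      using \<sigma> unfolding b by (simp add: abs_mult mult_ac)
    then have "\<sigma> * (x * v - S / (h * Q) + card R * (cod E R - x)) \<le> 1474/1000 * bnd n E (Cod R)"
      by linarith
    moreover have "\<sigma> * (x * v - S / (h * Q) + card R * (cod E R - x))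
        = \<sigma> * (x * v - S / (h * Q)) + card R * (\<sigma> * dev n E (Cod R))"
      unfolding dev by (simp add: distrib_left)
    ultimately have "\<sigma> * (x * v - S / (h * Q))
        \<le> - real (expo (Cod R)) * (\<sigma> * dev n E (Cod R)) + 1474/1000 * bnd n E (Cod R)"
      by simp
    then have "h * Q * (\<sigma> * (x * v - S / (h * Q)))
        \<le> h * Q * (- real (expo (Cod R)) * (\<sigma> * dev n E (Cod R)) + 1474/1000 * bnd n E (Cod R))"
      using h_pos Q_pos by (intro mult_left_mono) auto
    then show ?thesis unfolding eq by (simp only: mult.left_commute)
  qed
qed

lemma Link_step:
  assumes R: "R \<subseteq> {1..n}" "card R \<in> {1, 2}" "u \<in> R" and \<sigma>: "\<bar>\<sigma>\<bar> = 1"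
  shows "(\<Sum>T\<in>triangles E. exp (M * (\<sigma> * dev n (E - all_edges T) (Link u R) / bnd n (E - all_edges T) (Link u R) - 1)))
      / card (triangles E) \<le> exp (M * (\<sigma> * dev n E (Link u R) / bnd n E (Link u R) - 1)) + exp (- M / 200)"
proof (rule exp_step[OF _ \<sigma>, where X = "real n * p ^ card R"])
  define x where "x = real n * p ^ card R"
  define Y where "Y = cod E R"
  define A where "A = lsum E u R - c * cod E R"
  define s where "s T = lsum E u R - lsum (E - all_edges T) u R" for T
  define d where "d T = cod E R - cod (E - all_edges T) R" for T
  define v where "v = (1 - (1 - h)\<^sup>2) / h"
  have R0: "R \<noteq> {}" and R3: "card R \<in> {1, 2, 3}" using R by auto
  have x: "x > 0" unfolding x_def by (rule np_pos)
  have Y: "0 \<le> Y" "Y \<le> 11/10 * x" using cod_near(1)[OF R(1) R3] x by (auto simp: Y_def x_def cod_def)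
  have co: "21/50 \<le> coef (Link u R)" by simp
  have b: "bnd n E (Link u R) = coef (Link u R) * (x * c) * \<beta>"
    by (simp add: bnd_def x_def c_def \<beta>_def p_def power_add power2_eq_square)
  have dev: "dev n E (Link u R) = A" by (simp add: A_def c_def p_def)
  have hv: "0 \<le> h * v" "h * v \<le> 2 * h" "(1 - h)\<^sup>2 = 1 - h * v" "(1 - h)\<^sup>2 \<le> 1" "0 \<le> (1 - h)\<^sup>2"
    using one_minus_pow(2,4)[of 2] one_minus_pow_eq[of 2] h_pos by (auto simp: v_def)
  have \<Delta>: "dev n (E - all_edges T) (Link u R) - dev n E (Link u R)
      = - s T + c * (1 - h)\<^sup>2 * d T + c * (h * v) * Y" if "T \<in> triangles E" for T
  proof -
    have "real n * (dens n (E - all_edges T))\<^sup>2 = c * (1 - h)\<^sup>2"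
      by (simp add: dens_diff[OF that] c_def power_mult_distrib)
    then have "dev n (E - all_edges T) (Link u R) = (lsum E u R - s T) - c * (1 - h)\<^sup>2 * (Y - d T)"
      by (simp add: s_def d_def Y_def)
    then show ?thesis unfolding dev A_def Y_def[symmetric] hv(3) by (simp add: algebra_simps)
  qed
  have s0: "0 \<le> s T" for T unfolding s_def lsum_drop[OF R(3)] by simp
  have d0: "0 \<le> d T" for T unfolding d_def by (rule cod_drop_nonneg[OF R0])
  have cd: "0 \<le> c * (1 - h)\<^sup>2 * d T" "c * (1 - h)\<^sup>2 * d T \<le> c * d T" for T
  proof -
    show "0 \<le> c * (1 - h)\<^sup>2 * d T" using c_pos d0[of T] by simp
    have "c * (1 - h)\<^sup>2 * d T \<le> c * 1 * d T"
      using c_pos d0[of T] hv by (intro mult_right_mono mult_left_mono) auto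
    then show "c * (1 - h)\<^sup>2 * d T \<le> c * d T" by simp
  qed
  have hx: "h * x \<le> 1/100000000" unfolding x_def by (rule h_np) (use R in auto)
  have cv: "0 \<le> c * (h * v) * Y" "c * (h * v) * Y \<le> 3 * (h * x) * c" "c * (h * v) * Y \<le> 1/10 * c"
  proof -
    show "0 \<le> c * (h * v) * Y" using c_pos hv Y by simp
    have "(h * v) * Y \<le> (2 * h) * (11/10 * x)"
      by (rule mult_mono[OF hv(2) Y(2)]) (use h_pos Y in auto)
    then have "c * ((h * v) * Y) \<le> c * ((2 * h) * (11/10 * x))" using c_pos by (intro mult_left_mono) auto
    also have "\<dots> = 22/10 * (h * x * c)" by simp
    also have "\<dots> \<le> 3 * (h * x * c)" using c_pos h_pos x by (intro mult_right_mono) auto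
    finally show *: "c * (h * v) * Y \<le> 3 * (h * x) * c" by (simp only: mult.assoc)
    have "3 * (h * x) * c \<le> 1/10 * c" using hx c_pos by (intro mult_right_mono) auto
    with * show "c * (h * v) * Y \<le> 1/10 * c" by linarith
  qed
  show "Link u R \<in> vars n" using R by (auto simp: vars_def)
  show "0 < real n * p ^ card R" by (rule np_pos)
  show "(ln (real n))\<^sup>2 \<le> \<beta>\<^sup>2 * (real n * p ^ card R)" by (rule Lsq_le) (use R in auto)
  show "\<bar>dev n (E - all_edges T) (Link u R) - dev n E (Link u R)\<bar>
      \<le> 24 * bnd n E (Link u R) / (\<beta> * (real n * p ^ card R))"
    if T: "T \<in> triangles E" for T
  proof -
    have "10 * c \<le> 24 * coef (Link u R) * c" using co c_pos by (intro mult_right_mono) auto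
    also have "\<dots> = 24 * bnd n E (Link u R) / (\<beta> * (real n * p ^ card R))"
      unfolding b x_def[symmetric] using \<beta>_pos x by simp
    finally have rhs: "10 * c \<le> 24 * bnd n E (Link u R) / (\<beta> * (real n * p ^ card R))" .
    have "d T \<le> 3" unfolding d_def by (rule cod_drop_le[OF R0 T])
    then have "c * d T \<le> c * 3" using c_pos by (intro mult_left_mono) auto
    moreover have "s T \<le> 6 * ((1 + 1/100000000) * c)"
      unfolding s_def by (rule lsum_drop_le[OF R(3) T]) (rule edge_cod(2))
    then have "s T \<le> 61/10 * c" using c_pos by simp
    ultimately have "\<bar>- s T + c * (1 - h)\<^sup>2 * d T + c * (h * v) * Y\<bar> \<le> 10 * c"
      unfolding abs_le_iff using s0[of T] cd[of T] cv c_pos by linarith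
    then show ?thesis unfolding \<Delta>[OF T] using rhs by linarith
  qed
  define SS where "SS = (\<Sum>T\<in>triangles E. s T)"
  define SY where "SY = (\<Sum>T\<in>triangles E. d T)"
  have S: "SY \<le> 4 * x * (h * Q)" "SS \<le> 6 * (x * c) * (h * Q)"
    unfolding SY_def SS_def d_def s_def x_def using Cod_drift(2)[OF R(1) R3] Link_drift(2)[OF R] .
  show "(\<Sum>T\<in>triangles E. \<bar>dev n (E - all_edges T) (Link u R) - dev n E (Link u R)\<bar>)
      \<le> 700 * bnd n E (Link u R) / \<beta> * (h * Q)"
  proof -
    have "(\<Sum>T\<in>triangles E. \<bar>dev n (E - all_edges T) (Link u R) - dev n E (Link u R)\<bar>)
        \<le> (\<Sum>T\<in>triangles E. s T + c * d T + 3 * (h * x) * c)"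
    proof (rule sum_mono)
      fix T assume T: "T \<in> triangles E"
      show "\<bar>dev n (E - all_edges T) (Link u R) - dev n E (Link u R)\<bar> \<le> s T + c * d T + 3 * (h * x) * c"
        unfolding \<Delta>[OF T] abs_le_iff using s0[of T] cd[of T] cv by linarith
    qed
    also have "\<dots> = SS + c * SY + 3 * (x * c) * (h * Q)"
      by (simp add: sum.distrib Q_def SS_def SY_def sum_distrib_left mult_ac)
    also have "\<dots> \<le> 13 * (x * c) * (h * Q)"
    proof -
      have "c * SY \<le> c * (4 * x * (h * Q))" using S c_pos by (intro mult_left_mono) auto
      also have "\<dots> = 4 * (x * c) * (h * Q)" by simp
      finally show ?thesis using S by linarith
    qed
    also have "\<dots> \<le> 700 * coef (Link u R) * (x * c) * (h * Q)"
      using co x c_pos h_pos Q_pos by (intro mult_right_mono) auto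
    also have "\<dots> = 700 * bnd n E (Link u R) / \<beta> * (h * Q)" unfolding b using \<beta>_pos by simp
    finally show ?thesis .
  qed
  show "\<sigma> * (\<Sum>T\<in>triangles E. dev n (E - all_edges T) (Link u R) - dev n E (Link u R))
      \<le> h * Q * (- real (expo (Link u R)) * (\<sigma> * dev n E (Link u R)) + 1474/1000 * bnd n E (Link u R))"
    if big: "99/100 * bnd n E (Link u R) \<le> \<sigma> * dev n E (Link u R)"
  proof -
    define D where "D = (- SS + c * (1 - h)\<^sup>2 * SY) / (h * Q) + c * v * Y"
    define U where "U = p ^ (card R - 1) * (lsum E u {u} - c * cod E {u})"
    define Z where "Z = (\<Sum>w\<in>nb E R. lsum E w {w, u} - c * cod E {w, u}) / c"
    have "(\<Sum>T\<in>triangles E. dev n (E - all_edges T) (Link u R) - dev n E (Link u R))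
        = (\<Sum>T\<in>triangles E. - s T + c * (1 - h)\<^sup>2 * d T + c * (h * v) * Y)"
      by (intro sum.cong refl \<Delta>)
    also have "\<dots> = - SS + c * (1 - h)\<^sup>2 * SY + Q * (c * (h * v) * Y)"
      unfolding sum.distrib sum_negf SS_def SY_def sum_distrib_left[symmetric] by (simp add: Q_def)
    also have "\<dots> = h * Q * D"
      unfolding D_def using h_pos Q_pos by (simp add: distrib_left)
    finally have eq: "(\<Sum>T\<in>triangles E. dev n (E - all_edges T) (Link u R) - dev n E (Link u R)) = h * Q * D" .
    define w where "w = \<beta> * (x * c)"
    have w: "0 < w" using \<beta>_pos x c_pos by (simp add: w_def)
    have drift: "\<bar>D + (real (card R + 2) * A + U + Z)\<bar> \<le> 22/1000 * w"
      using Link_drift(1)[OF R]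
      by (simp only: D_def SS_def SY_def s_def d_def v_def Y_def A_def U_def Z_def x_def w_def mult.assoc)
    have U: "\<bar>U\<bar> \<le> 21/50 * w" and Z: "\<bar>Z\<bar> \<le> (1 + 1/100000000) * w"
      using Link_terms[OF R] by (simp_all only: U_def Z_def x_def w_def mult.assoc)
    have bw: "bnd n E (Link u R) = coef (Link u R) * w" unfolding b by (simp add: w_def)
    have sg: "\<sigma> * y \<le> \<bar>y\<bar>" for y using \<sigma> by (metis abs_ge_self abs_mult mult_1)
    have sgn: "- (\<sigma> * y) \<le> \<bar>y\<bar>" for y using sg[of "- y"] by simp
    have key: "\<sigma> * D \<le> - real (card R + 2) * (\<sigma> * A) + 1474/1000 * (coef (Link u R) * w)"
    proof -
      have "\<sigma> * (D + (real (card R + 2) * A + U + Z)) \<le> 22/1000 * w" using drift sg order_trans by blast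
      moreover have "\<sigma> * (D + (real (card R + 2) * A + U + Z))
          = \<sigma> * D + real (card R + 2) * (\<sigma> * A) + \<sigma> * U + \<sigma> * Z" by (simp add: algebra_simps)
      moreover have "- (\<sigma> * Z) \<le> (1 + 1/100000000) * w" using Z sgn order_trans by blast
      moreover have "(1 + 1/100000000) * w \<le> 1001/1000 * w" using w by (intro mult_right_mono) auto
      ultimately have "\<sigma> * D \<le> - (real (card R + 2) * (\<sigma> * A)) - \<sigma> * U + 1023/1000 * w"
        by linarith
      then have *: "\<sigma> * D \<le> - real (card R + 2) * (\<sigma> * A) - \<sigma> * U + 1023/1000 * w"
        by (simp only: mult_minus_left)
      show ?thesis
      proof (cases "card R = 1")
        \<comment> \<open>For a single vertex \<open>U\<close> is \<open>A\<close> itself, which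
          raises the decay rate from 3 to 4. The driving term 1023/1000 alone exceeds the allowed
          \<open>1474/1000 * 21/50\<close>, about 0.619; because \<open>\<sigma> * A\<close> is at
          least \<open>99/100 * 21/50 * w\<close>, the extra decay brings it down to about
          0.607.\<close>
        case True
        then obtain y where "R = {y}" by (auto simp: card_1_singleton_iff)
        then have UA: "U = A" using R(3) by (simp add: U_def A_def)
        have "99/100 * (21/50 * w) \<le> \<sigma> * A" using big True unfolding bw dev by simp
        moreover have "\<sigma> * D \<le> - 3 * (\<sigma> * A) - \<sigma> * A + 1023/1000 * w" using * True UA by simp
        ultimately have "\<sigma> * D \<le> - 3 * (\<sigma> * A) + 1474/1000 * (21/50 * w)" using w by linarith
        then show ?thesis using True by simp
      next
        \<comment> \<open>With two vertices the coefficient is 1, and 21/50 + 1023/1000 = 1443/1000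
          fits below 1474/1000.\<close>
        case False
        have "- (\<sigma> * U) \<le> 21/50 * w" using U sgn order_trans by blast
        then show ?thesis using * w False by simp
      qed
    qed
    have "h * Q * (\<sigma> * D) \<le> h * Q * (- real (card R + 2) * (\<sigma> * A) + 1474/1000 * (coef (Link u R) * w))"
      using key h_pos Q_pos by (intro mult_left_mono) auto
    then show ?thesis unfolding eq bw unfolding dev by (simp only: mult.left_commute expo.simps)
  qed
qed

lemma var_step:
  assumes "v \<in> vars n" "\<bar>\<sigma>\<bar> = 1"
  shows "(\<Sum>T\<in>triangles E. exp (M * (\<sigma> * dev n (E - all_edges T) v / bnd n (E - all_edges T) v - 1)))
      / card (triangles E) \<le> exp (M * (\<sigma> * dev n E v / bnd n E v - 1)) + exp (- M / 200)"
proof (cases v)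
  case Tri then show ?thesis using Tri_step assms by simp
next
  case (Cod R) then show ?thesis using Cod_step assms by (auto simp: vars_def)
next
  case (Link u R) then show ?thesis using Link_step assms by (auto simp: vars_def)
qed

end

section \<open>The complete graph and the conclusion\<close>

definition potential :: "nat \<Rightarrow> graph \<Rightarrow> real" where
  "potential n E = (\<Sum>v\<in>vars n. \<Sum>\<sigma>\<in>{1, -1}.
     exp (4000 * ln (real n) * (\<sigma> * dev n E v / bnd n E v - 1)))"

lemma choose_le_pow: "n choose k \<le> n ^ k"
  by (cases "k \<le> n") (auto simp: binomial_le_pow binomial_eq_0)

lemma finite_vars: "finite (vars n)"
  and card_vars: "1 \<le> n \<Longrightarrow> real (card (vars n)) \<le> 6 * real n ^ 3"
proof -
  define S where "S k = {R. R \<subseteq> {1..n} \<and> card R = k}" for k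
  have finS: "finite (S k)" for k unfolding S_def by (rule finite_subset[of _ "Pow {1..n}"]) auto
  have cardS: "real (card (S k)) \<le> real n ^ k" for k
  proof -
    have "card (S k) = n choose k" using n_subsets[of "{1..n}" k] by (simp add: S_def)
    also have "\<dots> \<le> n ^ k" by (rule choose_le_pow)
    finally show ?thesis by (metis of_nat_le_iff of_nat_power)
  qed
  let ?A = "Cod ` (S 1 \<union> S 2 \<union> S 3)"
  let ?B = "(\<lambda>(u, R). Link u R) ` ({1..n} \<times> (S 1 \<union> S 2))"
  have sub: "vars n \<subseteq> {Tri} \<union> ?A \<union> ?B" by (auto simp: vars_def S_def)
  have fin: "finite ({Tri} \<union> ?A \<union> ?B)" using finS by auto
  show "finite (vars n)" by (rule finite_subset[OF sub fin])
  assume n: "1 \<le> n"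
  have pw: "real n ^ k \<le> real n ^ 3" if "k \<le> 3" for k
    using n that by (intro power_increasing) auto
  have "card (vars n) \<le> card ({Tri} \<union> ?A \<union> ?B)" by (rule card_mono[OF fin sub])
  also have "\<dots> \<le> 1 + card ?A + card ?B"
    using card_Un_le[of "{Tri} \<union> ?A" ?B] card_Un_le[of "{Tri}" ?A] by simp
  also have "\<dots> \<le> 1 + card (S 1 \<union> S 2 \<union> S 3) + card ({1..n} \<times> (S 1 \<union> S 2))"
    by (intro add_mono card_image_le le_refl) (use finS in auto)
  also have "\<dots> \<le> 1 + (card (S 1) + card (S 2) + card (S 3)) + n * (card (S 1) + card (S 2))"
  proof -
    have "card (S 1 \<union> S 2) \<le> card (S 1) + card (S 2)" by (rule card_Un_le)
    moreover have "card (S 1 \<union> S 2 \<union> S 3) \<le> card (S 1 \<union> S 2) + card (S 3)" by (rule card_Un_le)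
    moreover have "card ({1..n} \<times> (S 1 \<union> S 2)) = n * card (S 1 \<union> S 2)"
      by (simp add: card_cartesian_product)
    ultimately show ?thesis by (simp add: add_mono mult_left_mono)
  qed
  finally have "real (card (vars n)) \<le> real (1 + (card (S 1) + card (S 2) + card (S 3)) + n * (card (S 1) + card (S 2)))"
    by (simp only: of_nat_le_iff)
  also have "\<dots> = 1 + (real (card (S 1)) + real (card (S 2)) + real (card (S 3)))
      + real n * (real (card (S 1)) + real (card (S 2)))" by simp
  also have "\<dots> \<le> 1 + (real n ^ 1 + real n ^ 2 + real n ^ 3) + real n * (real n ^ 1 + real n ^ 2)"
    by (intro add_mono mult_left_mono cardS) auto
  also have "\<dots> = 1 + real n ^ 1 + 2 * real n ^ 2 + 2 * real n ^ 3"
    by (simp add: power2_eq_square power3_eq_cube algebra_simps)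
  also have "\<dots> \<le> 6 * real n ^ 3"
  proof -
    have "real n ^ 0 \<le> real n ^ 3" "real n ^ 1 \<le> real n ^ 3" "real n ^ 2 \<le> real n ^ 3"
      by (rule pw, simp)+
    then show ?thesis unfolding power_0 by linarith
  qed
  finally show "real (card (vars n)) \<le> 6 * real n ^ 3" .
qed

lemma bnd_positive:
  assumes "0 < dens n E" "1 < real n"
  shows "0 < bnd n E v"
proof -
  have "0 < coef v" by (cases v) auto
  moreover have "0 < base n v" using assms by (cases v) auto
  moreover have "0 < rel_err n E" using assms by (simp add: rel_err_def)
  ultimately show ?thesis using assms by (simp add: bnd_def)
qed

lemma potential_nonneg: "0 \<le> potential n E"
  unfolding potential_def by (intro sum_nonneg) auto

lemma potential_ge_1:
  assumes v: "v \<in> vars n" "bnd n E v < \<bar>dev n E v\<bar>" and pos: "0 < dens n E" "1 < real n"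
  shows "1 \<le> potential n E"
proof -
  have b: "0 < bnd n E v" by (rule bnd_positive[OF pos])
  define \<sigma> :: real where "\<sigma> = (if 0 \<le> dev n E v then 1 else -1)"
  have "\<sigma> * dev n E v = \<bar>dev n E v\<bar>" by (simp add: \<sigma>_def)
  then have "1 \<le> \<sigma> * dev n E v / bnd n E v" using v b by (simp add: le_divide_eq)
  then have "1 \<le> exp (4000 * ln (real n) * (\<sigma> * dev n E v / bnd n E v - 1))" using pos by simp
  also have "\<dots> \<le> (\<Sum>\<sigma>\<in>{1, -1}. exp (4000 * ln (real n) * (\<sigma> * dev n E v / bnd n E v - 1)))"
    by (rule member_le_sum) (auto simp: \<sigma>_def)
  also have "\<dots> \<le> potential n E"
    unfolding potential_def by (rule member_le_sum[OF v(1)]) (auto simp: finite_vars intro!: sum_nonneg)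
  finally show ?thesis .
qed

lemma (in good_graph) potential_step:
  "(\<Sum>T\<in>triangles E. potential n (E - all_edges T)) / card (triangles E)
    \<le> potential n E + card (vars n) * (2 * exp (- M / 200))"
proof -
  let ?f = "\<lambda>F v \<sigma>. exp (M * (\<sigma> * dev n F v / bnd n F v - 1))"
  have pot: "potential n F = (\<Sum>v\<in>vars n. \<Sum>\<sigma>\<in>{1, -1}. ?f F v \<sigma>)" for F
    by (simp only: potential_def M_def)
  have "(\<Sum>T\<in>triangles E. potential n (E - all_edges T))
      = (\<Sum>v\<in>vars n. \<Sum>\<sigma>\<in>{1, -1}. \<Sum>T\<in>triangles E. ?f (E - all_edges T) v \<sigma>)"
    unfolding pot by (subst sum.swap, intro sum.cong refl, rule sum.swap)
  then have "(\<Sum>T\<in>triangles E. potential n (E - all_edges T)) / card (triangles E)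
      = (\<Sum>v\<in>vars n. \<Sum>\<sigma>\<in>{1, -1}. (\<Sum>T\<in>triangles E. ?f (E - all_edges T) v \<sigma>) / card (triangles E))"
    by (simp only: sum_divide_distrib)
  also have "\<dots> \<le> (\<Sum>v\<in>vars n. \<Sum>\<sigma>\<in>{1, -1}. ?f E v \<sigma> + exp (- M / 200))"
    by (intro sum_mono var_step) auto
  also have "\<dots> = potential n E + card (vars n) * (2 * exp (- M / 200))"
    unfolding pot by (simp only: sum.distrib) simp
  finally show ?thesis .
qed

section \<open>Deviations in the complete graph\<close>

lemma triangles_complete: "triangles (all_edges V) = {T. T \<subseteq> V \<and> card T = 3}"
proof -
  have "all_edges T \<subseteq> all_edges V \<longleftrightarrow> T \<subseteq> V" if "card T = 3" for T
  proof
    assume "all_edges T \<subseteq> all_edges V"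
    then have "\<Union> (all_edges T) \<subseteq> V" by (auto simp: all_edges_def)
    then show "T \<subseteq> V" using Union_all_edges[OF that] by simp
  qed (auto simp: all_edges_def)
  then show ?thesis by (auto simp: triangles_def)
qed

lemma cod_complete:
  assumes "R \<subseteq> {1..n}" "R \<noteq> {}"
  shows "cod (all_edges {1..n}) R = real n - real (card R)" "nb (all_edges {1..n}) R = {1..n} - R"
proof -
  show nb: "nb (all_edges {1..n}) R = {1..n} - R"
  proof
    show "nb (all_edges {1..n}) R \<subseteq> {1..n} - R"
      using assms by (auto simp: nb_def all_edges_def)
    show "{1..n} - R \<subseteq> nb (all_edges {1..n}) R"
      using assms by (auto simp: nb_def all_edges_def card_insert_if)
  qed
  have "card R \<le> n" using card_mono[OF _ assms(1)] by simp
  then show "cod (all_edges {1..n}) R = real n - real (card R)"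
    unfolding cod_def nb using assms finite_subset[OF assms(1)] by (subst card_Diff_subset) auto
qed

lemma dens_complete:
  assumes "1 \<le> n"
  shows "dens n (all_edges {1..n}) = 1 - 1 / real n"
proof -
  have "real (n choose 2) = real n * (real n - 1) / 2"
    using assms by (simp add: choose_two real_of_nat_div)
  then show ?thesis using assms unfolding dens_def card_all_edges_interval
    by (simp add: power2_eq_square field_simps)
qed

text \<open>At density \<open>1 - 1/n\<close> codegrees and link sums deviate by a bounded amount
  and the triangle count by \<open>(n - 1) / 6\<close>, whereas the bounds have order
  \<open>L * sqrt n\<close>, \<open>L * n powr (3/2)\<close> and
  \<open>L * n powr (5/2)\<close>.\<close>

lemma dev_complete:
  assumes n: "100 \<le> n" "1000 \<le> ln (real n)" and v: "v \<in> vars n"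
  shows "\<bar>dev n (all_edges {1..n}) v\<bar> \<le> bnd n (all_edges {1..n}) v / 2"
proof -
  let ?K = "all_edges {1..n}"
  define p where "p = dens n ?K"
  have p: "p = 1 - 1 / real n" unfolding p_def using n by (intro dens_complete) auto
  have np: "real n * p = real n - 1" using n by (simp add: p field_simps)
  have p2: "1/2 \<le> p" "p \<le> 1" using n by (auto simp: p field_simps)
  have err: "1000 \<le> rel_err n ?K * sqrt (real n)"
  proof -
    have "real n * p ^ 3 \<le> real n * 1" using p2 by (intro mult_left_mono power_le_one) auto
    then have le: "sqrt (real n * p ^ 3) \<le> sqrt (real n)" by simp
    have "0 < real n * p ^ 3" using n p2 by simp
    then have "ln (real n) / sqrt (real n) \<le> ln (real n) / sqrt (real n * p ^ 3)"
      using le n by (intro divide_left_mono) auto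
    then have "ln (real n) / sqrt (real n) * sqrt (real n) \<le> rel_err n ?K * sqrt (real n)"
      unfolding rel_err_def p_def[symmetric] by (intro mult_right_mono) auto
    then show ?thesis using n by simp
  qed
  have sn: "1 \<le> sqrt (real n)" using n by simp
  have ss: "sqrt (real n) * sqrt (real n) = real n" by simp
  have e0: "0 \<le> rel_err n ?K" unfolding rel_err_def p_def[symmetric] using n p2 by simp
  have errn: "1000 \<le> rel_err n ?K * real n"
  proof -
    have "1000 * 1 \<le> (rel_err n ?K * sqrt (real n)) * sqrt (real n)"
      using err sn by (intro mult_mono) auto
    then show ?thesis by (simp add: mult.assoc ss)
  qed
  have low: "base n v * p ^ expo v \<ge> base n v / 16"
  proof -
    have "(1/2)^4 \<le> (1/2::real) ^ expo v" using v by (intro power_decreasing) (auto simp: vars_def)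
    also have "\<dots> \<le> p ^ expo v" using p2 by (intro power_mono) auto
    finally have "1/16 \<le> p ^ expo v" by (simp add: power4_eq_xxxx)
    moreover have "0 \<le> base n v" by (cases v) auto
    ultimately have "base n v * (1/16) \<le> base n v * p ^ expo v" by (intro mult_left_mono)
    then show ?thesis by simp
  qed
  have cf: "1/100 \<le> coef v" by (cases v) auto
  have b: "bnd n ?K v \<ge> 1/100 * (base n v / 16) * rel_err n ?K"
    unfolding bnd_def p_def[symmetric] using low cf e0
    by (intro mult_right_mono mult_mono) (cases v; auto)+
  show ?thesis
  proof (cases v)
    case Tri
    have "real (n choose 3) = real n * (real n - 1) * (real n - 2) / 6"
      using n by (simp add: binomial_gbinomial gbinomial_prod_rev eval_nat_numeral fact_numeral algebra_simps lessThan_Suc)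
    moreover have "card (triangles ?K) = n choose 3"
      using n_subsets[of "{1..n}" 3] by (simp add: triangles_complete)
    moreover have "real n ^ 3 * p ^ 3 = (real n - 1) ^ 3" unfolding power_mult_distrib[symmetric] np ..
    ultimately have "dev n ?K v = real n * (real n - 1) * (real n - 2) / 6 - (real n - 1) ^ 3 / 6"
      unfolding Tri dev.simps base.simps p_def[symmetric] by simp
    also have "\<dots> = - (real n - 1) / 6"
      by (simp add: power3_eq_cube field_simps)
    finally have "\<bar>dev n ?K v\<bar> \<le> real n" using n by simp
    also have "real n \<le> (1/100 * (real n ^ 3 / 6 / 16) * rel_err n ?K) / 2"
    proof -
      have "1000 * (real n * 100) \<le> (rel_err n ?K * real n) * (real n * real n)"
        using errn n by (intro mult_mono) auto
      then show ?thesis by (simp add: power3_eq_cube mult_ac)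
    qed
    also have "\<dots> \<le> bnd n ?K v / 2" using b by (simp add: Tri)
    finally show ?thesis .
  next
    case (Cod R)
    have R: "R \<subseteq> {1..n}" "card R \<in> {1, 2, 3}" using v Cod by (auto simp: vars_def)
    then have "R \<noteq> {}" by auto
    note cod = cod_complete(1)[OF R(1) this]
    have inv: "1 / real n \<le> 1/100" "0 \<le> 1 / real n" "3 / real n \<le> 3/100" "0 \<le> 3 / real n"
      using n by (auto simp: field_simps)
    have "real n * p ^ card R = real n - card R \<or> real n * p ^ card R = real n - card R + 1 / real n
        \<or> real n * p ^ card R = real n - card R + 3 / real n - 1 / (real n)\<^sup>2"
      using R(2) n by (auto simp: p power2_eq_square power3_eq_cube field_simps)
    moreover have "0 \<le> 1 / (real n)\<^sup>2" "1 / (real n)\<^sup>2 \<le> 1" using n by auto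
    ultimately have "\<bar>dev n ?K v\<bar> \<le> 2"
      unfolding Cod dev.simps cod p_def[symmetric] using inv by (elim disjE; linarith)
    moreover have "10000 / 1600 * 1 \<le> bnd n ?K v"
    proof -
      have "1000 * 10 \<le> (rel_err n ?K * sqrt (real n)) * sqrt (real n)"
        using err n by (intro mult_mono real_le_rsqrt) auto
      then have "10000 \<le> rel_err n ?K * real n" by (simp add: mult.assoc ss)
      also have "\<dots> \<le> 1600 * bnd n ?K v" using b by (simp add: Cod mult.commute)
      finally show ?thesis by simp
    qed
    ultimately show ?thesis by simp
  next
    case (Link u R)
    have R: "R \<subseteq> {1..n}" "card R \<in> {1, 2}" "u \<in> R" using v Link by (auto simp: vars_def)
    then have "R \<noteq> {}" by auto
    note cod = cod_complete[OF R(1) this]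
    have "lsum ?K u R = (\<Sum>w\<in>{1..n} - R. real n - 2)"
      unfolding lsum_def cod(2)
    proof (rule sum.cong[OF refl])
      fix w assume "w \<in> {1..n} - R"
      then have "u \<noteq> w" "{u, w} \<subseteq> {1..n}" using R(1,3) by auto
      then have "{u, w} \<subseteq> {1..n}" "card {u, w} = 2" by auto
      then show "cod ?K {u, w} = real n - 2" using cod_complete(1)[of "{u, w}" n] by simp
    qed
    also have "\<dots> = cod ?K R * (real n - 2)" unfolding cod_def cod(2) by simp
    finally have ls: "lsum ?K u R = (real n - card R) * (real n - 2)" unfolding cod(1) .
    have c: "real n * p\<^sup>2 = real n - 2 + 1 / real n"
      using n by (simp add: p power2_eq_square field_simps)
    have "dev n ?K v = - (real n - card R) / real n"
      unfolding Link dev.simps ls cod(1) p_def[symmetric] c by (simp add: algebra_simps diff_divide_distrib)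
    moreover have "card R \<le> n" using card_mono[OF _ R(1)] by simp
    ultimately have "\<bar>dev n ?K v\<bar> \<le> 1" using n by (simp add: abs_le_iff divide_le_eq le_divide_eq)
    moreover have "2 \<le> bnd n ?K v"
    proof -
      have "1000 * 100 \<le> (rel_err n ?K * real n) * real n"
        using errn n by (intro mult_mono) auto
      then show ?thesis using b by (simp add: Link power2_eq_square mult_ac)
    qed
    ultimately show ?thesis by simp
  qed
qed

text \<open>Half the bound would give the exponent \<open>- M / 2\<close>; the weaker
  \<open>- M / 200\<close> makes the initial potential at most the additive term of a single
  step.\<close>

lemma potential_complete:
  assumes n: "100 \<le> n" "1000 \<le> ln (real n)"
  shows "potential n (all_edges {1..n}) \<le> card (vars n) * (2 * exp (- (4000 * ln (real n)) / 200))"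
proof -
  let ?K = "all_edges {1..n}"
  have dens: "0 < dens n ?K" using n dens_complete[of n] by simp
  have "exp (4000 * ln (real n) * (\<sigma> * dev n ?K v / bnd n ?K v - 1)) \<le> exp (- (4000 * ln (real n)) / 200)"
    if v: "v \<in> vars n" and \<sigma>: "\<sigma> \<in> {1, -1}" for v \<sigma>
  proof -
    have b: "0 < bnd n ?K v" by (rule bnd_positive[OF dens]) (use n in simp)
    have "\<sigma> * dev n ?K v \<le> \<bar>dev n ?K v\<bar>" using \<sigma> by auto
    also have "\<dots> \<le> bnd n ?K v / 2" by (rule dev_complete[OF n v])
    finally have "\<sigma> * dev n ?K v / bnd n ?K v \<le> 1/2" using b by (simp add: divide_le_eq)
    then have "4000 * ln (real n) * (\<sigma> * dev n ?K v / bnd n ?K v - 1) \<le> 4000 * ln (real n) * (- 1/200)"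
      using n by (intro mult_left_mono) auto
    then show ?thesis by simp
  qed
  then have "potential n ?K \<le> (\<Sum>v\<in>vars n. \<Sum>\<sigma>\<in>{1, -1::real}. exp (- (4000 * ln (real n)) / 200))"
    unfolding potential_def by (intro sum_mono) auto
  then show ?thesis by simp
qed

text \<open>The assumption means that the density exceeds \<open>2 * n powr (-1/3) * L ^ 4\<close>;
  its cube times \<open>n\<close> exceeds \<open>8 * L ^ 12\<close>.\<close>

lemma dens_large:
  assumes n: "1 < n" and E: "real n powr (5/3) * ln (real n) ^ 4 < real (card E)"
  shows "ln (real n) ^ 12 \<le> real n * dens n E ^ 3"
proof -
  define a where "a = real n powr (5/3) * ln (real n) ^ 4"
  have n0: "0 < real n" using n by simp
  have a3: "a ^ 3 = real n ^ 5 * ln (real n) ^ 12"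
  proof -
    have "(real n powr (5/3)) ^ 3 = (real n powr (5/3)) powr 3"
      using powr_realpow[of "real n powr (5/3)" 3] n0 by simp
    also have "\<dots> = real n powr 5" by (simp add: powr_powr)
    also have "\<dots> = real n ^ 5" using powr_realpow[OF n0, of 5] by simp
    finally have "(real n powr (5/3)) ^ 3 = real n ^ 5" .
    then show ?thesis by (simp add: a_def power_mult_distrib power_mult[symmetric])
  qed
  have a0: "0 \<le> a" unfolding a_def by simp
  have "a ^ 3 \<le> real (card E) ^ 3" using E a0 unfolding a_def[symmetric] by (intro power_mono) auto
  then have "8 * (real n * (a ^ 3 / real n ^ 6)) \<le> 8 * (real n * (real (card E) ^ 3 / real n ^ 6))"
    using n0 by (intro mult_left_mono divide_right_mono) auto
  also have "\<dots> = real n * dens n E ^ 3"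
    by (simp add: dens_def power_divide power_mult_distrib power_mult[symmetric])
  finally have "8 * (real n * (a ^ 3 / real n ^ 6)) \<le> real n * dens n E ^ 3" .
  moreover have "real n * (a ^ 3 / real n ^ 6) = ln (real n) ^ 12"
    using n0 unfolding a3 by (simp add: power_numeral_reduce)
  moreover have "0 \<le> ln (real n) ^ 12" by simp
  ultimately show ?thesis by linarith
qed

text \<open>At most \<open>6 * n ^ 3\<close> quantities with two signs each give
  \<open>\<delta> \<le> 12 / n ^ 17\<close>, which is paid once at the start and once for each of at
  most \<open>n\<^sup>2\<close> steps.\<close>

lemma fail_prob:
  assumes L: "1000000000000 \<le> ln (real n)"
  shows "measure_pmf.prob (triangle_packing_process n)
      {G. real n powr (5/3) * ln (real n) ^ 4 < real (card (G ! num_steps G))} \<le> 24 / real n"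
proof -
  let ?K = "all_edges {1..n}"
  define \<delta> where "\<delta> = card (vars n) * (2 * exp (- (4000 * ln (real n)) / 200))"
  have "n > 0" using L by (cases n) auto
  then have "ln (real n) \<le> real n - 1" by (intro ln_le_minus_one) auto
  then have n: "1000 \<le> real n" using L by linarith
  have pos: "0 < dens n E" if "real n powr (5/3) * ln (real n) ^ 4 < real (card E)" for E
  proof -
    have "0 \<le> real n powr (5/3) * ln (real n) ^ 4" by simp
    then have "0 < real (card E)" using that by linarith
    then show ?thesis using n by (simp add: dens_def)
  qed
  have gg: "good_graph n E"
    if "E \<subseteq> ?K" "real n powr (5/3) * ln (real n) ^ 4 < real (card E)"
      "\<forall>v\<in>vars n. \<bar>dev n E v\<bar> \<le> bnd n E v" for E
    by unfold_locales (use that L n dens_large[of n E] in auto)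
  have "measure_pmf.prob (trajectory ?K)
      {G. real n powr (5/3) * ln (real n) ^ 4 < real (card (G ! num_steps G))}
    \<le> potential n ?K + real (card ?K) * \<delta>"
  \<comment> \<open>The invariant is only that \<open>E\<close> is a graph on \<open>{1..n}\<close>.
    The bounds on the deviations form \<open>good\<close>, whose failure the potential
    detects.\<close>
  proof (rule trajectory_fail_bound[where Inv = "\<lambda>E. E \<subseteq> ?K"
        and good = "\<lambda>E. \<forall>v\<in>vars n. \<bar>dev n E v\<bar> \<le> bnd n E v"])
    show "1 \<le> potential n E" if "real n powr (5/3) * ln (real n) ^ 4 < real (card E)"
      "\<not> (\<forall>v\<in>vars n. \<bar>dev n E v\<bar> \<le> bnd n E v)" for E
      using that potential_ge_1[of _ n E] pos[of E] n by force
    show "triangles E \<noteq> {}"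
      if "E \<subseteq> ?K" "real n powr (5/3) * ln (real n) ^ 4 < real (card E)"
        "\<forall>v\<in>vars n. \<bar>dev n E v\<bar> \<le> bnd n E v" for E
      using good_graph.triangles_nonempty[OF gg[OF that]] .
    show "(\<Sum>T\<in>triangles E. potential n (E - all_edges T)) / card (triangles E) \<le> potential n E + \<delta>"
      if "E \<subseteq> ?K" "real n powr (5/3) * ln (real n) ^ 4 < real (card E)"
        "\<forall>v\<in>vars n. \<bar>dev n E v\<bar> \<le> bnd n E v" for E
      using good_graph.potential_step[OF gg[OF that]]
      by (simp add: \<delta>_def good_graph.M_def[OF gg[OF that]])
  qed (auto simp: potential_nonneg \<delta>_def finite_all_edges)
  also have "\<dots> \<le> \<delta> + real n ^ 2 * \<delta>"
  proof (intro add_mono mult_right_mono)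
    show "potential n ?K \<le> \<delta>" unfolding \<delta>_def by (rule potential_complete) (use L n in auto)
    have "n choose 2 \<le> n ^ 2" by (rule choose_le_pow)
    then show "real (card ?K) \<le> real n ^ 2" unfolding card_all_edges_interval
      by (metis of_nat_le_iff of_nat_power)
  qed (simp add: \<delta>_def)
  also have "\<dots> \<le> 24 / real n"
  proof -
    have "exp (- (4000 * ln (real n)) / 200) = exp (- real 20 * ln (real n))" by simp
    also have "\<dots> = 1 / real n ^ 20"
      using n exp_of_nat_mult[of 20 "ln (real n)"] by (simp add: exp_minus field_simps)
    finally have "\<delta> \<le> 6 * real n ^ 3 * (2 * (1 / real n ^ 20))"
      unfolding \<delta>_def using card_vars[of n] n by (intro mult_mono) auto
    also have "\<dots> = 12 / real n ^ 17" using n by (simp add: field_simps power_add[symmetric])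
    finally have d: "\<delta> \<le> 12 / real n ^ 17" .
    have "\<delta> + real n ^ 2 * \<delta> = (1 + real n ^ 2) * \<delta>" by (simp add: algebra_simps)
    also have "\<dots> \<le> (2 * real n ^ 2) * (12 / real n ^ 17)"
      using d n one_le_power[of "real n" 2] by (intro mult_mono) (auto simp: \<delta>_def)
    also have "\<dots> = 24 / real n ^ 15" using n by (simp add: field_simps power_add[symmetric])
    also have "\<dots> \<le> 24 / real n ^ 1"
      using n by (intro divide_left_mono power_increasing) auto
    finally show ?thesis by simp
  qed
  finally show ?thesis by (simp add: triangle_packing_process_def)
qed

theorem theorem1:
  "\<exists>C::real. C > 0 \<and>
     (\<lambda>n. measure_pmf.prob (triangle_packing_process n)
            {G. real (card (G ! num_steps G)) \<le> C * real n powr (5/3) * (ln (real n)) ^ 4})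
       \<longlonglongrightarrow> 1"
proof (intro exI[of _ "1::real"] conjI)
  let ?P = "\<lambda>n. measure_pmf.prob (triangle_packing_process n)
     {G. real (card (G ! num_steps G)) \<le> 1 * real n powr (5/3) * (ln (real n)) ^ 4}"
  have "filterlim (\<lambda>n. ln (real n)) at_top sequentially"
    by (rule filterlim_compose[OF ln_at_top filterlim_real_sequentially])
  then have ev: "\<forall>\<^sub>F n in sequentially. 1000000000000 \<le> ln (real n)"
    by (simp add: filterlim_at_top)
  have low: "\<forall>\<^sub>F n in sequentially. 1 - 24 / real n \<le> ?P n"
    using ev
  proof eventually_elim
    case (elim n)
    have "?P n = 1 - measure_pmf.prob (triangle_packing_process n)
        {G. real n powr (5/3) * ln (real n) ^ 4 < real (card (G ! num_steps G))}"
      by (subst measure_pmf.prob_compl[symmetric]) (auto intro!: arg_cong[where f = "measure_pmf.prob _"])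
    then show ?case using fail_prob[OF elim] by linarith
  qed
  have "(\<lambda>n. 1 - 24 / real n) \<longlonglongrightarrow> 1 - 0"
    by (intro tendsto_diff tendsto_const tendsto_divide_0[OF tendsto_const] filterlim_at_top_imp_at_infinity filterlim_real_sequentially)
  then show "?P \<longlonglongrightarrow> 1"
    by (intro tendsto_sandwich[OF low _ _ tendsto_const]) auto
qed simp

end
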